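(* Let $a:\mathbb{R}\to\mathbb{R}$ be continuous, fix $x_0\in\mathbb{R}$, and let $\mathcal{E}(x)=\exp\big[-\int_{x_0}^xa(y)\,dy\big]$. Fix $0<\alpha<1$, $1<p<1/\alpha$, $1/q=1/p-\alpha$, and $\omega\in A_{p,q}^-$. Then, for any $f\in L^p(\mathcal{E}^{-p}\omega^p)$, $$f(x)=\lim_{\varepsilon\to0^+}(\mathfrak{D}_{\mathrm{left},a})^\alpha_\varepsilon(\mathfrak{D}_{\mathrm{left},a})^{-\alpha}f(x)$$ for a.e. $x\in\mathbb{R}$ and in $L^p(\mathcal{E}^{-p}\omega^p)$.
   Context: The negative fractional power is $$(\mathfrak{D}_{\mathrm{left},a})^{-\alpha}f(x)=\frac{1}{\Gamma(\alpha)}\int_0^\infty e^{-t\mathfrak{D}_{\mathrm{left},a}}f(x)\,\frac{dt}{t^{1-\alpha}}=\frac{1}{\Gamma(\alpha)}\mathcal{E}(x)\int_{-\infty}^x\frac{(\mathcal{E}^{-1}f)(t)}{(x-t)^{1-\alpha}}\,dt,$$ where $e^{-t\mathfrak{D}_{\mathrm{left},a}}f(x)=\exp\big[-\int_{x-t}^xa(y)\,dy\big]f(x-t)$. The truncated fractional operator is, for $\varepsilon>0$, $$(\mathfrak{D}_{\mathrm{left},a})^\alpha_\varepsilon u(x)=c_\alpha\,\mathcal{E}(x)\int_{-\infty}^{x-\varepsilon}\frac{(\mathcal{E}^{-1}u)(x)-(\mathcal{E}^{-1}u)(t)}{(x-t)^{1+\alpha}}\,dt,\qquad c_\alpha=\frac{1}{|\Gamma(-\alpha)|}.$$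 For $1<p,q<\infty$, a weight $\omega$ (positive measurable function on $\mathbb{R}$) is in $A_{p,q}^-$ if there is $C>0$ with $\big(\frac1h\int_x^{x+h}\omega(y)^q\,dy\big)^{1/q}\big(\frac1h\int_{x-h}^x\omega(y)^{-p'}\,dy\big)^{1/p'}\le C$ for all $x\in\mathbb{R}$ and $h>0$, where $1/p+1/p'=1$. $L^p(\mathcal{E}^{-p}\omega^p)$ is the $L^p$ space with respect to $\mathcal{E}^{-p}\omega^p\,dx$. *)

theory Defs
  imports "HOL-Analysis.Analysis"
begin

text \<open>
  Integrals of functions in weighted Lebesgue spaces are taken over the completed measure
  \<^const>\<open>lebesgue\<close>, since such functions are only Lebesgue measurable (the Bochner integral over
  \<^const>\<open>lborel\<close> of a function that is not Borel measurable is 0 by convention).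
  \<open>LBINT y=u..v\<close> is the oriented integral, so that it changes sign when \<open>v < u\<close>.
\<close>

definition integrating_factor :: "(real \<Rightarrow> real) \<Rightarrow> real \<Rightarrow> real \<Rightarrow> real" where
  "integrating_factor a x0 x = exp (- (LBINT y=x0..x. a y))"

definition left_semigroup :: "(real \<Rightarrow> real) \<Rightarrow> real \<Rightarrow> (real \<Rightarrow> real) \<Rightarrow> real \<Rightarrow> real" where
  "left_semigroup a t f x = exp (- (LBINT y=x-t..x. a y)) * f (x - t)"

definition left_neg_power :: "(real \<Rightarrow> real) \<Rightarrow> real \<Rightarrow> (real \<Rightarrow> real) \<Rightarrow> real \<Rightarrow> real" where
  "left_neg_power a \<alpha> f x =
     1 / Gamma \<alpha> * (LINT t:{0<..}|lebesgue. left_semigroup a t f x / t powr (1 - \<alpha>))"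

definition left_trunc_power ::
    "(real \<Rightarrow> real) \<Rightarrow> real \<Rightarrow> real \<Rightarrow> real \<Rightarrow> (real \<Rightarrow> real) \<Rightarrow> real \<Rightarrow> real" where
  "left_trunc_power a x0 \<alpha> \<epsilon> u x =
     1 / \<bar>Gamma (- \<alpha>)\<bar> * integrating_factor a x0 x *
     (LINT t:{..x - \<epsilon>}|lebesgue.
        (u x / integrating_factor a x0 x - u t / integrating_factor a x0 t)
          / (x - t) powr (1 + \<alpha>))"

definition conj_exponent :: "real \<Rightarrow> real" where
  "conj_exponent p = 1 / (1 - 1 / p)"

text \<open>
  The integrals in the weight condition are integrals of positive functions with values in
  \<open>[0, \<infinity>]\<close>. As \<open>\<omega> > 0\<close>, neither factor vanishes, so a finite bound on the product forces both
  integrals to be finite; this is what the two integrability clauses record.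
\<close>

definition A_minus :: "real \<Rightarrow> real \<Rightarrow> (real \<Rightarrow> real) set" where
  "A_minus p q = {\<omega>. \<omega> \<in> borel_measurable lebesgue \<and> (\<forall>x. \<omega> x > 0) \<and>
     (\<exists>C>0. \<forall>x. \<forall>h>0.
        set_integrable lebesgue {x..x+h} (\<lambda>y. \<omega> y powr q) \<and>
        set_integrable lebesgue {x-h..x} (\<lambda>y. \<omega> y powr (- conj_exponent p)) \<and>
        (1 / h * (LINT y:{x..x+h}|lebesgue. \<omega> y powr q)) powr (1 / q) *
        (1 / h * (LINT y:{x-h..x}|lebesgue. \<omega> y powr (- conj_exponent p)))
          powr (1 / conj_exponent p) \<le> C)}"

definition Lp_space :: "'a measure \<Rightarrow> real \<Rightarrow> ('a \<Rightarrow> real) set" where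
  "Lp_space M p = {f \<in> borel_measurable M. integrable M (\<lambda>x. \<bar>f x\<bar> powr p)}"

definition Lp_norm :: "'a measure \<Rightarrow> real \<Rightarrow> ('a \<Rightarrow> real) \<Rightarrow> real" where
  "Lp_norm M p f = (LINT x|M. \<bar>f x\<bar> powr p) powr (1 / p)"

definition tendsto_Lp ::
    "'a measure \<Rightarrow> real \<Rightarrow> ('b \<Rightarrow> 'a \<Rightarrow> real) \<Rightarrow> ('a \<Rightarrow> real) \<Rightarrow> 'b filter \<Rightarrow> bool" where
  "tendsto_Lp M p g f F \<longleftrightarrow>
     f \<in> Lp_space M p \<and> (\<forall>\<^sub>F i in F. g i \<in> Lp_space M p) \<and>
     ((\<lambda>i. Lp_norm M p (\<lambda>x. g i x - f x)) \<longlongrightarrow> 0) F"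

definition weighted_measure ::
    "(real \<Rightarrow> real) \<Rightarrow> real \<Rightarrow> real \<Rightarrow> (real \<Rightarrow> real) \<Rightarrow> real measure" where
  "weighted_measure a x0 p \<omega> =
     density lebesgue (\<lambda>x. ennreal (integrating_factor a x0 x powr (- p) * \<omega> x powr p))"

lemma integrating_factor_quotient:
  assumes "continuous_on UNIV a"
  shows "integrating_factor a x0 x / integrating_factor a x0 t = exp (- (LBINT y=t..x. a y))"
proof -
  have "isCont a y" for y
    using assms by (simp add: continuous_on_eq_continuous_at)
  then have "interval_lebesgue_integrable lborel (min (ereal x0) (min (ereal t) (ereal x)))
      (max (ereal x0) (max (ereal t) (ereal x))) a"
    using interval_integrable_isCont[of "min x0 (min t x)" "max x0 (max t x)" a]
    by (simp flip: ereal_max ereal_min)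
  then have "(LBINT y=x0..t. a y) + (LBINT y=t..x. a y) = (LBINT y=x0..x. a y)"
    by (rule interval_integral_sum)
  then show ?thesis
    unfolding integrating_factor_def by (simp flip: exp_diff)
qed

text \<open>The second expression for the negative fractional power.\<close>

lemma left_neg_power_eq:
  assumes "continuous_on UNIV a"
  shows "left_neg_power a \<alpha> f x =
    1 / Gamma \<alpha> * integrating_factor a x0 x *
    (LINT t:{..x}|lebesgue. f t / integrating_factor a x0 t / (x - t) powr (1 - \<alpha>))"
proof -
  let ?E = "integrating_factor a x0"
  let ?g = "\<lambda>t. indicator {..x} t *\<^sub>R (f t / ?E t / (x - t) powr (1 - \<alpha>))"
  have "(LINT t|lebesgue. ?g t) = (LINT t|lebesgue. ?g (x + (-1) * t))"
    using lebesgue_integral_real_affine[of "-1" ?g x] by simp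
  then have "?E x * (LINT t|lebesgue. ?g t) = (LINT t|lebesgue. ?E x * ?g (x - t))"
    by (simp only: integral_mult_right_zero) simp
  also have "\<dots> = (LINT t|lebesgue. indicator {0<..} t *\<^sub>R
      (left_semigroup a t f x / t powr (1 - \<alpha>)))"
    by (rule Bochner_Integration.integral_cong)
      (auto simp: left_semigroup_def indicator_def simp flip: integrating_factor_quotient[OF assms, of x0])
  finally show ?thesis
    unfolding left_neg_power_def set_lebesgue_integral_def by (simp add: mult.assoc)
qed

end

theory Submission
  imports Defs
begin

text \<open>
  Put \<open>g = f / E\<close>, where \<open>E\<close> is the integrating factor. Conjugation by \<open>E\<close> removes the zeroth order
  term: it turns the negative power into the one-sided Riesz potential \<open>I g\<close> and the truncated
  operator into \<open>E\<close> times the truncated Marchaud derivative of \<open>I g\<close>. Writing that derivative as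
  an iterated integral and exchanging the integrations gives the classical fact that it is a
  convolution \<open>K\<^sub>\<epsilon> * g\<close> over the past, with \<open>K\<^sub>\<epsilon>(s) = K\<^sub>1(s / \<epsilon>) / \<epsilon>\<close> nonnegative, nonincreasing on
  \<open>(0, \<infinity>)\<close>, of total mass 1 (a Beta integral) and of size \<open>\<epsilon>\<^sup>1\<^sup>-\<^sup>\<alpha> s\<^sup>\<alpha>\<^sup>-\<^sup>2\<close> at infinity
  (\<open>truncated_derivative_of_riesz_potential\<close>, \<open>nn_integral_truncation_kernel\<close>). So the theorem says
  that this approximate identity works on \<open>L\<^sup>p(\<omega>\<^sup>p)\<close>.

  The exchange of integrations at \<open>x\<close> needs the Riesz potential of \<open>\<bar>g\<bar>\<close> to be finite at \<open>x\<close>. Locally this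
  is Tonelli. At infinity, Hoelder's inequality on the annulus \<open>2\<^sup>n < s < 2\<^sup>n\<^sup>+\<^sup>1\<close> and the weight condition
  give only a bounded contribution for each \<open>n\<close>; the gain comes from the fact that the masses of
  \<open>\<omega>\<^sup>q\<close> on the intervals \<open>[x - 2\<^sup>n, x]\<close> grow geometrically (\<open>W_reverse_doubling\<close>), which turns the
  bound into a convergent geometric series (\<open>fractional_integral_finite\<close>). Given this, almost
  everywhere convergence holds at the left Lebesgue points of \<open>g\<close> (\<open>conv_truncation_kernel_tendsto\<close>).

  For convergence in \<open>L\<^sup>p(\<omega>\<^sup>p)\<close> one needs a bound for \<open>K\<^sub>\<epsilon> * g\<close> uniform in \<open>\<epsilon>\<close>. The one-sided maximal
  theorem would give it, but something much simpler suffices. The convolution with a nonincreasing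
  kernel is dominated at \<open>x\<close> by a superposition, over the scales \<open>l\<close>, of the means of \<open>\<bar>g\<bar>\<close> over
  \<open>(x - 2l, x - l)\<close> (\<open>decreasing_kernel_le_scale_average\<close>). These intervals keep a distance \<open>l\<close> from
  \<open>x\<close>, so one application of Hoelder's inequality and of the one-sided \<open>A\<^sub>p\<close> condition bounds each mean on
  \<open>L\<^sup>p(\<omega>\<^sup>p)\<close> with a constant independent of \<open>l\<close> (\<open>annular_mean_bound\<close>). Averaging over the
  scales gives \<open>conv_bound\<close>. It then remains to treat bounded \<open>g\<close> of bounded support, where
  dominated convergence applies, since \<open>K\<^sub>\<epsilon> \<le> K\<^sub>1 / \<alpha>\<close> on \<open>[1, \<infinity>)\<close> for \<open>\<epsilon> \<le> 1\<close>.
\<close>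

section \<open>Hoelder's inequality for nonnegative integrals\<close>

text \<open>
  The finite upper bounds \<open>U\<close> and \<open>V\<close> stand for the two integrals, so that no fractional power of an
  extended real occurs. The proof normalises both factors and integrates Young's inequality.
\<close>
lemma nn_integral_Holder:
  fixes u v :: "'a \<Rightarrow> real"
  assumes [measurable]: "u \<in> borel_measurable M" "v \<in> borel_measurable M"
    and pr: "1 < p" "1 < r" "1 / p + 1 / r = 1"
    and nonneg: "\<And>x. 0 \<le> u x" "\<And>x. 0 \<le> v x" "0 \<le> U" "0 \<le> V"
    and U: "(\<integral>\<^sup>+x. ennreal (u x powr p) \<partial>M) \<le> ennreal U"
    and V: "(\<integral>\<^sup>+x. ennreal (v x powr r) \<partial>M) \<le> ennreal V"
  shows "(\<integral>\<^sup>+x. ennreal (u x * v x) \<partial>M) \<le> ennreal (U powr (1 / p) * V powr (1 / r))"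
proof (cases "U = 0 \<or> V = 0")
  case True
  have "AE x in M. u x * v x = 0"
  proof (cases "U = 0")
    case True
    then have "AE x in M. ennreal (u x powr p) = 0"
      using U by (subst nn_integral_0_iff_AE[symmetric]) auto
    then show ?thesis by eventually_elim (auto simp: ennreal_eq_0_iff)
  next
    case False
    then have "AE x in M. ennreal (v x powr r) = 0"
      using V True by (subst nn_integral_0_iff_AE[symmetric]) auto
    then show ?thesis by eventually_elim (auto simp: ennreal_eq_0_iff)
  qed
  then have "(\<integral>\<^sup>+x. ennreal (u x * v x) \<partial>M) = (\<integral>\<^sup>+x. 0 \<partial>M)"
    by (intro nn_integral_cong_AE) (auto elim: eventually_mono)
  then show ?thesis by simp
next
  case False
  then have pos: "0 < U" "0 < V" using nonneg by auto
  define A where "A = U powr (1 / p)"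
  define B where "B = V powr (1 / r)"
  have AB: "0 < A" "0 < B" "A powr p = U" "B powr r = V"
    using pos pr by (auto simp: A_def B_def powr_powr)
  \<comment> \<open>Young's inequality for the normalised functions \<open>u / A\<close> and \<open>v / B\<close>.\<close>
  have Young: "u x * v x \<le> A * B / (p * U) * u x powr p + A * B / (r * V) * v x powr r" for x
  proof -
    have "(u x / A) * (v x / B) \<le> (u x / A) powr p / p + (v x / B) powr r / r"
      by (intro Youngs_inequality) (use pr nonneg AB in auto)
    then have "A * B * ((u x / A) * (v x / B)) \<le> A * B * (u x powr p / U / p + v x powr r / V / r)"
      using AB nonneg by (intro mult_left_mono) (auto simp: powr_divide)
    then show ?thesis using AB by (simp add: field_simps)
  qed
  have "(\<integral>\<^sup>+x. ennreal (u x * v x) \<partial>M)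
      \<le> (\<integral>\<^sup>+x. ennreal (A * B / (p * U)) * ennreal (u x powr p)
          + ennreal (A * B / (r * V)) * ennreal (v x powr r) \<partial>M)"
    using Young AB pos pr
    by (intro nn_integral_mono) (simp add: ennreal_leI flip: ennreal_mult' ennreal_plus)
  also have "\<dots> = ennreal (A * B / (p * U)) * (\<integral>\<^sup>+x. ennreal (u x powr p) \<partial>M)
      + ennreal (A * B / (r * V)) * (\<integral>\<^sup>+x. ennreal (v x powr r) \<partial>M)"
    by (simp add: nn_integral_add nn_integral_cmult)
  also have "\<dots> \<le> ennreal (A * B / (p * U)) * ennreal U + ennreal (A * B / (r * V)) * ennreal V"
    by (intro add_mono mult_left_mono U V) auto
  also have "\<dots> = ennreal (A * B / (p * U) * U + A * B / (r * V) * V)"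
    using AB pos pr by (simp flip: ennreal_mult' ennreal_plus)
  also have "A * B / (p * U) * U + A * B / (r * V) * V = A * B * (1 / p + 1 / r)"
    using pos by (simp add: field_simps)
  finally show ?thesis using pr by (simp add: A_def B_def)
qed

section \<open>Nonincreasing kernels and means over annuli\<close>

lemma measurable_indicator_open_interval[measurable (raw)]:
  fixes f g h :: "'a \<Rightarrow> real"
  assumes [measurable]: "f \<in> borel_measurable M" "g \<in> borel_measurable M" "h \<in> borel_measurable M"
  shows "(\<lambda>x. indicator {f x<..<g x} (h x) :: ennreal) \<in> borel_measurable M"
proof -
  have "(\<lambda>x. indicator {f x<..<g x} (h x) :: ennreal) = (\<lambda>x. if f x < h x \<and> h x < g x then 1 else 0)"
    by (auto simp: fun_eq_iff indicator_def)
  then show ?thesis by simp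
qed

lemma measurable_indicator_closed_interval[measurable (raw)]:
  fixes f g h :: "'a \<Rightarrow> real"
  assumes [measurable]: "f \<in> borel_measurable M" "g \<in> borel_measurable M" "h \<in> borel_measurable M"
  shows "(\<lambda>x. indicator {f x..g x} (h x) :: ennreal) \<in> borel_measurable M"
proof -
  have "(\<lambda>x. indicator {f x..g x} (h x) :: ennreal) = (\<lambda>x. if f x \<le> h x \<and> h x \<le> g x then 1 else 0)"
    by (auto simp: fun_eq_iff indicator_def)
  then show ?thesis by simp
qed

text \<open>
  The point \<open>s\<close> lies in \<open>(l, 2l)\<close> for the scales \<open>s/2 < l < s\<close>, and there \<open>K l / l \<ge> K s / s\<close>. Hence these
  scales together contribute at least \<open>K s\<close> to the superposition on the right.
\<close>
lemma decreasing_kernel_le_scale_average: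
  fixes K :: "real \<Rightarrow> real" and \<phi> :: "real \<Rightarrow> ennreal"
  assumes [measurable]: "K \<in> borel_measurable borel" "\<phi> \<in> borel_measurable borel"
    and K0: "\<And>s. 0 \<le> K s" "\<And>s. s \<le> 0 \<Longrightarrow> K s = 0"
    and dec: "\<And>s t. 0 < s \<Longrightarrow> s \<le> t \<Longrightarrow> K t \<le> K s"
  shows "(\<integral>\<^sup>+s. ennreal (K s) * \<phi> s \<partial>lborel)
    \<le> (\<integral>\<^sup>+l. ennreal (2 * K l / l) * (\<integral>\<^sup>+y. \<phi> y * indicator {l<..<2*l} y \<partial>lborel) \<partial>lborel)"
proof -
  have "ennreal (K s) * \<phi> s \<le> (\<integral>\<^sup>+l. ennreal (2 * K l / l) * (\<phi> s * indicator {l<..<2*l} s) \<partial>lborel)" for s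
  proof (cases "0 < s")
    case True
    have "ennreal (K s) * \<phi> s = ennreal (2 * K s / s) * \<phi> s * ennreal (s - s / 2)"
      using True K0(1)[of s] by (simp add: mult_ac flip: ennreal_mult'' mult.assoc)
    also have "\<dots> = (\<integral>\<^sup>+l. ennreal (2 * K s / s) * \<phi> s * indicator {s/2<..<s} l \<partial>lborel)"
      using True by (subst nn_integral_cmult_indicator) auto
    also have "\<dots> \<le> (\<integral>\<^sup>+l. ennreal (2 * K l / l) * (\<phi> s * indicator {l<..<2*l} s) \<partial>lborel)"
    proof (rule nn_integral_mono)
      fix l
      show "ennreal (2 * K s / s) * \<phi> s * indicator {s/2<..<s} l
          \<le> ennreal (2 * K l / l) * (\<phi> s * indicator {l<..<2*l} s)"
      proof (cases "l \<in> {s/2<..<s}")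
        case True
        then have "0 < l" "l \<le> s" using \<open>0 < s\<close> by auto
        then have "2 * K s / s \<le> 2 * K l / l"
          using dec[of l s] K0(1)[of s] by (intro frac_le) auto
        with True show ?thesis by (auto intro!: mult_right_mono ennreal_leI)
      qed auto
    qed
    finally show ?thesis .
  qed (auto simp: K0)
  then have "(\<integral>\<^sup>+s. ennreal (K s) * \<phi> s \<partial>lborel)
    \<le> (\<integral>\<^sup>+s. \<integral>\<^sup>+l. ennreal (2 * K l / l) * (\<phi> s * indicator {l<..<2*l} s) \<partial>lborel \<partial>lborel)"
    by (intro nn_integral_mono)
  also have "\<dots> = (\<integral>\<^sup>+l. \<integral>\<^sup>+s. ennreal (2 * K l / l) * (\<phi> s * indicator {l<..<2*l} s) \<partial>lborel \<partial>lborel)"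
    by (rule lborel_pair.Fubini') measurable
  finally show ?thesis by (simp add: nn_integral_cmult)
qed

section \<open>One-sided weights\<close>

text \<open>
  The class \<open>A_minus\<close> for a Borel weight, with \<open>r\<close> the conjugate exponent of \<open>p\<close> and the
  normalising factors \<open>1/h\<close> collected in \<open>h powr (1 - \<alpha>)\<close>, because \<open>1/q + 1/r = 1 - \<alpha>\<close>.
\<close>
locale one_sided_weight =
  fixes \<alpha> p q r C :: real and \<omega> :: "real \<Rightarrow> real"
  assumes \<alpha>: "0 < \<alpha>" "\<alpha> < 1"
    and p: "1 < p" and r: "1 / p + 1 / r = 1" "1 < r"
    and q: "0 < q" "1 / q = 1 / p - \<alpha>"
    and \<omega>[measurable]: "\<omega> \<in> borel_measurable borel" and \<omega>_pos: "\<And>x. 0 < \<omega> x"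
    and C: "0 < C"
    and int_q: "\<And>u v. set_integrable lborel {u..v} (\<lambda>y. \<omega> y powr q)"
    and int_r: "\<And>u v. set_integrable lborel {u..v} (\<lambda>y. \<omega> y powr (- r))"
    and Apq: "\<And>x h. 0 < h \<Longrightarrow>
      (LBINT y:{x..x+h}. \<omega> y powr q) powr (1 / q) * (LBINT y:{x-h..x}. \<omega> y powr (- r)) powr (1 / r)
        \<le> C * h powr (1 - \<alpha>)"
begin

definition W :: "real \<Rightarrow> real \<Rightarrow> real" where "W u v = (LBINT y:{u..v}. \<omega> y powr q)"
definition S :: "real \<Rightarrow> real \<Rightarrow> real" where "S u v = (LBINT y:{u..v}. \<omega> y powr (- r))"

lemma Apq': "0 < h \<Longrightarrow> W x (x + h) powr (1 / q) * S (x - h) x powr (1 / r) \<le> C * h powr (1 - \<alpha>)"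
  using Apq unfolding W_def S_def .

lemma pq: "p < q"
proof -
  have "1 / q < 1 / p" using q \<alpha> by simp
  then show ?thesis
    using inverse_less_imp_less[of q p] q by (simp add: inverse_eq_divide)
qed

lemma p_over_r: "p / r = p - 1"
proof -
  have "p * (1 / p + 1 / r) = p" using r by simp
  moreover have "p * (1 / p + 1 / r) = 1 + p / r" using p by (simp add: distrib_left)
  ultimately show ?thesis by simp
qed

lemma nn_W: "(\<integral>\<^sup>+y. ennreal (\<omega> y powr q) * indicator {u..v} y \<partial>lborel) = ennreal (W u v)"
  unfolding W_def using int_q[of u v]
  by (subst nn_integral_set_ennreal, subst nn_integral_eq_integral)
     (auto simp: set_integrable_def set_lebesgue_integral_def mult.commute)

lemma nn_S: "(\<integral>\<^sup>+y. ennreal (\<omega> y powr (- r)) * indicator {u..v} y \<partial>lborel) = ennreal (S u v)"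
  unfolding S_def using int_r[of u v]
  by (subst nn_integral_set_ennreal, subst nn_integral_eq_integral)
     (auto simp: set_integrable_def set_lebesgue_integral_def mult.commute)

lemma W_nonneg [simp]: "0 \<le> W u v" and S_nonneg [simp]: "0 \<le> S u v"
  unfolding W_def S_def set_lebesgue_integral_def by (auto intro!: integral_nonneg_AE)

lemma S_mono: "u' \<le> u \<Longrightarrow> v \<le> v' \<Longrightarrow> S u v \<le> S u' v'"
  by (subst ennreal_le_iff[symmetric], simp, unfold nn_S[symmetric])
     (auto intro!: nn_integral_mono split: split_indicator)

text \<open>
  Jensen's inequality lowers the exponent \<open>q\<close> to \<open>p\<close>, giving the one-sided Muckenhoupt condition
  for the weight \<open>\<omega> powr p\<close>.
\<close>

lemma nn_Wp_le:
  assumes "u \<le> v"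
  shows "(\<integral>\<^sup>+y. ennreal (\<omega> y powr p) * indicator {u..v} y \<partial>lborel)
    \<le> ennreal (W u v powr (p / q) * (v - u) powr (\<alpha> * p))"
proof -
  have "p / q < 1" using pq p q by simp
  \<comment> \<open>Jensen's inequality as Hoelder's inequality against the constant 1, with exponent \<open>q / p\<close>.\<close>
  have pp: "1 < q / p" "1 < 1 / (1 - p / q)" "1 / (q / p) + 1 / (1 / (1 - p / q)) = 1"
    using pq p q by (auto simp: field_simps)
  have "(\<integral>\<^sup>+y. ennreal ((\<omega> y powr p * indicator {u..v} y) * indicator {u..v} y) \<partial>lborel)
    \<le> ennreal (W u v powr (1 / (q / p)) * (v - u) powr (1 / (1 / (1 - p / q))))"
  proof (rule nn_integral_Holder)
    show "(\<integral>\<^sup>+y. ennreal ((\<omega> y powr p * indicator {u..v} y) powr (q / p)) \<partial>lborel) \<le> ennreal (W u v)"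
      unfolding nn_W[symmetric] using p
      by (intro nn_integral_mono) (auto simp: powr_powr split: split_indicator)
    show "(\<integral>\<^sup>+y. ennreal (indicator {u..v} y powr (1 / (1 - p / q))) \<partial>lborel) \<le> ennreal (v - u)"
    proof -
      have "(\<integral>\<^sup>+y. ennreal (indicator {u..v} y powr (1 / (1 - p / q))) \<partial>lborel) = (\<integral>\<^sup>+y. indicator {u..v} y \<partial>lborel)"
        using pp by (intro nn_integral_cong) (auto split: split_indicator)
      then show ?thesis using assms by simp
    qed
  qed (use pp assms in auto)
  moreover have "1 / (q / p) = p / q" by simp
  moreover have "1 / (1 / (1 - p / q)) = \<alpha> * p"
  proof -
    have "p * (1 / q) = p * (1 / p - \<alpha>)" using q by simp
    also have "\<dots> = 1 - \<alpha> * p" using p by (simp add: right_diff_distrib)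
    finally show ?thesis by simp
  qed
  moreover have "(\<integral>\<^sup>+y. ennreal ((\<omega> y powr p * indicator {u..v} y) * indicator {u..v} y) \<partial>lborel)
      = (\<integral>\<^sup>+y. ennreal (\<omega> y powr p) * indicator {u..v} y \<partial>lborel)"
    by (intro nn_integral_cong) (simp split: split_indicator)
  ultimately show ?thesis by simp
qed

lemma one_sided_Ap:
  assumes "0 < h"
  shows "(\<integral>\<^sup>+y. ennreal (\<omega> y powr p) * indicator {x..x+h} y \<partial>lborel) * ennreal (S (x - h) x powr (p - 1))
    \<le> ennreal ((C * h) powr p)"
proof -
  have "(\<integral>\<^sup>+y. ennreal (\<omega> y powr p) * indicator {x..x+h} y \<partial>lborel) * ennreal (S (x - h) x powr (p - 1))
      \<le> ennreal (W x (x+h) powr (p / q) * h powr (\<alpha> * p)) * ennreal (S (x - h) x powr (p - 1))"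
    using nn_Wp_le[of x "x + h"] assms by (intro mult_right_mono) auto
  also have "\<dots> = ennreal (W x (x+h) powr (p / q) * S (x - h) x powr (p - 1) * h powr (\<alpha> * p))"
    by (simp add: mult_ac flip: ennreal_mult')
  also have "W x (x+h) powr (p / q) * S (x - h) x powr (p - 1)
      = (W x (x + h) powr (1 / q) * S (x - h) x powr (1 / r)) powr p"
    using p_over_r by (simp add: powr_mult powr_powr)
  also have "\<dots> \<le> (C * h powr (1 - \<alpha>)) powr p"
    using assms Apq'[OF assms, of x] p by (intro powr_mono2) auto
  also have "(C * h powr (1 - \<alpha>)) powr p * h powr (\<alpha> * p) = (C * h) powr p"
    using C assms by (simp add: powr_mult powr_powr flip: powr_add) (simp add: algebra_simps)
  finally show ?thesis by (simp add: ennreal_leI mult_right_mono)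
qed

text \<open>Hoelder's inequality for the factorisation \<open>g = (g \<omega>) (1/\<omega>)\<close>.\<close>
lemma local_Holder:
  assumes [measurable]: "g \<in> borel_measurable borel" and "0 \<le> U"
    and U: "(\<integral>\<^sup>+t. ennreal ((\<bar>g t\<bar> * \<omega> t) powr p) * indicator {u<..<v} t \<partial>lborel) \<le> ennreal U"
  shows "(\<integral>\<^sup>+t. ennreal \<bar>g t\<bar> * indicator {u<..<v} t \<partial>lborel) \<le> ennreal (U powr (1 / p) * S u v powr (1 / r))"
proof -
  have "(\<integral>\<^sup>+t. ennreal ((\<bar>g t\<bar> * \<omega> t * indicator {u<..<v} t) * (inverse (\<omega> t) * indicator {u<..<v} t)) \<partial>lborel)
    \<le> ennreal (U powr (1 / p) * S u v powr (1 / r))"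
  proof (rule nn_integral_Holder)
    show "(\<integral>\<^sup>+t. ennreal ((\<bar>g t\<bar> * \<omega> t * indicator {u<..<v} t) powr p) \<partial>lborel) \<le> ennreal U"
      using U by (rule order_trans[rotated]) (auto intro!: nn_integral_mono split: split_indicator)
    show "(\<integral>\<^sup>+t. ennreal ((inverse (\<omega> t) * indicator {u<..<v} t) powr r) \<partial>lborel) \<le> ennreal (S u v)"
      unfolding nn_S[symmetric]
      by (auto intro!: nn_integral_mono simp: powr_minus inverse_powr split: split_indicator)
  qed (use p r assms \<omega>_pos in \<open>auto simp: less_imp_le\<close>)
  also have "(\<integral>\<^sup>+t. ennreal ((\<bar>g t\<bar> * \<omega> t * indicator {u<..<v} t) * (inverse (\<omega> t) * indicator {u<..<v} t)) \<partial>lborel)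
     = (\<integral>\<^sup>+t. ennreal \<bar>g t\<bar> * indicator {u<..<v} t \<partial>lborel)"
    using \<omega>_pos by (intro nn_integral_cong)
      (simp add: field_simps less_imp_neq[symmetric] split: split_indicator)
  finally show ?thesis .
qed

end

text \<open>
  The mean of \<open>\<bar>g\<bar>\<close> over \<open>(x - 2l, x - l)\<close>, as a real number, so that it can be raised to the power \<open>p\<close>. The
  conversion loses nothing when \<open>g\<close> is locally integrable.
\<close>
definition annular_mean :: "(real \<Rightarrow> real) \<Rightarrow> real \<Rightarrow> real \<Rightarrow> real" where
  "annular_mean g l x = enn2real (\<integral>\<^sup>+y. ennreal \<bar>g (x - y)\<bar> * indicator {l<..<2*l} y \<partial>lborel) / l"

lemma annular_mean_nonneg: "0 \<le> annular_mean g l x"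
proof (cases "0 < l")
  case False
  then have "{l<..<2*l} = {}" by auto
  then show ?thesis unfolding annular_mean_def by simp
qed (simp add: annular_mean_def)

lemma measurable_annular_mean [measurable]:
  assumes [measurable]: "g \<in> borel_measurable borel"
  shows "(\<lambda>(l, x). annular_mean g l x) \<in> borel_measurable (borel \<Otimes>\<^sub>M borel)"
  unfolding annular_mean_def by measurable

lemma nn_integral_reflect_shift:
  fixes \<phi> :: "real \<Rightarrow> ennreal"
  assumes [measurable]: "\<phi> \<in> borel_measurable borel"
  shows "(\<integral>\<^sup>+y. \<phi> (x - y) \<partial>lborel) = (\<integral>\<^sup>+t. \<phi> t \<partial>lborel)"
  by (subst (2) nn_integral_real_affine[where c="-1" and t=x]) simp_all

lemma nn_integral_annulus:
  fixes \<phi> :: "real \<Rightarrow> ennreal"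
  assumes [measurable]: "\<phi> \<in> borel_measurable borel"
  shows "(\<integral>\<^sup>+y. \<phi> (x - y) * indicator {u<..<v} y \<partial>lborel) = (\<integral>\<^sup>+t. \<phi> t * indicator {x-v<..<x-u} t \<partial>lborel)"
proof -
  have "(\<integral>\<^sup>+y. \<phi> (x - y) * indicator {u<..<v} y \<partial>lborel)
      = (\<integral>\<^sup>+y. \<phi> (x - y) * indicator {x-v<..<x-u} (x - y) \<partial>lborel)"
    by (intro nn_integral_cong) (simp split: split_indicator)
  also have "\<dots> = (\<integral>\<^sup>+t. \<phi> t * indicator {x-v<..<x-u} t \<partial>lborel)"
    by (rule nn_integral_reflect_shift[where \<phi>="\<lambda>t. \<phi> t * indicator {x-v<..<x-u} t"]) measurable
  finally show ?thesis .
qed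

context one_sided_weight begin

lemma measurable_S [measurable (raw)]:
  assumes [measurable]: "f \<in> borel_measurable M" "g \<in> borel_measurable M"
  shows "(\<lambda>x. S (f x) (g x)) \<in> borel_measurable M"
proof -
  have "S u v = (\<integral>y. (if u \<le> y \<and> y \<le> v then \<omega> y powr (- r) else 0) \<partial>lborel)" for u v
    unfolding S_def set_lebesgue_integral_def
    by (intro Bochner_Integration.integral_cong) (auto split: split_indicator)
  then show ?thesis by simp
qed

lemma annulus_Holder:
  assumes [measurable]: "g \<in> borel_measurable borel"
    and N: "(\<integral>\<^sup>+t. ennreal ((\<bar>g t\<bar> * \<omega> t) powr p) \<partial>lborel) < \<infinity>"
  shows "(\<integral>\<^sup>+t. ennreal \<bar>g t\<bar> * indicator {u<..<v} t \<partial>lborel) < \<infinity>" (is ?A)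
    and "ennreal (enn2real (\<integral>\<^sup>+t. ennreal \<bar>g t\<bar> * indicator {u<..<v} t \<partial>lborel) powr p)
      \<le> (\<integral>\<^sup>+t. ennreal ((\<bar>g t\<bar> * \<omega> t) powr p) * indicator {u<..<v} t \<partial>lborel) * ennreal (S u v powr (p - 1))"
      (is ?B)
proof -
  let ?N = "\<integral>\<^sup>+t. ennreal ((\<bar>g t\<bar> * \<omega> t) powr p) * indicator {u<..<v} t \<partial>lborel"
  let ?b = "\<integral>\<^sup>+t. ennreal \<bar>g t\<bar> * indicator {u<..<v} t \<partial>lborel"
  have "?N \<le> (\<integral>\<^sup>+t. ennreal ((\<bar>g t\<bar> * \<omega> t) powr p) \<partial>lborel)"
    by (intro nn_integral_mono) (simp split: split_indicator)
  from this N have fin: "?N < \<infinity>" by (rule le_less_trans)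
  then obtain U where U: "?N = ennreal U" "0 \<le> U" by (cases ?N) auto
  have H: "?b \<le> ennreal (U powr (1 / p) * S u v powr (1 / r))"
    using local_Holder[of g U u v] U by simp
  then show ?A by (auto simp: order.strict_trans1)
  then obtain b where b: "?b = ennreal b" "0 \<le> b" by (cases ?b) auto
  have "b \<le> U powr (1 / p) * S u v powr (1 / r)" using H b by simp
  then have "b powr p \<le> (U powr (1 / p) * S u v powr (1 / r)) powr p"
    using b p by (intro powr_mono2) auto
  also have "\<dots> = U * S u v powr (p - 1)"
    using U p p_over_r by (simp add: powr_mult powr_powr)
  finally show ?B unfolding U b using U b by (simp add: ennreal_leI flip: ennreal_mult)
qed

text \<open>
  After Hoelder's inequality on \<open>(x - 2l, x - l)\<close> and Tonelli, the mass \<open>(\<bar>g\<bar> \<omega>)\<^sup>p(t)\<close> is multiplied by an integral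
  over the points \<open>x\<close> with \<open>t + l < x < t + 2l\<close>. For these, \<open>(x - 2l, x - l)\<close> lies in \<open>[t - l, t + l]\<close> and \<open>x\<close>
  lies in \<open>[t + l, t + 3l]\<close>: two adjacent intervals of length \<open>2l\<close>, as in the one-sided condition.
\<close>
lemma annular_mean_bound:
  assumes [measurable]: "g \<in> borel_measurable borel" and l: "0 < l"
    and N: "(\<integral>\<^sup>+t. ennreal ((\<bar>g t\<bar> * \<omega> t) powr p) \<partial>lborel) < \<infinity>"
  shows "(\<integral>\<^sup>+x. ennreal ((annular_mean g l x * \<omega> x) powr p) \<partial>lborel)
    \<le> ennreal ((2 * C) powr p) * (\<integral>\<^sup>+t. ennreal ((\<bar>g t\<bar> * \<omega> t) powr p) \<partial>lborel)"
proof -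
  let ?G = "\<lambda>t. ennreal ((\<bar>g t\<bar> * \<omega> t) powr p)"
  let ?k = "ennreal (1 / l powr p)"
  have "(\<integral>\<^sup>+x. ennreal ((annular_mean g l x * \<omega> x) powr p) \<partial>lborel)
    \<le> (\<integral>\<^sup>+x. \<integral>\<^sup>+t. ?k * ?G t * (ennreal (S (t - l) (t + l) powr (p - 1))
          * (ennreal (\<omega> x powr p) * indicator {t + l..t + 3*l} x)) \<partial>lborel \<partial>lborel)"
  proof (rule nn_integral_mono)
    fix x
    have "annular_mean g l x = enn2real (\<integral>\<^sup>+t. ennreal \<bar>g t\<bar> * indicator {x-2*l<..<x-l} t \<partial>lborel) / l"
      unfolding annular_mean_def by (subst nn_integral_annulus[where \<phi>="\<lambda>t. ennreal \<bar>g t\<bar>"]) auto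
    then have "ennreal ((annular_mean g l x * \<omega> x) powr p) =
      ?k * ennreal (\<omega> x powr p) * ennreal (enn2real (\<integral>\<^sup>+t. ennreal \<bar>g t\<bar> * indicator {x-2*l<..<x-l} t \<partial>lborel) powr p)"
      by (simp add: powr_mult powr_divide mult_ac flip: ennreal_mult')
    also have "\<dots> \<le> ?k * ennreal (\<omega> x powr p) *
        ((\<integral>\<^sup>+t. ?G t * indicator {x-2*l<..<x-l} t \<partial>lborel) * ennreal (S (x-2*l) (x-l) powr (p - 1)))"
      by (intro mult_left_mono annulus_Holder N) auto
    also have "\<dots> = (\<integral>\<^sup>+t. ?k * ennreal (\<omega> x powr p) * ennreal (S (x-2*l) (x-l) powr (p - 1))
        * (?G t * indicator {x-2*l<..<x-l} t) \<partial>lborel)"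
      by (subst nn_integral_cmult) (auto simp: mult_ac)
    also have "\<dots> \<le> (\<integral>\<^sup>+t. ?k * ?G t * (ennreal (S (t - l) (t + l) powr (p - 1))
          * (ennreal (\<omega> x powr p) * indicator {t + l..t + 3*l} x)) \<partial>lborel)"
    proof (rule nn_integral_mono)
      fix t
      show "?k * ennreal (\<omega> x powr p) * ennreal (S (x-2*l) (x-l) powr (p - 1))
        * (?G t * indicator {x-2*l<..<x-l} t)
        \<le> ?k * ?G t * (ennreal (S (t - l) (t + l) powr (p - 1))
          * (ennreal (\<omega> x powr p) * indicator {t + l..t + 3*l} x))"
      proof (cases "t \<in> {x-2*l<..<x-l}")
        case True
        then have "S (x-2*l) (x-l) powr (p - 1) \<le> S (t - l) (t + l) powr (p - 1)"
          using p by (intro powr_mono2 S_mono) auto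
        then have "?k * ?G t * ennreal (\<omega> x powr p) * ennreal (S (x-2*l) (x-l) powr (p - 1))
            \<le> ?k * ?G t * ennreal (\<omega> x powr p) * ennreal (S (t - l) (t + l) powr (p - 1))"
          by (intro mult_left_mono ennreal_leI) auto
        moreover have "x \<in> {t + l..t + 3*l}" using True l by auto
        ultimately show ?thesis using True by (simp add: mult_ac)
      qed auto
    qed
    finally show "ennreal ((annular_mean g l x * \<omega> x) powr p) \<le> (\<integral>\<^sup>+t. ?k * ?G t * (ennreal (S (t - l) (t + l) powr (p - 1))
          * (ennreal (\<omega> x powr p) * indicator {t + l..t + 3*l} x)) \<partial>lborel)" .
  qed
  also have "\<dots> = (\<integral>\<^sup>+t. \<integral>\<^sup>+x. ?k * ?G t * (ennreal (S (t - l) (t + l) powr (p - 1))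
          * (ennreal (\<omega> x powr p) * indicator {t + l..t + 3*l} x)) \<partial>lborel \<partial>lborel)"
    by (rule lborel_pair.Fubini') measurable
  also have "\<dots> = (\<integral>\<^sup>+t. ?k * ?G t * (ennreal (S (t - l) (t + l) powr (p - 1))
          * (\<integral>\<^sup>+x. (ennreal (\<omega> x powr p) * indicator {t + l..t + 3*l} x) \<partial>lborel)) \<partial>lborel)"
    by (intro nn_integral_cong) (simp add: nn_integral_cmult)
  also have "\<dots> \<le> (\<integral>\<^sup>+t. ?k * ?G t * ennreal ((C * (2 * l)) powr p) \<partial>lborel)"
  proof (intro nn_integral_mono mult_left_mono)
    fix t
    have "(\<integral>\<^sup>+x. ennreal (\<omega> x powr p) * indicator {t+l..t+l+2*l} x \<partial>lborel)
        * ennreal (S (t + l - 2*l) (t+l) powr (p - 1)) \<le> ennreal ((C * (2 * l)) powr p)"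
      using l by (intro one_sided_Ap) auto
    then show "ennreal (S (t - l) (t + l) powr (p - 1))
          * (\<integral>\<^sup>+x. (ennreal (\<omega> x powr p) * indicator {t + l..t + 3*l} x) \<partial>lborel)
        \<le> ennreal ((C * (2 * l)) powr p)"
      by (simp add: algebra_simps)
  qed auto
  also have "\<dots> = (\<integral>\<^sup>+t. ennreal ((2 * C) powr p) * ?G t \<partial>lborel)"
    using l C by (intro nn_integral_cong) (simp add: powr_mult mult_ac flip: ennreal_mult')
  finally show ?thesis by (simp add: nn_integral_cmult)
qed

end

section \<open>Uniform bounds for convolutions with nonincreasing kernels\<close>

definition conv :: "(real \<Rightarrow> real) \<Rightarrow> (real \<Rightarrow> real) \<Rightarrow> real \<Rightarrow> real" where
  "conv K g x = (\<integral>s. K s * g (x - s) \<partial>lborel)"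

lemma measurable_conv [measurable]:
  assumes [measurable]: "K \<in> borel_measurable borel" "g \<in> borel_measurable borel"
  shows "conv K g \<in> borel_measurable borel"
  unfolding conv_def by measurable

lemma abs_lebesgue_integral_le:
  fixes f :: "'a \<Rightarrow> real"
  shows "ennreal \<bar>integral\<^sup>L M f\<bar> \<le> (\<integral>\<^sup>+x. ennreal \<bar>f x\<bar> \<partial>M)"
proof (cases "integrable M f")
  case True
  then show ?thesis using integral_norm_bound_ennreal[of M f] by simp
qed (simp add: not_integrable_integral_eq)

context one_sided_weight begin

text \<open>
  Jensen's inequality for the measure \<open>K(l) dl\<close> of mass at most 1, applied to the superposition of
  means that dominates the convolution.
\<close>
lemma conv_pointwise_bound:
  assumes [measurable]: "K \<in> borel_measurable borel" "g \<in> borel_measurable borel"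
    and K0: "\<And>s. 0 \<le> K s" "\<And>s. s \<le> 0 \<Longrightarrow> K s = 0"
    and dec: "\<And>s t. 0 < s \<Longrightarrow> s \<le> t \<Longrightarrow> K t \<le> K s"
    and K1: "(\<integral>\<^sup>+s. ennreal (K s) \<partial>lborel) \<le> 1"
    and N: "(\<integral>\<^sup>+t. ennreal ((\<bar>g t\<bar> * \<omega> t) powr p) \<partial>lborel) < \<infinity>"
  shows "ennreal (\<bar>conv K g x\<bar> powr p)
    \<le> (\<integral>\<^sup>+l. ennreal (2 powr p) * (ennreal (K l) * ennreal (annular_mean g l x powr p)) \<partial>lborel)"
proof -
  let ?U = "\<integral>\<^sup>+l. ennreal (K l) * ennreal (annular_mean g l x powr p) \<partial>lborel"

  have Us: "(\<integral>\<^sup>+l. ennreal (2 powr p) * (ennreal (K l) * ennreal (annular_mean g l x powr p)) \<partial>lborel)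
    = ennreal (2 powr p) * ?U" by (rule nn_integral_cmult) measurable
  show ?thesis
  proof (cases "?U = \<infinity>")
    case True
    then show ?thesis unfolding Us by (simp add: ennreal_mult_top)
  next
    case False
    then obtain u where u: "?U = ennreal u" "0 \<le> u" by (cases ?U) auto
    have "ennreal \<bar>conv K g x\<bar> \<le> (\<integral>\<^sup>+s. ennreal (K s) * ennreal \<bar>g (x - s)\<bar> \<partial>lborel)"
      unfolding conv_def using K0
      by (intro order_trans[OF abs_lebesgue_integral_le]) (simp add: abs_mult ennreal_mult)
    also have "\<dots> \<le> (\<integral>\<^sup>+l. ennreal (2 * K l / l)
        * (\<integral>\<^sup>+y. ennreal \<bar>g (x - y)\<bar> * indicator {l<..<2*l} y \<partial>lborel) \<partial>lborel)"
      using K0 dec by (intro decreasing_kernel_le_scale_average) auto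
    also have "\<dots> = (\<integral>\<^sup>+l. ennreal 2 * ennreal ((K l powr (1 / p) * annular_mean g l x) * K l powr (1 / r)) \<partial>lborel)"
    proof (rule nn_integral_cong)
      fix l
      let ?b = "\<integral>\<^sup>+y. ennreal \<bar>g (x - y)\<bar> * indicator {l<..<2*l} y \<partial>lborel"
      show "ennreal (2 * K l / l) * ?b
        = ennreal 2 * ennreal ((K l powr (1 / p) * annular_mean g l x) * K l powr (1 / r))"
      proof (cases "0 < l")
        case True
        have "?b = (\<integral>\<^sup>+t. ennreal \<bar>g t\<bar> * indicator {x-2*l<..<x-l} t \<partial>lborel)"
          by (rule nn_integral_annulus) measurable
        then have "?b < \<infinity>" using annulus_Holder(1)[OF _ N] by simp
        then have b: "?b = ennreal (l * annular_mean g l x)"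
          unfolding annular_mean_def using True by simp
        have "K l powr (1 / p) * K l powr (1 / r) = K l"
          using r K0(1)[of l] by (simp flip: powr_add)
        then have K: "(K l powr (1 / p) * annular_mean g l x) * K l powr (1 / r) = K l * annular_mean g l x"
          by (metis mult.assoc mult.commute)
        have "ennreal (2 * K l / l) * ennreal (l * annular_mean g l x)
            = ennreal (2 * K l / l * (l * annular_mean g l x))"
          using True K0(1)[of l] annular_mean_nonneg[of g l x] by (intro ennreal_mult[symmetric]) auto
        also have "\<dots> = ennreal 2 * ennreal (K l * annular_mean g l x)"
          using True K0(1)[of l] annular_mean_nonneg[of g l x]
          by (subst ennreal_mult[symmetric]) (auto simp: mult_ac)
        finally show ?thesis unfolding b K .
      qed (simp add: K0)
    qed
    also have "\<dots> = ennreal 2 * (\<integral>\<^sup>+l. ennreal ((K l powr (1 / p) * annular_mean g l x) * K l powr (1 / r)) \<partial>lborel)"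
      by (rule nn_integral_cmult) measurable
    also have "(\<integral>\<^sup>+l. ennreal ((K l powr (1 / p) * annular_mean g l x) * K l powr (1 / r)) \<partial>lborel)
        \<le> ennreal (u powr (1 / p) * 1 powr (1 / r))"
    proof (rule nn_integral_Holder)
      show "(\<integral>\<^sup>+l. ennreal ((K l powr (1 / p) * annular_mean g l x) powr p) \<partial>lborel) \<le> ennreal u"
        unfolding u(1)[symmetric] using p K0
        by (intro nn_integral_mono) (simp add: powr_mult powr_powr ennreal_mult annular_mean_nonneg)
      show "(\<integral>\<^sup>+l. ennreal ((K l powr (1 / r)) powr r) \<partial>lborel) \<le> ennreal 1"
        using K1 K0 r by (simp add: powr_powr)
    qed (use p r u in \<open>auto simp: annular_mean_nonneg\<close>)
    finally have "ennreal \<bar>conv K g x\<bar> \<le> ennreal (2 * u powr (1 / p))"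
      by (simp add: mult_left_mono ennreal_mult)
    then have "\<bar>conv K g x\<bar> \<le> 2 * u powr (1 / p)" by simp
    then have "\<bar>conv K g x\<bar> powr p \<le> (2 * u powr (1 / p)) powr p"
      using p by (intro powr_mono2) auto
    then show ?thesis
      unfolding Us u(1) using p u by (simp add: powr_mult powr_powr ennreal_leI flip: ennreal_mult)
  qed
qed

text \<open>
  The constant depends neither on the kernel nor on \<open>g\<close>, because \<open>annular_mean_bound\<close> is uniform in the scale.
\<close>
lemma conv_bound:
  assumes [measurable]: "K \<in> borel_measurable borel" "g \<in> borel_measurable borel"
    and K0: "\<And>s. 0 \<le> K s" "\<And>s. s \<le> 0 \<Longrightarrow> K s = 0"
    and dec: "\<And>s t. 0 < s \<Longrightarrow> s \<le> t \<Longrightarrow> K t \<le> K s"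
    and K1: "(\<integral>\<^sup>+s. ennreal (K s) \<partial>lborel) \<le> 1"
    and N: "(\<integral>\<^sup>+t. ennreal ((\<bar>g t\<bar> * \<omega> t) powr p) \<partial>lborel) < \<infinity>"
  shows "(\<integral>\<^sup>+x. ennreal ((\<bar>conv K g x\<bar> * \<omega> x) powr p) \<partial>lborel)
    \<le> ennreal ((4 * C) powr p) * (\<integral>\<^sup>+t. ennreal ((\<bar>g t\<bar> * \<omega> t) powr p) \<partial>lborel)"
proof -
  let ?N = "\<integral>\<^sup>+t. ennreal ((\<bar>g t\<bar> * \<omega> t) powr p) \<partial>lborel"
  have "(\<integral>\<^sup>+x. ennreal ((\<bar>conv K g x\<bar> * \<omega> x) powr p) \<partial>lborel)
    \<le> (\<integral>\<^sup>+x. \<integral>\<^sup>+l. ennreal (2 powr p) * (ennreal (K l) * ennreal ((annular_mean g l x * \<omega> x) powr p)) \<partial>lborel \<partial>lborel)"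
  proof (rule nn_integral_mono)
    fix x
    have "ennreal ((\<bar>conv K g x\<bar> * \<omega> x) powr p) = ennreal (\<bar>conv K g x\<bar> powr p) * ennreal (\<omega> x powr p)"
      by (simp add: powr_mult ennreal_mult)
    also have "\<dots> \<le> (\<integral>\<^sup>+l. ennreal (2 powr p) * (ennreal (K l) * ennreal (annular_mean g l x powr p)) \<partial>lborel)
        * ennreal (\<omega> x powr p)"
      by (intro mult_right_mono conv_pointwise_bound assms) auto
    also have "\<dots> = (\<integral>\<^sup>+l. ennreal (2 powr p) * (ennreal (K l) * ennreal ((annular_mean g l x * \<omega> x) powr p)) \<partial>lborel)"
      by (subst nn_integral_multc[symmetric]) (auto simp: powr_mult ennreal_mult mult_ac intro!: nn_integral_cong)
    finally show "ennreal ((\<bar>conv K g x\<bar> * \<omega> x) powr p) \<le> \<dots>" .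
  qed
  also have "\<dots> = (\<integral>\<^sup>+l. \<integral>\<^sup>+x. ennreal (2 powr p) * (ennreal (K l) * ennreal ((annular_mean g l x * \<omega> x) powr p)) \<partial>lborel \<partial>lborel)"
    by (rule lborel_pair.Fubini') measurable
  also have "\<dots> = (\<integral>\<^sup>+l. ennreal (2 powr p) * (ennreal (K l) * (\<integral>\<^sup>+x. ennreal ((annular_mean g l x * \<omega> x) powr p) \<partial>lborel)) \<partial>lborel)"
    by (intro nn_integral_cong) (simp add: nn_integral_cmult)
  also have "\<dots> \<le> (\<integral>\<^sup>+l. ennreal (2 powr p) * (ennreal (K l) * (ennreal ((2 * C) powr p) * ?N)) \<partial>lborel)"
  proof (intro nn_integral_mono, rule mult_left_mono)
    fix l
    show "ennreal (K l) * (\<integral>\<^sup>+x. ennreal ((annular_mean g l x * \<omega> x) powr p) \<partial>lborel)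
        \<le> ennreal (K l) * (ennreal ((2 * C) powr p) * ?N)"
    proof (cases "0 < l")
      case True
      then show ?thesis by (intro mult_left_mono annular_mean_bound N) auto
    qed (simp add: K0)
  qed auto
  also have "\<dots> = (\<integral>\<^sup>+l. ennreal (K l) * (ennreal (2 powr p) * (ennreal ((2 * C) powr p) * ?N)) \<partial>lborel)"
    by (simp add: mult_ac)
  also have "\<dots> = (\<integral>\<^sup>+l. ennreal (K l) \<partial>lborel) * (ennreal (2 powr p) * (ennreal ((2 * C) powr p) * ?N))"
    by (rule nn_integral_multc) measurable
  also have "\<dots> \<le> 1 * (ennreal (2 powr p) * (ennreal ((2 * C) powr p) * ?N))"
    by (intro mult_right_mono K1) auto
  also have "\<dots> = ennreal ((4 * C) powr p) * ?N"
  proof -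
    have "(4 * C) powr p = 2 powr p * (2 * C) powr p"
      by (simp flip: powr_mult)
    then show ?thesis by (simp add: ennreal_mult mult_ac)
  qed
  finally show ?thesis .
qed

end

section \<open>Finiteness of the fractional integral\<close>

lemma AE_not_range_seq:
  fixes c :: "nat \<Rightarrow> real"
  shows "AE s in lborel. s \<notin> range c"
  by (intro AE_not_in countable_imp_null_set_lborel countable_image) auto

lemma nn_integral_powr_near_0:
  assumes "-1 < b" "0 \<le> c"
  shows "(\<integral>\<^sup>+s. ennreal (s powr b) * indicator {0<..<c} s \<partial>lborel) = ennreal (c powr (b + 1) / (b + 1))"
proof -
  have "(\<integral>\<^sup>+s. ennreal (s powr b) * indicator {0<..<c} s \<partial>lborel)
     = (\<integral>\<^sup>+s. ennreal (s powr b) * indicator {0..c} s \<partial>lborel)"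
    using AE_lborel_singleton[of 0] AE_lborel_singleton[of c]
    by (intro nn_integral_cong_AE, eventually_elim) (auto split: split_indicator)
  also have "\<dots> = ennreal (c powr (b + 1) / (b + 1))"
    by (rule nn_integral_has_integral_lebesgue'[OF _ has_integral_powr_from_0]) (use assms in auto)
  finally show ?thesis .
qed

lemma real_dyadic_ivl:
  assumes "1 < (s::real)"
  obtains n :: nat where "2 ^ n \<le> s" "s < 2 ^ Suc n"
proof -
  define m where "m = (LEAST n. s < (2::real) ^ n)"
  have m: "s < 2 ^ m" unfolding m_def by (rule LeastI_ex) (rule real_arch_pow, simp)
  then have "m \<noteq> 0" using assms by (intro notI) simp
  then obtain n where n: "m = Suc n" by (cases m) auto
  then have "\<not> s < 2 ^ n" using not_less_Least[of n "\<lambda>n. s < (2::real) ^ n"] unfolding m_def[symmetric] by simp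
  then show ?thesis using that[of n] m n by simp
qed

context one_sided_weight begin

text \<open>
  Hoelder's inequality for \<open>1 = \<omega> (1/\<omega>)\<close>; it is the reverse of the weight condition when both
  integrals are taken over the same interval.
\<close>
lemma length_le_W_S:
  assumes "u < v"
  shows "v - u \<le> W u v powr (1 / q) * (v - u) powr \<alpha> * S u v powr (1 / r)"
proof -
  have "(\<integral>\<^sup>+t. ennreal \<bar>1\<bar> * indicator {u<..<v} t \<partial>lborel)
    \<le> ennreal ((W u v powr (p / q) * (v - u) powr (\<alpha> * p)) powr (1 / p) * S u v powr (1 / r))"
  proof (rule local_Holder)
    have "(\<integral>\<^sup>+t. ennreal ((\<bar>1\<bar> * \<omega> t) powr p) * indicator {u<..<v} t \<partial>lborel)
      \<le> (\<integral>\<^sup>+y. ennreal (\<omega> y powr p) * indicator {u..v} y \<partial>lborel)"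
      by (intro nn_integral_mono) (simp split: split_indicator)
    also have "\<dots> \<le> ennreal (W u v powr (p / q) * (v - u) powr (\<alpha> * p))"
      using assms by (intro nn_Wp_le) simp
    finally show "(\<integral>\<^sup>+t. ennreal ((\<bar>1\<bar> * \<omega> t) powr p) * indicator {u<..<v} t \<partial>lborel) \<le> \<dots>" .
  qed auto
  then show ?thesis using assms p by (simp add: powr_mult powr_powr)
qed

lemma S_pos: assumes "u < v" shows "0 < S u v" and W_pos: "0 < W u v"
proof -
  have "S u v \<noteq> 0" "W u v \<noteq> 0" using length_le_W_S[OF assms] assms by auto
  then show "0 < S u v" "0 < W u v" using S_nonneg[of u v] W_nonneg[of u v] by linarith+
qed

text \<open>
  The weight condition compares the mass of \<open>\<omega>\<^sup>q\<close> on the right with that of \<open>\<omega>\<^sup>-\<^sup>r\<close> on the left, and the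
  latter is bounded below in terms of the mass of \<open>\<omega>\<^sup>q\<close> on the left by \<open>length_le_W_S\<close>.
\<close>
lemma W_right_le_left:
  assumes h: "0 < h"
  shows "W x (x + h) \<le> C powr q * W (x - h) x"
proof -
  let ?s = "S (x - h) x powr (1 / r)"
  have s: "0 < ?s" using S_pos[of "x - h" x] h by simp
  have "W x (x + h) powr (1 / q) * ?s \<le> C * h powr (- \<alpha>) * h"
    using Apq'[OF h, of x] h by (simp add: powr_diff powr_minus field_simps)
  also have "\<dots> \<le> C * h powr (- \<alpha>) * (W (x - h) x powr (1 / q) * h powr \<alpha> * ?s)"
    using length_le_W_S[of "x - h" x] h C by (intro mult_left_mono) auto
  also have "\<dots> = C * W (x - h) x powr (1 / q) * ?s"
    using h by (simp add: powr_minus)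
  finally have "W x (x + h) powr (1 / q) \<le> C * W (x - h) x powr (1 / q)"
    using s by simp
  then have "(W x (x + h) powr (1 / q)) powr q \<le> (C * W (x - h) x powr (1 / q)) powr q"
    using q by (intro powr_mono2) auto
  then show ?thesis using q(1) by (simp add: powr_mult powr_powr)
qed

lemma W_add: assumes "u \<le> m" "m \<le> v" shows "W u v = W u m + W m v"
proof -
  have "ennreal (W u v) = (\<integral>\<^sup>+y. ennreal (\<omega> y powr q) * indicator {u..m} y + ennreal (\<omega> y powr q) * indicator {m..v} y \<partial>lborel)"
    unfolding nn_W[symmetric] using assms
    by (intro nn_integral_cong_AE, use AE_lborel_singleton[of m] in eventually_elim)
       (auto split: split_indicator)
  also have "\<dots> = ennreal (W u m + W m v)"
    by (simp add: nn_integral_add nn_W)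
  finally show ?thesis by (subst (asm) ennreal_inj) auto
qed

text \<open>
  By \<open>W_right_le_left\<close> the left neighbour of \<open>[x - h, x]\<close> carries at least a fixed fraction of its
  mass, so every doubling towards the left multiplies the mass by a factor greater than 1.
\<close>
lemma W_reverse_doubling: "(1 + 1 / C powr q) ^ n * W (x - 1) x \<le> W (x - 2 ^ n) x"
proof (induction n)
  case (Suc n)
  let ?h = "(2::real) ^ n"
  have "W (x - ?h) x \<le> C powr q * W (x - 2 * ?h) (x - ?h)"
    using W_right_le_left[of ?h "x - ?h"] by (simp add: algebra_simps)
  then have "1 / C powr q * W (x - ?h) x \<le> W (x - 2 * ?h) (x - ?h)"
    using C by (simp add: field_simps)
  then have "(1 + 1 / C powr q) * W (x - ?h) x \<le> W (x - 2 * ?h) (x - ?h) + W (x - ?h) x"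
    by (simp add: distrib_right)
  also have "\<dots> = W (x - 2 ^ Suc n) x"
    using W_add[of "x - 2 * ?h" "x - ?h" x] by simp
  finally have *: "(1 + 1 / C powr q) * W (x - ?h) x \<le> W (x - 2 ^ Suc n) x" .
  have "(1 + 1 / C powr q) ^ Suc n * W (x - 1) x \<le> (1 + 1 / C powr q) * W (x - ?h) x"
    using mult_left_mono[OF Suc, of "1 + 1 / C powr q"] by (simp add: mult_ac)
  with * show ?case by linarith
qed simp

text \<open>
  The weight condition at \<open>x - 2\<^sup>n\<close>. The powers of \<open>2\<^sup>n\<close> cancel exactly, since \<open>1/q + 1/r = 1 - \<alpha>\<close> is the scaling
  of the Riesz kernel; all the decay comes from \<open>W_reverse_doubling\<close>.
\<close>
lemma S_annulus_decay:
  "(2 ^ n) powr (\<alpha> - 1) * S (x - 2 ^ Suc n) (x - 2 ^ n) powr (1 / r)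
    \<le> C * W (x - 1) x powr (- (1 / q)) * ((1 + 1 / C powr q) powr (- (1 / q))) ^ n"
proof -
  let ?h = "(2::real) ^ n" and ?\<theta> = "1 + 1 / C powr q"
  let ?s = "S (x - 2 * ?h) (x - ?h) powr (1 / r)" and ?w = "?\<theta> ^ n * W (x - 1) x"
  have \<theta>: "0 < ?\<theta>" using C by (intro add_pos_nonneg) auto
  have w: "0 < ?w" using W_pos[of "x - 1" x] \<theta> by simp
  have "?w powr (1 / q) * ?s \<le> W (x - ?h) x powr (1 / q) * ?s"
    using W_reverse_doubling[of n x] w q(1) by (intro mult_right_mono powr_mono2) auto
  also have "\<dots> \<le> C * ?h powr (1 - \<alpha>)"
    using Apq'[of ?h "x - ?h"] by (simp add: algebra_simps)
  finally have *: "?w powr (1 / q) * ?s \<le> C * ?h powr (1 - \<alpha>)" .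
  have "y powr (- c) * y powr c = 1" if "0 < y" for y c :: real
    using that by (simp flip: powr_add)
  from this[OF w, of "1 / q"]
  have "?h powr (\<alpha> - 1) * ?s = ?h powr (\<alpha> - 1) * (?w powr (- (1 / q)) * ?w powr (1 / q)) * ?s"
    by (simp only: mult_1_right)
  also have "\<dots> = ?h powr (\<alpha> - 1) * ?w powr (- (1 / q)) * (?w powr (1 / q) * ?s)"
    by (simp only: mult.assoc)
  also have "\<dots> \<le> ?h powr (\<alpha> - 1) * ?w powr (- (1 / q)) * (C * ?h powr (1 - \<alpha>))"
    by (intro mult_left_mono *) auto
  also have "\<dots> = C * ?w powr (- (1 / q)) * ?h powr ((\<alpha> - 1) + (1 - \<alpha>))"
    unfolding powr_add by (simp add: mult_ac)
  also have "\<dots> = C * ?w powr (- (1 / q))" by simp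
  also have "?w powr (- (1 / q)) = W (x - 1) x powr (- (1 / q)) * (?\<theta> powr (- (1 / q))) ^ n"
    using \<theta> by (simp add: powr_mult powr_powr powr_realpow[symmetric] mult_ac)
  finally show ?thesis by (simp add: mult_ac)
qed

lemma fractional_integral_tail_finite:
  assumes [measurable]: "g \<in> borel_measurable borel"
    and N: "(\<integral>\<^sup>+t. ennreal ((\<bar>g t\<bar> * \<omega> t) powr p) \<partial>lborel) < \<infinity>"
  shows "(\<integral>\<^sup>+s. ennreal (s powr (\<alpha> - 1) * \<bar>g (x - s)\<bar>) * indicator {1<..} s \<partial>lborel) < \<infinity>"
proof -
  let ?N = "\<integral>\<^sup>+t. ennreal ((\<bar>g t\<bar> * \<omega> t) powr p) \<partial>lborel"
  let ?\<rho> = "(1 + 1 / C powr q) powr (- (1 / q))"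
  obtain U where U: "?N = ennreal U" "0 \<le> U" using N by (cases ?N) auto
  let ?c = "U powr (1 / p) * (C * W (x - 1) x powr (- (1 / q)))"
  have \<rho>: "0 \<le> ?\<rho>" "?\<rho> < 1"
  proof -
    have "1 < 1 + 1 / C powr q" using C by simp
    then show "?\<rho> < 1" using q(1) powr_less_mono2_neg[of "- (1 / q)" 1 "1 + 1 / C powr q"] by simp
  qed simp
  have "(\<integral>\<^sup>+s. ennreal (s powr (\<alpha> - 1) * \<bar>g (x - s)\<bar>) * indicator {1<..} s \<partial>lborel)
    \<le> (\<integral>\<^sup>+s. (\<Sum>n. ennreal ((2 ^ n) powr (\<alpha> - 1)) * (ennreal \<bar>g (x - s)\<bar> * indicator {2 ^ n<..<2 ^ Suc n} s)) \<partial>lborel)"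
  proof (rule nn_integral_mono_AE, use AE_not_range_seq[of "\<lambda>n. 2 ^ n"] in eventually_elim)
    fix s :: real assume s: "s \<notin> range (\<lambda>n. 2 ^ n)"
    show "ennreal (s powr (\<alpha> - 1) * \<bar>g (x - s)\<bar>) * indicator {1<..} s
      \<le> (\<Sum>n. ennreal ((2 ^ n) powr (\<alpha> - 1)) * (ennreal \<bar>g (x - s)\<bar> * indicator {2 ^ n<..<2 ^ Suc n} s))"
    proof (cases "1 < s")
      case True
      then obtain n :: nat where "2 ^ n \<le> s" "s < 2 ^ Suc n" by (rule real_dyadic_ivl)
      then have n: "2 ^ n < s" "s < 2 ^ Suc n" using s by (auto simp: order_le_less)
      have "s powr (\<alpha> - 1) \<le> (2 ^ n) powr (\<alpha> - 1)"
        using n \<alpha> by (intro powr_mono2') auto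
      then have "ennreal (s powr (\<alpha> - 1) * \<bar>g (x - s)\<bar>) * indicator {1<..} s
         \<le> ennreal ((2 ^ n) powr (\<alpha> - 1)) * (ennreal \<bar>g (x - s)\<bar> * indicator {2 ^ n<..<2 ^ Suc n} s)"
        using n True by (simp add: mult_right_mono ennreal_leI flip: ennreal_mult)
      also have "\<dots> = (\<Sum>n\<in>{n}. ennreal ((2 ^ n) powr (\<alpha> - 1)) * (ennreal \<bar>g (x - s)\<bar> * indicator {2 ^ n<..<2 ^ Suc n} s))"
        by simp
      also have "\<dots> \<le> (\<Sum>n. ennreal ((2 ^ n) powr (\<alpha> - 1)) * (ennreal \<bar>g (x - s)\<bar> * indicator {2 ^ n<..<2 ^ Suc n} s))"
        by (rule sum_le_suminf) auto
      finally show ?thesis .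
    qed auto
  qed
  also have "\<dots> = (\<Sum>n. ennreal ((2 ^ n) powr (\<alpha> - 1)) * (\<integral>\<^sup>+s. ennreal \<bar>g (x - s)\<bar> * indicator {2 ^ n<..<2 ^ Suc n} s \<partial>lborel))"
    by (subst nn_integral_suminf) (auto simp: nn_integral_cmult)
  also have "\<dots> \<le> (\<Sum>n. ennreal (?c * ?\<rho> ^ n))"
  proof (intro suminf_le)
    fix n
    have "(\<integral>\<^sup>+t. ennreal ((\<bar>g t\<bar> * \<omega> t) powr p) * indicator {x - 2 ^ Suc n<..<x - 2 ^ n} t \<partial>lborel) \<le> ennreal U"
      unfolding U(1)[symmetric] by (intro nn_integral_mono) (simp split: split_indicator)
    then have "(\<integral>\<^sup>+t. ennreal \<bar>g t\<bar> * indicator {x - 2 ^ Suc n<..<x - 2 ^ n} t \<partial>lborel)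
        \<le> ennreal (U powr (1 / p) * S (x - 2 ^ Suc n) (x - 2 ^ n) powr (1 / r))"
      using U by (intro local_Holder) auto
    then have "ennreal ((2 ^ n) powr (\<alpha> - 1)) * (\<integral>\<^sup>+s. ennreal \<bar>g (x - s)\<bar> * indicator {2 ^ n<..<2 ^ Suc n} s \<partial>lborel)
      \<le> ennreal ((2 ^ n) powr (\<alpha> - 1)) * ennreal (U powr (1 / p) * S (x - 2 ^ Suc n) (x - 2 ^ n) powr (1 / r))"
      by (subst nn_integral_annulus[where \<phi>="\<lambda>t. ennreal \<bar>g t\<bar>"]) (auto intro: mult_left_mono)
    also have "\<dots> = ennreal (U powr (1 / p) * ((2 ^ n) powr (\<alpha> - 1) * S (x - 2 ^ Suc n) (x - 2 ^ n) powr (1 / r)))"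
      by (simp add: mult_ac flip: ennreal_mult)
    also have "\<dots> \<le> ennreal (U powr (1 / p) * (C * W (x - 1) x powr (- (1 / q)) * ?\<rho> ^ n))"
      by (intro ennreal_leI mult_left_mono S_annulus_decay) auto
    finally show "ennreal ((2 ^ n) powr (\<alpha> - 1)) * (\<integral>\<^sup>+s. ennreal \<bar>g (x - s)\<bar> * indicator {2 ^ n<..<2 ^ Suc n} s \<partial>lborel)
       \<le> ennreal (?c * ?\<rho> ^ n)" by (simp add: mult_ac)
  qed auto
  also have "\<dots> < \<infinity>"
    using \<rho> C by (subst suminf_ennreal2) (auto intro!: summable_mult summable_geometric)
  finally show ?thesis .
qed

text \<open>Integrate over bounded sets of \<open>x\<close>: there the local integrability of \<open>g\<close> and of the kernel suffices.\<close>
lemma fractional_integral_local_finite: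
  assumes [measurable]: "g \<in> borel_measurable borel"
    and N: "(\<integral>\<^sup>+t. ennreal ((\<bar>g t\<bar> * \<omega> t) powr p) \<partial>lborel) < \<infinity>"
  shows "AE x in lborel. (\<integral>\<^sup>+s. ennreal (s powr (\<alpha> - 1) * \<bar>g (x - s)\<bar>) * indicator {0<..<2} s \<partial>lborel) < \<infinity>"
proof -
  let ?T = "\<lambda>x. \<integral>\<^sup>+s. ennreal (s powr (\<alpha> - 1) * \<bar>g (x - s)\<bar>) * indicator {0<..<2} s \<partial>lborel"
  have "AE x in lborel. x \<in> {-real n<..<real n} \<longrightarrow> ?T x < \<infinity>" for n :: nat
  proof -
    let ?A = "\<integral>\<^sup>+t. ennreal \<bar>g t\<bar> * indicator {-real n - 2<..<real n} t \<partial>lborel"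
    have A: "?A < \<infinity>" by (intro annulus_Holder N) auto
    have "(\<integral>\<^sup>+x. ?T x * indicator {-real n<..<real n} x \<partial>lborel)
      = (\<integral>\<^sup>+x. \<integral>\<^sup>+s. ennreal (s powr (\<alpha> - 1)) * indicator {0<..<2} s * (ennreal \<bar>g (x - s)\<bar> * indicator {-real n<..<real n} x) \<partial>lborel \<partial>lborel)"
      by (subst nn_integral_multc[symmetric]) (auto simp: ennreal_mult mult_ac)
    also have "\<dots> = (\<integral>\<^sup>+s. \<integral>\<^sup>+x. ennreal (s powr (\<alpha> - 1)) * indicator {0<..<2} s * (ennreal \<bar>g (x - s)\<bar> * indicator {-real n<..<real n} x) \<partial>lborel \<partial>lborel)"
      by (rule lborel_pair.Fubini') measurable
    also have "\<dots> = (\<integral>\<^sup>+s. ennreal (s powr (\<alpha> - 1)) * indicator {0<..<2} s * (\<integral>\<^sup>+x. ennreal \<bar>g (x - s)\<bar> * indicator {-real n<..<real n} x \<partial>lborel) \<partial>lborel)"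
      by (intro nn_integral_cong nn_integral_cmult) measurable
    also have "\<dots> \<le> (\<integral>\<^sup>+s. ennreal (s powr (\<alpha> - 1)) * indicator {0<..<2} s * ?A \<partial>lborel)"
    proof (rule nn_integral_mono)
      fix s :: real
      have "(\<integral>\<^sup>+x. ennreal \<bar>g (x - s)\<bar> * indicator {-real n<..<real n} x \<partial>lborel) \<le> ?A" if "0 < s" "s < 2"
      proof -
        have "(\<integral>\<^sup>+x. ennreal \<bar>g (x - s)\<bar> * indicator {-real n<..<real n} x \<partial>lborel)
            = (\<integral>\<^sup>+t. ennreal \<bar>g t\<bar> * indicator {-real n<..<real n} (s + t) \<partial>lborel)"
          by (subst nn_integral_real_affine[where c=1 and t=s]) auto
        also have "\<dots> \<le> ?A" using that by (intro nn_integral_mono) (auto split: split_indicator)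
        finally show ?thesis .
      qed
      then show "ennreal (s powr (\<alpha> - 1)) * indicator {0<..<2} s * (\<integral>\<^sup>+x. ennreal \<bar>g (x - s)\<bar> * indicator {-real n<..<real n} x \<partial>lborel)
         \<le> ennreal (s powr (\<alpha> - 1)) * indicator {0<..<2} s * ?A"
        by (cases "0 < s \<and> s < 2") (auto intro!: mult_left_mono)
    qed
    also have "\<dots> = ennreal (2 powr (\<alpha> - 1 + 1) / (\<alpha> - 1 + 1)) * ?A"
      using \<alpha> by (subst nn_integral_multc) (auto simp: nn_integral_powr_near_0)
    also have "\<dots> < \<infinity>" using A by (simp add: ennreal_mult_less_top)
    finally have "AE x in lborel. ?T x * indicator {-real n<..<real n} x \<noteq> \<infinity>"
      by (intro nn_integral_PInf_AE) auto
    then show ?thesis by eventually_elim (auto simp: less_top)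
  qed
  then have "AE x in lborel. \<forall>n::nat. x \<in> {-real n<..<real n} \<longrightarrow> ?T x < \<infinity>"
    by (subst AE_all_countable) auto
  then show ?thesis
  proof eventually_elim
    case (elim x)
    obtain n :: nat where "\<bar>x\<bar> < real n" using reals_Archimedean2 by blast
    then have "x \<in> {-real n<..<real n}" by auto
    then show ?case using elim by blast
  qed
qed

lemma fractional_integral_finite:
  assumes [measurable]: "g \<in> borel_measurable borel"
    and N: "(\<integral>\<^sup>+t. ennreal ((\<bar>g t\<bar> * \<omega> t) powr p) \<partial>lborel) < \<infinity>"
  shows "AE x in lborel. (\<integral>\<^sup>+s. ennreal (s powr (\<alpha> - 1) * \<bar>g (x - s)\<bar>) * indicator {0<..} s \<partial>lborel) < \<infinity>"
  using fractional_integral_local_finite[OF assms]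
proof eventually_elim
  case (elim x)
  have "(\<integral>\<^sup>+s. ennreal (s powr (\<alpha> - 1) * \<bar>g (x - s)\<bar>) * indicator {0<..} s \<partial>lborel)
    \<le> (\<integral>\<^sup>+s. ennreal (s powr (\<alpha> - 1) * \<bar>g (x - s)\<bar>) * indicator {0<..<2} s
         + ennreal (s powr (\<alpha> - 1) * \<bar>g (x - s)\<bar>) * indicator {1<..} s \<partial>lborel)"
    by (intro nn_integral_mono) (auto split: split_indicator)
  also have "\<dots> = (\<integral>\<^sup>+s. ennreal (s powr (\<alpha> - 1) * \<bar>g (x - s)\<bar>) * indicator {0<..<2} s \<partial>lborel)
     + (\<integral>\<^sup>+s. ennreal (s powr (\<alpha> - 1) * \<bar>g (x - s)\<bar>) * indicator {1<..} s \<partial>lborel)"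
    by (rule nn_integral_add) measurable
  also have "\<dots> < \<infinity>" using elim fractional_integral_tail_finite[OF assms, of x] by simp
  finally show ?case .
qed

end

section \<open>The kernel of the truncated inversion\<close>

text \<open>
  This is \<open>\<epsilon>\<^sup>-\<^sup>\<alpha> (s\<^sup>\<alpha> - (s - \<epsilon>)\<^sub>+\<^sup>\<alpha>) / s\<close>, divided by its mass \<open>\<Gamma>(\<alpha>) \<Gamma>(1 - \<alpha>) = \<pi> / sin (\<pi> \<alpha>)\<close>.
\<close>
definition truncation_kernel :: "real \<Rightarrow> real \<Rightarrow> real \<Rightarrow> real" where
  "truncation_kernel \<alpha> \<epsilon> s =
     (if 0 < s then (s powr \<alpha> - (max 0 (s - \<epsilon>)) powr \<alpha>) / (\<epsilon> powr \<alpha> * s * (Gamma \<alpha> * Gamma (1 - \<alpha>))) else 0)"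

lemma measurable_truncation_kernel [measurable]: "truncation_kernel \<alpha> \<epsilon> \<in> borel_measurable borel"
  unfolding truncation_kernel_def by measurable

lemma powr_one_minus_bounds:
  fixes \<alpha> m :: real
  assumes "0 < \<alpha>" "\<alpha> < 1" "0 \<le> m" "m \<le> 1"
  shows "(1 - m) powr \<alpha> \<le> 1 - \<alpha> * m" "1 - m \<le> (1 - m) powr \<alpha>"
proof -
  show "(1 - m) powr \<alpha> \<le> 1 - \<alpha> * m"
  proof (cases "m = 1")
    case False
    then show ?thesis
      using Youngs_inequality_0[of \<alpha> "1 - \<alpha>" "1 - m" 1] assms by (simp add: algebra_simps)
  qed (use assms in auto)
  show "1 - m \<le> (1 - m) powr \<alpha>"
    using powr_mono'[of \<alpha> 1 "1 - m"] assms by simp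
qed

lemma nn_integral_powr_interval:
  assumes "-1 < b" "0 \<le> c" "c \<le> d"
  shows "(\<integral>\<^sup>+s. ennreal (s powr b) * indicator {c<..<d} s \<partial>lborel) = ennreal ((d powr (b + 1) - c powr (b + 1)) / (b + 1))"
proof -
  let ?I = "\<integral>\<^sup>+s. ennreal (s powr b) * indicator {c<..<d} s \<partial>lborel"
  have "ennreal (d powr (b + 1) / (b + 1))
      = (\<integral>\<^sup>+s. ennreal (s powr b) * indicator {0<..<c} s + ennreal (s powr b) * indicator {c<..<d} s \<partial>lborel)"
    unfolding nn_integral_powr_near_0[OF assms(1) order_trans[OF assms(2,3)], symmetric]
    using assms by (intro nn_integral_cong_AE, use AE_lborel_singleton[of c] in eventually_elim)
      (auto split: split_indicator)
  also have "\<dots> = ennreal (c powr (b + 1) / (b + 1)) + ?I"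
    using assms by (simp add: nn_integral_add nn_integral_powr_near_0)
  finally have eq: "ennreal (d powr (b + 1) / (b + 1)) = ennreal (c powr (b + 1) / (b + 1)) + ?I" .
  then have "?I \<noteq> \<infinity>" by auto
  then obtain i where i: "?I = ennreal i" "0 \<le> i" by (cases ?I) auto
  have "d powr (b + 1) / (b + 1) = c powr (b + 1) / (b + 1) + i"
    using eq i assms by (simp flip: ennreal_plus)
  then show ?thesis unfolding i by (simp add: diff_divide_distrib)
qed

context
  fixes \<alpha> :: real
  assumes \<alpha>: "0 < \<alpha>" "\<alpha> < 1"
begin

lemma Gamma_product_pos: "0 < Gamma \<alpha> * Gamma (1 - \<alpha>)"
  using \<alpha> by (intro mult_pos_pos Gamma_real_pos) auto

text \<open>In this form the kernel is visibly a product of two nonnegative nonincreasing functions of \<open>s\<close>.\<close>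
lemma truncation_kernel_eq:
  assumes "0 < s" "0 < \<epsilon>"
  shows "truncation_kernel \<alpha> \<epsilon> s
    = s powr (\<alpha> - 1) * (1 - (1 - min 1 (\<epsilon> / s)) powr \<alpha>) / (\<epsilon> powr \<alpha> * (Gamma \<alpha> * Gamma (1 - \<alpha>)))"
proof -
  have "max 0 (s - \<epsilon>) = s * (1 - min 1 (\<epsilon> / s))"
    using assms by (auto simp: max_def min_def field_simps)
  then have "max 0 (s - \<epsilon>) powr \<alpha> = s powr \<alpha> * (1 - min 1 (\<epsilon> / s)) powr \<alpha>"
    by (simp only: powr_mult)
  then have "s powr \<alpha> - (max 0 (s - \<epsilon>)) powr \<alpha> = s * s powr (\<alpha> - 1) * (1 - (1 - min 1 (\<epsilon> / s)) powr \<alpha>)"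
    unfolding right_diff_distrib using assms by (simp add: powr_mult_base)
  then show ?thesis using assms by (simp add: truncation_kernel_def)
qed

lemma truncation_kernel_nonpos: "s \<le> 0 \<Longrightarrow> truncation_kernel \<alpha> \<epsilon> s = 0"
  by (simp add: truncation_kernel_def)

lemma truncation_kernel_nonneg: "0 < \<epsilon> \<Longrightarrow> 0 \<le> truncation_kernel \<alpha> \<epsilon> s"
  using Gamma_product_pos \<alpha> by (auto simp: truncation_kernel_def intro!: divide_nonneg_nonneg powr_mono2)

lemma truncation_kernel_decreasing:
  assumes "0 < \<epsilon>" "0 < s" "s \<le> t"
  shows "truncation_kernel \<alpha> \<epsilon> t \<le> truncation_kernel \<alpha> \<epsilon> s"
proof -
  have t: "0 < t" using assms by simp
  have m: "min 1 (\<epsilon> / t) \<le> min 1 (\<epsilon> / s)"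
    using assms t by (intro min.mono order_refl divide_left_mono) auto
  have "(1 - min 1 (\<epsilon> / s)) powr \<alpha> \<le> (1 - min 1 (\<epsilon> / t)) powr \<alpha>"
    using m \<alpha> by (intro powr_mono2) auto
  moreover have "(1 - min 1 (\<epsilon> / t)) powr \<alpha> \<le> 1"
    using \<alpha> t assms by (intro powr_le1) auto
  moreover have "t powr (\<alpha> - 1) \<le> s powr (\<alpha> - 1)"
    using assms \<alpha> by (intro powr_mono2') auto
  ultimately show ?thesis
    unfolding truncation_kernel_eq[OF assms(2,1)] truncation_kernel_eq[OF t assms(1)]
    using Gamma_product_pos by (intro divide_right_mono mult_mono) auto
qed

lemma truncation_kernel_le:
  assumes "0 < \<epsilon>" "0 < s"
  shows "truncation_kernel \<alpha> \<epsilon> s \<le> \<epsilon> powr (1 - \<alpha>) * s powr (\<alpha> - 2) / (Gamma \<alpha> * Gamma (1 - \<alpha>))"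
proof -
  have "1 - (1 - min 1 (\<epsilon> / s)) powr \<alpha> \<le> min 1 (\<epsilon> / s)"
    using powr_one_minus_bounds(2)[OF \<alpha>, of "min 1 (\<epsilon> / s)"] assms by simp
  also have "\<dots> \<le> \<epsilon> / s" by simp
  finally have "truncation_kernel \<alpha> \<epsilon> s \<le> s powr (\<alpha> - 1) * (\<epsilon> / s) / (\<epsilon> powr \<alpha> * (Gamma \<alpha> * Gamma (1 - \<alpha>)))"
    unfolding truncation_kernel_eq[OF assms(2,1)]
    using Gamma_product_pos by (intro divide_right_mono mult_left_mono) auto
  also have "s powr (\<alpha> - 1) * (\<epsilon> / s) = \<epsilon> * s powr (\<alpha> - 2)"
    using assms powr_diff[of s "\<alpha> - 1" 1] by (simp add: field_simps)
  also have "\<epsilon> * s powr (\<alpha> - 2) / (\<epsilon> powr \<alpha> * (Gamma \<alpha> * Gamma (1 - \<alpha>)))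
     = \<epsilon> powr (1 - \<alpha>) * s powr (\<alpha> - 2) / (Gamma \<alpha> * Gamma (1 - \<alpha>))"
    using assms by (simp add: powr_diff)
  finally show ?thesis .
qed

text \<open>
  Beyond \<open>s = 1\<close> all kernels with \<open>\<epsilon> \<le> 1\<close> have the tail \<open>\<epsilon>\<^sup>1\<^sup>-\<^sup>\<alpha> s\<^sup>\<alpha>\<^sup>-\<^sup>2\<close> up to constants, which is largest
  for \<open>\<epsilon> = 1\<close>. This provides the dominating function for the convergence in norm.
\<close>
lemma truncation_kernel_le_unit:
  assumes "0 < \<epsilon>" "\<epsilon> \<le> 1" "1 \<le> s"
  shows "\<alpha> * truncation_kernel \<alpha> \<epsilon> s \<le> truncation_kernel \<alpha> 1 s"
proof -
  have s: "0 < s" using assms by simp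
  have "\<alpha> * truncation_kernel \<alpha> \<epsilon> s \<le> \<alpha> * (\<epsilon> powr (1 - \<alpha>) * s powr (\<alpha> - 2) / (Gamma \<alpha> * Gamma (1 - \<alpha>)))"
    using truncation_kernel_le[OF assms(1) s] \<alpha> by (intro mult_left_mono) auto
  also have "\<dots> \<le> \<alpha> * (1 * s powr (\<alpha> - 2) / (Gamma \<alpha> * Gamma (1 - \<alpha>)))"
    using Gamma_product_pos \<alpha> assms
    by (intro mult_left_mono divide_right_mono mult_right_mono powr_le1) auto
  also have "\<dots> = s powr (\<alpha> - 1) * (\<alpha> * (1 / s)) / (Gamma \<alpha> * Gamma (1 - \<alpha>))"
    using s powr_diff[of s "\<alpha> - 1" 1] by simp
  also have "\<dots> \<le> s powr (\<alpha> - 1) * (1 - (1 - 1 / s) powr \<alpha>) / (Gamma \<alpha> * Gamma (1 - \<alpha>))"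
    using powr_one_minus_bounds(1)[OF \<alpha>, of "1 / s"] assms Gamma_product_pos
    by (intro divide_right_mono mult_left_mono) auto
  also have "\<dots> = truncation_kernel \<alpha> 1 s"
    using truncation_kernel_eq[OF s, of 1] assms by (simp add: min_def)
  finally show ?thesis .
qed

lemma truncation_kernel_scale:
  assumes "0 < \<epsilon>"
  shows "truncation_kernel \<alpha> \<epsilon> (\<epsilon> * s) = truncation_kernel \<alpha> 1 s / \<epsilon>"
proof (cases "0 < s")
  case True
  have "max 0 (\<epsilon> * s - \<epsilon>) = \<epsilon> * max 0 (s - 1)"
    using assms by (auto simp: max_def algebra_simps)
  then have "(\<epsilon> * s) powr \<alpha> - (max 0 (\<epsilon> * s - \<epsilon>)) powr \<alpha> = \<epsilon> powr \<alpha> * (s powr \<alpha> - max 0 (s - 1) powr \<alpha>)"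
    by (simp add: powr_mult right_diff_distrib)
  then show ?thesis using True assms by (simp add: truncation_kernel_def mult_ac)
qed (use assms in \<open>simp add: truncation_kernel_def zero_less_mult_iff\<close>)

text \<open>
  Write \<open>1 - (1 - m)\<^sup>\<alpha>\<close>, with \<open>m = min 1 (1/s)\<close>, as the integral of \<open>\<alpha> u\<^sup>\<alpha>\<^sup>-\<^sup>1\<close> over \<open>(1 - m, 1)\<close>. For \<open>0 < u < 1\<close> the condition
  \<open>1 - m < u\<close> means \<open>s < 1 / (1 - u)\<close>, so that integrating in \<open>s\<close> first leaves a Beta integral in \<open>u\<close>.
\<close>
lemma nn_integral_truncation_kernel_1:
  "(\<integral>\<^sup>+s. ennreal (truncation_kernel \<alpha> 1 s) \<partial>lborel) = 1"
proof -
  let ?c = "Gamma \<alpha> * Gamma (1 - \<alpha>)"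
  let ?d = "\<alpha> / ?c"
  have c: "0 < ?c" by (rule Gamma_product_pos)
  have "ennreal (truncation_kernel \<alpha> 1 s)
    = (\<integral>\<^sup>+u. ennreal ?d * (ennreal (s powr (\<alpha> - 1)) * indicator {0<..<1 / (1 - u)} s * (ennreal (u powr (\<alpha> - 1)) * indicator {0<..<1} u)) \<partial>lborel)" for s
  proof (cases "0 < s")
    case True
    define m where "m = min 1 (1 / s)"
    have m: "0 < m" "m \<le> 1" using True by (auto simp: m_def)
    have ind: "indicator {0<..<1 / (1 - u)} s * indicator {0<..<1} u = (indicator {1 - m<..<1} u :: ennreal)" if "u \<noteq> 0" for u
    proof (cases "0 < u \<and> u < 1")
      case u: True
      have "s < 1 / (1 - u) \<longleftrightarrow> 1 - m < u"
      proof (cases "s \<le> 1")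
        case True
        then have "s * (1 - u) \<le> 1 - u" using u by (intro mult_left_le_one_le) (use \<open>0 < s\<close> in auto)
        then have "s * (1 - u) < 1" using u by linarith
        then show ?thesis using u True \<open>0 < s\<close> by (simp add: m_def field_simps)
      qed (use u True in \<open>auto simp: m_def min_def field_simps\<close>)
      then show ?thesis using u True by (auto split: split_indicator)
    next
      case False
      then show ?thesis using that m True by (auto simp: divide_less_0_iff split: split_indicator)
    qed
    have "ennreal (?d * s powr (\<alpha> - 1)) = ennreal ?d * ennreal (s powr (\<alpha> - 1))"
      using c \<alpha> by (intro ennreal_mult) auto
    then have "(\<integral>\<^sup>+u. ennreal ?d * (ennreal (s powr (\<alpha> - 1)) * indicator {0<..<1 / (1 - u)} s * (ennreal (u powr (\<alpha> - 1)) * indicator {0<..<1} u)) \<partial>lborel)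
      = (\<integral>\<^sup>+u. ennreal (?d * s powr (\<alpha> - 1)) * (ennreal (u powr (\<alpha> - 1)) * indicator {1 - m<..<1} u) \<partial>lborel)"
      by (intro nn_integral_cong_AE, use AE_lborel_singleton[of 0] in eventually_elim)
        (simp only: ind[symmetric] mult_ac not_False_eq_True)
    also have "\<dots> = ennreal (?d * s powr (\<alpha> - 1)) * ennreal ((1 - (1 - m) powr \<alpha>) / \<alpha>)"
      using m \<alpha> nn_integral_powr_interval[of "\<alpha> - 1" "1 - m" 1] by (simp add: nn_integral_cmult)
    also have "\<dots> = ennreal (s powr (\<alpha> - 1) * (1 - (1 - m) powr \<alpha>) / ?c)"
      using \<alpha> c by (simp flip: ennreal_mult')
    also have "\<dots> = ennreal (truncation_kernel \<alpha> 1 s)"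
      using truncation_kernel_eq[OF True, of 1] by (simp add: m_def)
    finally show ?thesis by simp
  next
    case False
    then have "{0<..<1 / (1 - u)} \<inter> {s} = {}" for u by auto
    then show ?thesis using False by (auto simp: truncation_kernel_nonpos indicator_def)
  qed
  then have "(\<integral>\<^sup>+s. ennreal (truncation_kernel \<alpha> 1 s) \<partial>lborel)
     = (\<integral>\<^sup>+s. \<integral>\<^sup>+u. ennreal ?d * (ennreal (s powr (\<alpha> - 1)) * indicator {0<..<1 / (1 - u)} s * (ennreal (u powr (\<alpha> - 1)) * indicator {0<..<1} u)) \<partial>lborel \<partial>lborel)"
    by simp
  also have "\<dots> = (\<integral>\<^sup>+u. \<integral>\<^sup>+s. ennreal ?d * (ennreal (s powr (\<alpha> - 1)) * indicator {0<..<1 / (1 - u)} s * (ennreal (u powr (\<alpha> - 1)) * indicator {0<..<1} u)) \<partial>lborel \<partial>lborel)"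
    by (rule lborel_pair.Fubini') measurable
  also have "\<dots> = (\<integral>\<^sup>+u. ennreal (1 / ?c) * (ennreal (u powr (\<alpha> - 1) * (1 - u) powr (1 - \<alpha> - 1)) * indicator {0..1} u) \<partial>lborel)"
  proof (rule nn_integral_cong_AE, use AE_lborel_singleton[of 0] AE_lborel_singleton[of 1] in eventually_elim)
    fix u :: real assume u: "u \<noteq> 0" "u \<noteq> 1"
    show "(\<integral>\<^sup>+s. ennreal ?d * (ennreal (s powr (\<alpha> - 1)) * indicator {0<..<1 / (1 - u)} s * (ennreal (u powr (\<alpha> - 1)) * indicator {0<..<1} u)) \<partial>lborel)
      = ennreal (1 / ?c) * (ennreal (u powr (\<alpha> - 1) * (1 - u) powr (1 - \<alpha> - 1)) * indicator {0..1} u)"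
    proof (cases "0 < u \<and> u < 1")
      case True
      have "(\<integral>\<^sup>+s. ennreal ?d * (ennreal (s powr (\<alpha> - 1)) * indicator {0<..<1 / (1 - u)} s * (ennreal (u powr (\<alpha> - 1)) * indicator {0<..<1} u)) \<partial>lborel)
        = ennreal ?d * (ennreal ((1 / (1 - u)) powr (\<alpha> - 1 + 1) / (\<alpha> - 1 + 1)) * ennreal (u powr (\<alpha> - 1)))"
        using True \<alpha> by (simp add: nn_integral_cmult nn_integral_multc nn_integral_powr_near_0)
      also have "\<dots> = ennreal (1 / ?c * (u powr (\<alpha> - 1) * (1 - u) powr (1 - \<alpha> - 1)))"
        using True \<alpha> c by (simp add: powr_divide powr_minus field_simps flip: ennreal_mult')
      also have "\<dots> = ennreal (1 / ?c) * (ennreal (u powr (\<alpha> - 1) * (1 - u) powr (1 - \<alpha> - 1)) * indicator {0..1} u)"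
        using True c by (subst ennreal_mult) auto
      finally show ?thesis .
    qed (use u in \<open>auto split: split_indicator\<close>)
  qed
  also have "\<dots> = ennreal (1 / ?c) * (\<integral>\<^sup>+u. ennreal (u powr (\<alpha> - 1) * (1 - u) powr (1 - \<alpha> - 1)) * indicator {0..1} u \<partial>lborel)"
    by (rule nn_integral_cmult) measurable
  also have "(\<integral>\<^sup>+u. ennreal (u powr (\<alpha> - 1) * (1 - u) powr (1 - \<alpha> - 1)) * indicator {0..1} u \<partial>lborel) = ennreal (Beta \<alpha> (1 - \<alpha>))"
    by (rule nn_integral_has_integral_lebesgue'[OF _ has_integral_Beta_real]) (use \<alpha> in auto)
  also have "Beta \<alpha> (1 - \<alpha>) = ?c" by (simp add: Beta_def)
  also have "ennreal (1 / ?c) * ennreal ?c = 1"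
    using c by (subst ennreal_mult[symmetric]) (auto simp: less_imp_neq[symmetric])
  finally show ?thesis .
qed

lemma nn_integral_truncation_kernel:
  assumes "0 < \<epsilon>"
  shows "(\<integral>\<^sup>+s. ennreal (truncation_kernel \<alpha> \<epsilon> s) \<partial>lborel) = 1"
proof -
  have "(\<integral>\<^sup>+s. ennreal (truncation_kernel \<alpha> \<epsilon> s) \<partial>lborel)
      = ennreal \<epsilon> * (\<integral>\<^sup>+s. ennreal (truncation_kernel \<alpha> \<epsilon> (\<epsilon> * s)) \<partial>lborel)"
    using assms by (subst nn_integral_real_affine[where c=\<epsilon> and t=0]) auto
  also have "\<dots> = (\<integral>\<^sup>+s. ennreal \<epsilon> * ennreal (truncation_kernel \<alpha> 1 s / \<epsilon>) \<partial>lborel)"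
    using assms by (simp add: truncation_kernel_scale nn_integral_cmult)
  also have "\<dots> = (\<integral>\<^sup>+s. ennreal (truncation_kernel \<alpha> 1 s) \<partial>lborel)"
    using assms by (intro nn_integral_cong) (simp flip: ennreal_mult')
  finally show ?thesis by (simp add: nn_integral_truncation_kernel_1)
qed

end

section \<open>The truncated derivative of a Riesz potential\<close>

definition riesz_kernel :: "real \<Rightarrow> real \<Rightarrow> real" where
  "riesz_kernel \<alpha> s = (if 0 < s then s powr (\<alpha> - 1) / Gamma \<alpha> else 0)"

lemma measurable_riesz_kernel [measurable]: "riesz_kernel \<alpha> \<in> borel_measurable borel"
  unfolding riesz_kernel_def by measurable

context
  fixes \<alpha> :: real
  assumes \<alpha>: "0 < \<alpha>" "\<alpha> < 1"
begin

text \<open>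
  The substitution \<open>v = (s - y) / y\<close> turns the integrand into \<open>v\<^sup>\<alpha>\<^sup>-\<^sup>1 / s\<close>, which explains the
  antiderivative used in the proof.
\<close>
lemma tail_riesz_convolution_has_integral:
  assumes \<epsilon>: "0 < \<epsilon>" "\<epsilon> \<le> s"
  shows "((\<lambda>y. y powr (- 1 - \<alpha>) * (s - y) powr (\<alpha> - 1)) has_integral (s - \<epsilon>) powr \<alpha> / (\<epsilon> powr \<alpha> * \<alpha> * s)) {\<epsilon>..s}"
proof -
  let ?F = "\<lambda>y. - (((s - y) / y) powr \<alpha> / (\<alpha> * s))"
  have "((\<lambda>y. y powr (- 1 - \<alpha>) * (s - y) powr (\<alpha> - 1)) has_integral (?F s - ?F \<epsilon>)) {\<epsilon>..s}"
  proof (rule fundamental_theorem_of_calculus_interior)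
    show "continuous_on {\<epsilon>..s} ?F"
      using \<epsilon> \<alpha> by (intro continuous_intros continuous_on_powr') auto
    fix y assume y: "y \<in> {\<epsilon><..<s}"
    then have pos: "0 < y" "0 < s - y" "0 < s" using \<epsilon> by auto
    have "(?F has_real_derivative - (\<alpha> * ((s - y) / y) powr (\<alpha> - 1) * ((- 1 * y - (s - y) * 1) / (y * y)) / (\<alpha> * s))) (at y)"
      using pos \<alpha> by (auto intro!: derivative_eq_intros simp: field_simps powr_diff)
    also have "- (\<alpha> * ((s - y) / y) powr (\<alpha> - 1) * ((- 1 * y - (s - y) * 1) / (y * y)) / (\<alpha> * s))
        = ((s - y) / y) powr (\<alpha> - 1) / (y * y)"
      using pos \<alpha> by (simp add: field_simps)
    also have "\<dots> = y powr (- 1 - \<alpha>) * (s - y) powr (\<alpha> - 1)"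
    proof -
      have "y powr (- 1 - \<alpha>) = y powr (- (\<alpha> - 1) - 2)" by simp
      also have "\<dots> = 1 / (y powr (\<alpha> - 1) * (y * y))"
        using pos by (simp only: powr_diff powr_minus) (simp add: field_simps power2_eq_square)
      finally show ?thesis using pos by (simp add: powr_divide)
    qed
    finally show "(?F has_vector_derivative y powr (- 1 - \<alpha>) * (s - y) powr (\<alpha> - 1)) (at y)"
      by (simp add: has_real_derivative_iff_has_vector_derivative)
  qed (use \<epsilon> in auto)
  also have "?F s - ?F \<epsilon> = (s - \<epsilon>) powr \<alpha> / (\<epsilon> powr \<alpha> * \<alpha> * s)"
    using \<epsilon> \<alpha> by (simp add: powr_divide mult_ac)
  finally show ?thesis .
qed

lemma nn_integral_tail_riesz_convolution:
  assumes \<epsilon>: "0 < \<epsilon>"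
  shows "(\<integral>\<^sup>+y. ennreal ((if \<epsilon> < y then y powr (- 1 - \<alpha>) else 0) * riesz_kernel \<alpha> (s - y)) \<partial>lborel)
    = ennreal (if 0 < s then max 0 (s - \<epsilon>) powr \<alpha> / (\<epsilon> powr \<alpha> * \<alpha> * s * Gamma \<alpha>) else 0)"
proof (cases "\<epsilon> \<le> s")
  case True
  have G: "0 < Gamma \<alpha>" using \<alpha> by (intro Gamma_real_pos)
  have "(\<integral>\<^sup>+y. ennreal ((if \<epsilon> < y then y powr (- 1 - \<alpha>) else 0) * riesz_kernel \<alpha> (s - y)) \<partial>lborel)
    = (\<integral>\<^sup>+y. ennreal (1 / Gamma \<alpha>) * (ennreal (y powr (- 1 - \<alpha>) * (s - y) powr (\<alpha> - 1)) * indicator {\<epsilon>..s} y) \<partial>lborel)"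
    using G by (intro nn_integral_cong_AE, use AE_lborel_singleton[of \<epsilon>] in eventually_elim)
      (auto simp: riesz_kernel_def mult_ac split: split_indicator simp flip: ennreal_mult')
  also have "\<dots> = ennreal (1 / Gamma \<alpha>) * ennreal ((s - \<epsilon>) powr \<alpha> / (\<epsilon> powr \<alpha> * \<alpha> * s))"
    by (subst nn_integral_cmult, measurable)
       (subst nn_integral_has_integral_lebesgue'[OF _ tail_riesz_convolution_has_integral[OF \<epsilon> True]], auto)
  also have "\<dots> = ennreal (if 0 < s then max 0 (s - \<epsilon>) powr \<alpha> / (\<epsilon> powr \<alpha> * \<alpha> * s * Gamma \<alpha>) else 0)"
    using G True \<epsilon> \<alpha> by (simp add: max_def mult_ac flip: ennreal_mult')
  finally show ?thesis .
next
  case False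
  then have zero: "(if \<epsilon> < y then y powr (- 1 - \<alpha>) else 0) * riesz_kernel \<alpha> (s - y) = 0" for y
    by (auto simp: riesz_kernel_def)
  show ?thesis unfolding zero using False by (simp add: max_def)
qed

text \<open>
  With \<open>A(y) = y\<^sup>-\<^sup>1\<^sup>-\<^sup>\<alpha>\<close> on \<open>(\<epsilon>, \<infinity>)\<close> and \<open>R\<close> the Riesz kernel, the left-hand side is \<open>((\<integral> A) R - A * R) * g\<close> by Fubini,
  and \<open>A * R\<close> is known in closed form from \<open>nn_integral_tail_riesz_convolution\<close>. Since \<open>A * R\<close> is
  at most a multiple of \<open>R\<close>, finiteness of \<open>R * \<bar>g\<bar>\<close> at \<open>x\<close> is all that Fubini's theorem requires.
\<close>
lemma truncated_derivative_of_riesz_potential: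
  assumes \<epsilon>: "0 < \<epsilon>" and [measurable]: "g \<in> borel_measurable borel"
    and fin: "(\<integral>\<^sup>+s. ennreal (s powr (\<alpha> - 1) * \<bar>g (x - s)\<bar>) * indicator {0<..} s \<partial>lborel) < \<infinity>"
  shows "\<alpha> / Gamma (1 - \<alpha>) * (\<integral>y. indicator {\<epsilon><..} y *
      ((conv (riesz_kernel \<alpha>) g x - conv (riesz_kernel \<alpha>) g (x - y)) / y powr (1 + \<alpha>)) \<partial>lborel)
    = conv (truncation_kernel \<alpha> \<epsilon>) g x"
proof -
  define A where "A = (\<lambda>y. if \<epsilon> < y then y powr (- 1 - \<alpha>) else 0)"
  define B where "B = (\<lambda>s. if 0 < s then max 0 (s - \<epsilon>) powr \<alpha> / (\<epsilon> powr \<alpha> * \<alpha> * s * Gamma \<alpha>) else 0)"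
  let ?R = "riesz_kernel \<alpha>" and ?c = "\<epsilon> powr (- \<alpha>) / \<alpha>"
  have [measurable]: "A \<in> borel_measurable borel" "B \<in> borel_measurable borel"
    unfolding A_def B_def by measurable
  have G: "0 < Gamma \<alpha>" "0 < Gamma (1 - \<alpha>)" using \<alpha> by (auto intro!: Gamma_real_pos)
  have A0: "0 \<le> A y" and R0: "0 \<le> ?R y" and B0: "0 \<le> B y" for y
    using G \<alpha> by (auto simp: A_def B_def riesz_kernel_def)
  have BR: "B s \<le> ?c * ?R s" for s
  proof (cases "0 < s")
    case True
    have "max 0 (s - \<epsilon>) powr \<alpha> \<le> s * s powr (\<alpha> - 1)"
      using True \<epsilon> \<alpha> by (auto simp: powr_mult_base intro!: powr_mono2)
    then have "max 0 (s - \<epsilon>) powr \<alpha> / (\<epsilon> powr \<alpha> * \<alpha> * s * Gamma \<alpha>)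
        \<le> s * s powr (\<alpha> - 1) / (\<epsilon> powr \<alpha> * \<alpha> * s * Gamma \<alpha>)"
      using True \<epsilon> \<alpha> G by (intro divide_right_mono) auto
    then have "B s \<le> s * s powr (\<alpha> - 1) / (\<epsilon> powr \<alpha> * \<alpha> * s * Gamma \<alpha>)"
      using True by (simp only: B_def if_True)
    also have "\<dots> = ?c * ?R s" using True \<epsilon> by (simp add: riesz_kernel_def powr_minus field_simps)
    finally show ?thesis .
  qed (simp add: B_def riesz_kernel_def)
  have finR: "(\<integral>\<^sup>+s. ennreal (?R s * \<bar>g (x - s)\<bar>) \<partial>lborel) < \<infinity>"
  proof -
    have "(\<integral>\<^sup>+s. ennreal (?R s * \<bar>g (x - s)\<bar>) \<partial>lborel)
      = (\<integral>\<^sup>+s. ennreal (1 / Gamma \<alpha>) * (ennreal (s powr (\<alpha> - 1) * \<bar>g (x - s)\<bar>) * indicator {0<..} s) \<partial>lborel)"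
      using G by (intro nn_integral_cong) (auto simp: riesz_kernel_def split: split_indicator simp flip: ennreal_mult')
    also have "\<dots> = ennreal (1 / Gamma \<alpha>) * (\<integral>\<^sup>+s. ennreal (s powr (\<alpha> - 1) * \<bar>g (x - s)\<bar>) * indicator {0<..} s \<partial>lborel)"
      by (rule nn_integral_cmult) measurable
    also have "\<dots> < \<infinity>" using fin by (simp add: ennreal_mult_less_top)
    finally show ?thesis .
  qed
  have intR: "integrable lborel (\<lambda>s. ?R s * g (x - s))"
    using finR R0 by (intro integrableI_bounded) (auto simp: abs_mult)
  have A_int: "has_bochner_integral lborel A ?c"
  proof (rule has_bochner_integral_nn_integral)
    have "(\<integral>\<^sup>+y. ennreal (A y) \<partial>lborel) = (\<integral>\<^sup>+y. ennreal (y powr (- 1 - \<alpha>)) * indicator {\<epsilon>..} y \<partial>lborel)"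
      by (intro nn_integral_cong_AE, use AE_lborel_singleton[of \<epsilon>] in eventually_elim)
         (auto simp: A_def split: split_indicator)
    also have "\<dots> = ennreal (- (\<epsilon> powr (- 1 - \<alpha> + 1)) / (- 1 - \<alpha> + 1))"
      by (rule nn_integral_has_integral_lebesgue'[OF _ has_integral_powr_to_inf]) (use \<epsilon> \<alpha> in auto)
    finally show "(\<integral>\<^sup>+y. ennreal (A y) \<partial>lborel) = ennreal ?c" by simp
  qed (use A0 \<alpha> in auto)
  have AR_int: "has_bochner_integral lborel (\<lambda>y. A y * ?R (s - y)) (B s)" for s
    using nn_integral_tail_riesz_convolution[OF \<epsilon>, of s] A0 R0 B0
    by (intro has_bochner_integral_nn_integral) (auto simp: A_def B_def)
  have "integrable (lborel \<Otimes>\<^sub>M lborel) (\<lambda>(s, y). A y * ?R (s - y) * g (x - s))"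
  proof (rule integrableI_bounded)
    have "(\<integral>\<^sup>+z. ennreal (norm (case z of (s, y) \<Rightarrow> A y * ?R (s - y) * g (x - s))) \<partial>(lborel \<Otimes>\<^sub>M lborel))
      = (\<integral>\<^sup>+s. \<integral>\<^sup>+y. ennreal (A y * ?R (s - y)) * ennreal \<bar>g (x - s)\<bar> \<partial>lborel \<partial>lborel)"
      by (subst lborel.nn_integral_fst[symmetric]) (auto simp: abs_mult A0 R0 ennreal_mult)
    also have "\<dots> = (\<integral>\<^sup>+s. ennreal (B s) * ennreal \<bar>g (x - s)\<bar> \<partial>lborel)"
      by (subst nn_integral_multc)
         (auto simp: A_def B_def nn_integral_tail_riesz_convolution[OF \<epsilon>])
    also have "\<dots> \<le> (\<integral>\<^sup>+s. ennreal ?c * ennreal (?R s * \<bar>g (x - s)\<bar>) \<partial>lborel)"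
    proof (rule nn_integral_mono)
      fix s
      have "B s * \<bar>g (x - s)\<bar> \<le> ?c * (?R s * \<bar>g (x - s)\<bar>)"
        using mult_right_mono[OF BR[of s], of "\<bar>g (x - s)\<bar>"] by (simp add: mult_ac)
      then show "ennreal (B s) * ennreal \<bar>g (x - s)\<bar> \<le> ennreal ?c * ennreal (?R s * \<bar>g (x - s)\<bar>)"
        using \<alpha> B0 R0 by (subst (1 2) ennreal_mult[symmetric]) (auto intro: ennreal_leI)
    qed
    also have "\<dots> < \<infinity>" using finR by (simp add: nn_integral_cmult ennreal_mult_less_top)
    finally show "(\<integral>\<^sup>+z. ennreal (norm (case z of (s, y) \<Rightarrow> A y * ?R (s - y) * g (x - s))) \<partial>(lborel \<Otimes>\<^sub>M lborel)) < \<infinity>" .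
  qed measurable
  note pair = this
  have inner: "(\<integral>s. A y * ?R (s - y) * g (x - s) \<partial>lborel) = A y * conv ?R g (x - y)" for y
  proof -
    have "(\<integral>s. A y * ?R (s - y) * g (x - s) \<partial>lborel) = (\<integral>z. A y * (?R z * g (x - y - z)) \<partial>lborel)"
      by (subst lborel_integral_real_affine[where c=1 and t=y]) (auto simp: algebra_simps)
    then show ?thesis by (simp add: conv_def)
  qed
  have Fub: "(\<integral>y. A y * conv ?R g (x - y) \<partial>lborel) = (\<integral>s. B s * g (x - s) \<partial>lborel)"
    using lborel_pair.Fubini_integral[OF pair] AR_int[THEN has_bochner_integral_integral_eq]
    by (simp add: inner)
  have A_conv_int: "integrable lborel (\<lambda>y. A y * conv ?R g (x - y))"
    using lborel_pair.integrable_snd[OF pair] by (simp add: inner)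
  have B_int: "integrable lborel (\<lambda>s. B s * g (x - s))"
    using lborel_pair.integrable_fst[OF pair] AR_int[THEN has_bochner_integral_integral_eq] by simp
  have "(\<integral>y. indicator {\<epsilon><..} y * ((conv ?R g x - conv ?R g (x - y)) / y powr (1 + \<alpha>)) \<partial>lborel)
    = (\<integral>y. A y * conv ?R g x - A y * conv ?R g (x - y) \<partial>lborel)"
  proof (intro Bochner_Integration.integral_cong refl)
    fix y
    have "1 / y powr (1 + \<alpha>) = y powr (- 1 - \<alpha>)" using powr_minus_divide[of y "1 + \<alpha>"] by simp
    then show "indicator {\<epsilon><..} y * ((conv ?R g x - conv ?R g (x - y)) / y powr (1 + \<alpha>))
      = A y * conv ?R g x - A y * conv ?R g (x - y)"
      by (simp add: A_def divide_inverse algebra_simps split: split_indicator)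
  qed
  also have "\<dots> = ?c * conv ?R g x - (\<integral>s. B s * g (x - s) \<partial>lborel)"
    using A_int A_conv_int unfolding has_bochner_integral_iff by (simp add: Fub)
  also have "\<dots> = (\<integral>s. (?c * ?R s - B s) * g (x - s) \<partial>lborel)"
    unfolding conv_def using intR B_int by (simp add: left_diff_distrib mult.assoc)
  finally have "\<alpha> / Gamma (1 - \<alpha>) * (\<integral>y. indicator {\<epsilon><..} y *
      ((conv ?R g x - conv ?R g (x - y)) / y powr (1 + \<alpha>)) \<partial>lborel)
    = (\<integral>s. \<alpha> / Gamma (1 - \<alpha>) * ((?c * ?R s - B s) * g (x - s)) \<partial>lborel)"
    by simp
  also have "\<dots> = conv (truncation_kernel \<alpha> \<epsilon>) g x"
    unfolding conv_def
  proof (intro Bochner_Integration.integral_cong refl)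
    fix s
    have "\<alpha> / Gamma (1 - \<alpha>) * (?c * ?R s - B s) = truncation_kernel \<alpha> \<epsilon> s"
    proof (cases "0 < s")
      case True
      have "s powr \<alpha> = s * s powr (\<alpha> - 1)" using True by (simp add: powr_mult_base)
      then show ?thesis
        using True \<epsilon> \<alpha> G
        by (simp add: truncation_kernel_def riesz_kernel_def B_def powr_minus right_diff_distrib diff_divide_distrib)
           (simp add: field_simps)
    qed (simp add: truncation_kernel_def riesz_kernel_def B_def)
    then show "\<alpha> / Gamma (1 - \<alpha>) * ((?c * ?R s - B s) * g (x - s)) = truncation_kernel \<alpha> \<epsilon> s * g (x - s)"
      by (metis mult.assoc)
  qed
  finally show ?thesis .
qed

end

section \<open>Convergence almost everywhere\<close>

text \<open>
  The differentiation theorem used here concerns intervals to the right of a point, so it is applied to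
  the reflected functions \<open>t \<mapsto> \<bar>g (- t) - c\<bar>\<close>. Countably many rational \<open>c\<close> leave one common null set,
  and choosing \<open>c\<close> close to \<open>g x\<close> gives the Lebesgue point property.
\<close>
lemma AE_left_Lebesgue_point:
  fixes g :: "real \<Rightarrow> real"
  assumes [measurable]: "g \<in> borel_measurable borel"
    and loc: "\<And>u v. (\<integral>\<^sup>+t. ennreal \<bar>g t\<bar> * indicator {u<..<v} t \<partial>lborel) < \<infinity>"
  shows "AE x in lborel. \<forall>\<eta>>0. \<exists>\<delta>>0. \<forall>h. 0 < h \<and> h < \<delta> \<longrightarrow>
    (\<integral>\<^sup>+s. ennreal \<bar>g (x - s) - g x\<bar> * indicator {0<..<h} s \<partial>lborel) \<le> ennreal (\<eta> * h)"
proof -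
  define F where "F = (\<lambda>(c::real) t. \<bar>g (- t) - c\<bar>)"
  have F_int: "F c integrable_on cbox u v" for c u v
  proof -
    have "set_integrable lborel {u..v} (F c)"
      unfolding set_integrable_def
    proof (rule integrableI_bounded)
      have "(\<integral>\<^sup>+t. ennreal (norm (indicator {u..v} t *\<^sub>R F c t)) \<partial>lborel)
        \<le> (\<integral>\<^sup>+t. ennreal \<bar>g (0 - t)\<bar> * indicator {u - 1<..<v + 1} t + ennreal \<bar>c\<bar> * indicator {u..v} t \<partial>lborel)"
        by (intro nn_integral_mono) (auto simp: F_def split: split_indicator simp flip: ennreal_plus intro!: ennreal_leI)
      also have "\<dots> = (\<integral>\<^sup>+t. ennreal \<bar>g (0 - t)\<bar> * indicator {u - 1<..<v + 1} t \<partial>lborel)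
          + (\<integral>\<^sup>+t. ennreal \<bar>c\<bar> * indicator {u..v} t \<partial>lborel)"
        by (rule nn_integral_add) measurable
      also have "(\<integral>\<^sup>+t. ennreal \<bar>g (0 - t)\<bar> * indicator {u - 1<..<v + 1} t \<partial>lborel)
          = (\<integral>\<^sup>+t. ennreal \<bar>g t\<bar> * indicator {0 - (v + 1)<..<0 - (u - 1)} t \<partial>lborel)"
        by (rule nn_integral_annulus) measurable
      also have "\<dots> + (\<integral>\<^sup>+t. ennreal \<bar>c\<bar> * indicator {u..v} t \<partial>lborel) < \<infinity>"
        using loc[of "0 - (v + 1)" "0 - (u - 1)"]
        by (cases "u \<le> v") (simp_all add: nn_integral_cmult ennreal_mult_less_top)
      finally show "(\<integral>\<^sup>+t. ennreal (norm (indicator {u..v} t *\<^sub>R F c t)) \<partial>lborel) < \<infinity>" .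
    qed (simp add: F_def)
    then show ?thesis using set_borel_integral_eq_integral(1) by (metis interval_cbox)
  qed
  have "\<exists>N. negligible N \<and> (\<forall>x e. x \<notin> N \<and> 0 < e \<longrightarrow>
      (\<exists>d>0. \<forall>h. 0 < h \<and> h < d \<longrightarrow> \<bar>integral {x..x + h} (F c) / h - F c x\<bar> < e))" for c
  proof -
    obtain N where N: "negligible N"
      "\<And>x e. \<lbrakk>x \<notin> N; 0 < e\<rbrakk> \<Longrightarrow> \<exists>d>0. \<forall>h. 0 < h \<and> h < d \<longrightarrow>
          norm (integral (cbox x (x + h *\<^sub>R One)) (F c) /\<^sub>R h ^ DIM(real) - F c x) < e"
      using integrable_ccontinuous_explicit[of "F c"] F_int by blast
    then show ?thesis by (intro exI[of _ N]) (auto simp: divide_inverse mult.commute)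
  qed
  then obtain N where N: "\<And>c. negligible (N c)"
    "\<And>c x e. \<lbrakk>x \<notin> N c; 0 < e\<rbrakk> \<Longrightarrow> \<exists>d>0. \<forall>h. 0 < h \<and> h < d \<longrightarrow> \<bar>integral {x..x + h} (F c) / h - F c x\<bar> < e"
    by metis
  have "negligible (\<Union>c\<in>\<rat>. N c)"
    using N(1) by (intro negligible_countable_Union) (auto intro: countable_rat)
  then have "negligible (uminus ` (\<Union>c\<in>\<rat>. N c))"
    by (intro negligible_differentiable_image_negligible) (auto intro!: derivative_intros)
  then have "AE x in lebesgue. x \<notin> uminus ` (\<Union>c\<in>\<rat>. N c)"
    by (simp add: negligible_iff_null_sets AE_not_in)
  then have "AE x in lborel. x \<notin> uminus ` (\<Union>c\<in>\<rat>. N c)"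
    by (simp add: AE_completion_iff)
  then show ?thesis
  proof eventually_elim
    case (elim x)
    then have x: "- x \<notin> N c" if "c \<in> \<rat>" for c using that by (metis UN_I imageI minus_minus)
    show ?case
    proof (intro allI impI)
      fix \<eta> :: real assume "0 < \<eta>"
      then obtain c where c: "c \<in> \<rat>" "g x - \<eta> / 3 < c" "c < g x + \<eta> / 3"
        using Rats_dense_in_real[of "g x - \<eta> / 3" "g x + \<eta> / 3"] by auto
      then have c': "\<bar>g x - c\<bar> < \<eta> / 3" by linarith
      obtain d where d: "d > 0" "\<And>h. 0 < h \<Longrightarrow> h < d \<Longrightarrow> \<bar>integral {-x..-x + h} (F c) / h - F c (-x)\<bar> < \<eta> / 3"
        using N(2)[OF x[OF c(1)], of "\<eta> / 3"] \<open>0 < \<eta>\<close> by auto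
      show "\<exists>\<delta>>0. \<forall>h. 0 < h \<and> h < \<delta> \<longrightarrow>
        (\<integral>\<^sup>+s. ennreal \<bar>g (x - s) - g x\<bar> * indicator {0<..<h} s \<partial>lborel) \<le> ennreal (\<eta> * h)"
      proof (intro exI[of _ d] conjI allI impI d(1))
        fix h assume h: "0 < h \<and> h < d"
        let ?I = "integral {-x..-x + h} (F c)"
        have I: "(\<integral>\<^sup>+t. ennreal (F c t) * indicator {-x..-x + h} t \<partial>lborel) = ennreal ?I"
          using F_int[of c "-x" "-x + h"]
          by (intro nn_integral_has_integral_lebesgue' integrable_integral) (auto simp: F_def)
        have I0: "0 \<le> ?I"
          using F_int[of c "-x" "-x + h"] by (intro integral_nonneg) (auto simp: F_def)
        have "F c (-x) = \<bar>g x - c\<bar>" by (simp add: F_def)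
        then have "?I / h < 2 * \<eta> / 3" using d(2)[of h] h c' by linarith
        then have I_le: "?I \<le> 2 * \<eta> / 3 * h" using h by (simp add: field_simps)
        have "(\<integral>\<^sup>+s. ennreal \<bar>g (x - s) - g x\<bar> * indicator {0<..<h} s \<partial>lborel)
          \<le> (\<integral>\<^sup>+s. ennreal (F c (- x + s)) * indicator {-x..-x + h} (- x + s) + ennreal (\<eta> / 3) * indicator {0..h} s \<partial>lborel)"
        proof (rule nn_integral_mono)
          fix s
          have "F c (- x + s) = \<bar>g (x - s) - c\<bar>" by (simp add: F_def)
          then have "\<bar>g (x - s) - g x\<bar> \<le> F c (- x + s) + \<eta> / 3" using c' by linarith
          then have "ennreal \<bar>g (x - s) - g x\<bar> \<le> ennreal (F c (- x + s)) + ennreal (\<eta> / 3)"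
            using \<open>0 < \<eta>\<close> by (simp add: F_def ennreal_leI flip: ennreal_plus)
          then show "ennreal \<bar>g (x - s) - g x\<bar> * indicator {0<..<h} s
            \<le> ennreal (F c (- x + s)) * indicator {-x..-x + h} (- x + s) + ennreal (\<eta> / 3) * indicator {0..h} s"
            by (auto split: split_indicator)
        qed
        also have "\<dots> = (\<integral>\<^sup>+s. ennreal (F c (- x + s)) * indicator {-x..-x + h} (- x + s) \<partial>lborel)
            + (\<integral>\<^sup>+s. ennreal (\<eta> / 3) * indicator {0..h} s \<partial>lborel)"
          by (rule nn_integral_add) (auto simp: F_def)
        also have "(\<integral>\<^sup>+s. ennreal (F c (- x + s)) * indicator {-x..-x + h} (- x + s) \<partial>lborel) = ennreal ?I"
          unfolding I[symmetric] by (subst (2) nn_integral_real_affine[where c=1 and t="-x"]) (auto simp: F_def)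
        also have "(\<integral>\<^sup>+s. ennreal (\<eta> / 3) * indicator {0..h} s \<partial>lborel) = ennreal (\<eta> / 3 * h)"
          using h \<open>0 < \<eta>\<close> by (simp add: nn_integral_cmult flip: ennreal_mult)
        also have "ennreal ?I + ennreal (\<eta> / 3 * h) \<le> ennreal (\<eta> * h)"
          using I_le I0 h \<open>0 < \<eta>\<close> by (subst ennreal_plus[symmetric]) (auto intro!: ennreal_leI simp: field_simps)
        finally show "(\<integral>\<^sup>+s. ennreal \<bar>g (x - s) - g x\<bar> * indicator {0<..<h} s \<partial>lborel) \<le> ennreal (\<eta> * h)" .
      qed
    qed
  qed
qed

context
  fixes \<alpha> :: real
  assumes \<alpha>: "0 < \<alpha>" "\<alpha> < 1"
begin

lemma truncation_kernel_le_riesz: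
  assumes "0 < \<epsilon>" "0 < s"
  shows "truncation_kernel \<alpha> \<epsilon> s \<le> s powr (\<alpha> - 1) / (\<epsilon> powr \<alpha> * (Gamma \<alpha> * Gamma (1 - \<alpha>)))"
proof -
  have "s powr (\<alpha> - 1) * (1 - (1 - min 1 (\<epsilon> / s)) powr \<alpha>) \<le> s powr (\<alpha> - 1) * 1"
    by (intro mult_left_mono) auto
  then show ?thesis
    unfolding truncation_kernel_eq[OF \<alpha> assms(2,1)]
    using Gamma_product_pos[OF \<alpha>] by (intro divide_right_mono) auto
qed

lemma integrable_truncation_kernel_conv:
  assumes \<epsilon>: "0 < \<epsilon>" and [measurable]: "g \<in> borel_measurable borel"
    and fin: "(\<integral>\<^sup>+s. ennreal (s powr (\<alpha> - 1) * \<bar>g (x - s)\<bar>) * indicator {0<..} s \<partial>lborel) < \<infinity>"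
  shows "integrable lborel (\<lambda>s. truncation_kernel \<alpha> \<epsilon> s * g (x - s))"
proof (rule integrableI_bounded)
  let ?c = "1 / (\<epsilon> powr \<alpha> * (Gamma \<alpha> * Gamma (1 - \<alpha>)))"
  have "(\<integral>\<^sup>+s. ennreal (norm (truncation_kernel \<alpha> \<epsilon> s * g (x - s))) \<partial>lborel)
    \<le> (\<integral>\<^sup>+s. ennreal ?c * (ennreal (s powr (\<alpha> - 1) * \<bar>g (x - s)\<bar>) * indicator {0<..} s) \<partial>lborel)"
  proof (rule nn_integral_mono)
    fix s
    show "ennreal (norm (truncation_kernel \<alpha> \<epsilon> s * g (x - s)))
      \<le> ennreal ?c * (ennreal (s powr (\<alpha> - 1) * \<bar>g (x - s)\<bar>) * indicator {0<..} s)"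
    proof (cases "0 < s")
      case True
      have "norm (truncation_kernel \<alpha> \<epsilon> s * g (x - s)) \<le> ?c * (s powr (\<alpha> - 1) * \<bar>g (x - s)\<bar>)"
        using truncation_kernel_le_riesz[OF \<epsilon> True] truncation_kernel_nonneg[OF \<alpha> \<epsilon>, of s]
          mult_right_mono[of "truncation_kernel \<alpha> \<epsilon> s" _ "\<bar>g (x - s)\<bar>"]
        by (fastforce simp: abs_mult)
      then show ?thesis
        using True Gamma_product_pos[OF \<alpha>] by (simp add: ennreal_leI flip: ennreal_mult')
    qed (simp add: truncation_kernel_nonpos[OF \<alpha>])
  qed
  also have "\<dots> < \<infinity>" using fin by (simp add: nn_integral_cmult ennreal_mult_less_top)
  finally show "(\<integral>\<^sup>+s. ennreal (norm (truncation_kernel \<alpha> \<epsilon> s * g (x - s))) \<partial>lborel) < \<infinity>" .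
qed measurable

lemma truncation_kernel_integral:
  assumes "0 < \<epsilon>"
  shows "has_bochner_integral lborel (truncation_kernel \<alpha> \<epsilon>) 1"
  using nn_integral_truncation_kernel[OF \<alpha> assms] truncation_kernel_nonneg[OF \<alpha> assms]
  by (intro has_bochner_integral_nn_integral) auto

text \<open>
  Near \<open>s = 0\<close> the Lebesgue point property controls the mean of \<open>\<bar>g (x - s) - g x\<bar>\<close> at every small scale,
  hence, by \<open>decreasing_kernel_le_scale_average\<close>, its integral against the kernel. Away from \<open>0\<close> the kernel is
  at most a multiple of \<open>\<epsilon>\<^sup>1\<^sup>-\<^sup>\<alpha> s\<^sup>\<alpha>\<^sup>-\<^sup>2\<close>, and \<open>s\<^sup>\<alpha>\<^sup>-\<^sup>2 \<bar>g (x - s) - g x\<bar>\<close> is integrable there.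
\<close>
lemma conv_truncation_kernel_tendsto:
  assumes [measurable]: "g \<in> borel_measurable borel"
    and fin: "(\<integral>\<^sup>+s. ennreal (s powr (\<alpha> - 1) * \<bar>g (x - s)\<bar>) * indicator {0<..} s \<partial>lborel) < \<infinity>"
    and leb: "\<And>\<eta>. \<eta> > 0 \<Longrightarrow> \<exists>\<delta>>0. \<forall>h. 0 < h \<and> h < \<delta> \<longrightarrow>
      (\<integral>\<^sup>+s. ennreal \<bar>g (x - s) - g x\<bar> * indicator {0<..<h} s \<partial>lborel) \<le> ennreal (\<eta> * h)"
  shows "((\<lambda>\<epsilon>. conv (truncation_kernel \<alpha> \<epsilon>) g x) \<longlongrightarrow> g x) (at_right 0)"
proof (rule tendstoI)
  fix e :: real assume e: "0 < e"
  let ?\<phi> = "\<lambda>s. ennreal \<bar>g (x - s) - g x\<bar>"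
  \<comment> \<open>The factor 8 leaves \<open>e / 2\<close> below: 2 comes from the superposition of scales and 2 from the length \<open>2l\<close>.\<close>
  obtain \<delta>2 where \<delta>2: "\<delta>2 > 0" "\<And>h. 0 < h \<Longrightarrow> h < \<delta>2 \<Longrightarrow>
      (\<integral>\<^sup>+s. ?\<phi> s * indicator {0<..<h} s \<partial>lborel) \<le> ennreal (e / 8 * h)"
    using leb[of "e / 8"] e by auto
  \<comment> \<open>Scales \<open>l < \<delta>\<close> involve \<open>g\<close> up to distance \<open>2l\<close>, which must stay below \<open>\<delta>2\<close>.\<close>
  define \<delta> where "\<delta> = \<delta>2 / 2"
  have \<delta>: "\<delta> > 0" using \<delta>2 by (simp add: \<delta>_def)
  let ?c = "1 / (Gamma \<alpha> * Gamma (1 - \<alpha>))"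
  \<comment> \<open>The part far from \<open>0\<close> will be at most a multiple of \<open>Q \<epsilon>\<^sup>1\<^sup>-\<^sup>\<alpha>\<close>, with \<open>Q\<close> independent of \<open>\<epsilon>\<close>.\<close>
  let ?Q = "\<integral>\<^sup>+s. ennreal (s powr (\<alpha> - 2)) * ?\<phi> s * indicator {\<delta>..} s \<partial>lborel"
  have "?Q \<le> (\<integral>\<^sup>+s. ennreal (1 / \<delta>) * (ennreal (s powr (\<alpha> - 1) * \<bar>g (x - s)\<bar>) * indicator {0<..} s)
      + ennreal \<bar>g x\<bar> * (ennreal (s powr (\<alpha> - 2)) * indicator {\<delta>..} s) \<partial>lborel)"
  proof (rule nn_integral_mono)
    fix s
    show "ennreal (s powr (\<alpha> - 2)) * ?\<phi> s * indicator {\<delta>..} s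
      \<le> ennreal (1 / \<delta>) * (ennreal (s powr (\<alpha> - 1) * \<bar>g (x - s)\<bar>) * indicator {0<..} s)
      + ennreal \<bar>g x\<bar> * (ennreal (s powr (\<alpha> - 2)) * indicator {\<delta>..} s)"
    proof (cases "\<delta> \<le> s")
      case True
      then have s: "0 < s" using \<delta> by simp
      have "s powr (\<alpha> - 2) = 1 / s * s powr (\<alpha> - 1)"
        using s powr_diff[of s "\<alpha> - 1" 1] by simp
      also have "\<dots> \<le> 1 / \<delta> * s powr (\<alpha> - 1)"
        using True \<delta> s by (intro mult_right_mono divide_left_mono) auto
      finally have le: "s powr (\<alpha> - 2) \<le> 1 / \<delta> * s powr (\<alpha> - 1)" .
      have "s powr (\<alpha> - 2) * \<bar>g (x - s) - g x\<bar> \<le> s powr (\<alpha> - 2) * (\<bar>g (x - s)\<bar> + \<bar>g x\<bar>)"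
        by (intro mult_left_mono) auto
      also have "\<dots> \<le> 1 / \<delta> * (s powr (\<alpha> - 1) * \<bar>g (x - s)\<bar>) + \<bar>g x\<bar> * s powr (\<alpha> - 2)"
        using mult_right_mono[OF le, of "\<bar>g (x - s)\<bar>"] by (simp add: distrib_left mult_ac)
      finally show ?thesis
        using True s \<delta> by (simp add: ennreal_leI flip: ennreal_mult ennreal_mult' ennreal_plus)
    qed auto
  qed
  also have "\<dots> = ennreal (1 / \<delta>) * (\<integral>\<^sup>+s. ennreal (s powr (\<alpha> - 1) * \<bar>g (x - s)\<bar>) * indicator {0<..} s \<partial>lborel)
      + ennreal \<bar>g x\<bar> * (\<integral>\<^sup>+s. ennreal (s powr (\<alpha> - 2)) * indicator {\<delta>..} s \<partial>lborel)"
    by (simp add: nn_integral_add nn_integral_cmult)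
  also have "(\<integral>\<^sup>+s. ennreal (s powr (\<alpha> - 2)) * indicator {\<delta>..} s \<partial>lborel) = ennreal (- (\<delta> powr (\<alpha> - 2 + 1)) / (\<alpha> - 2 + 1))"
    by (rule nn_integral_has_integral_lebesgue'[OF _ has_integral_powr_to_inf]) (use \<delta> \<alpha> in auto)
  also have "ennreal (1 / \<delta>) * (\<integral>\<^sup>+s. ennreal (s powr (\<alpha> - 1) * \<bar>g (x - s)\<bar>) * indicator {0<..} s \<partial>lborel)
      + ennreal \<bar>g x\<bar> * ennreal (- (\<delta> powr (\<alpha> - 2 + 1)) / (\<alpha> - 2 + 1)) < \<infinity>"
    using fin by (simp add: ennreal_mult_less_top)
  finally obtain Q where Q: "?Q = ennreal Q" "0 \<le> Q" by (cases ?Q) auto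
  have bound: "\<bar>conv (truncation_kernel \<alpha> \<epsilon>) g x - g x\<bar> \<le> e / 2 + ?c * Q * \<epsilon> powr (1 - \<alpha>)" if \<epsilon>: "0 < \<epsilon>" for \<epsilon>
  proof -
    let ?K = "truncation_kernel \<alpha> \<epsilon>"
    note K0 = truncation_kernel_nonneg[OF \<alpha> \<epsilon>]
    have near: "(\<integral>\<^sup>+s. ennreal (?K s) * (?\<phi> s * indicator {0<..<\<delta>} s) \<partial>lborel) \<le> ennreal (e / 2)"
    proof -
      have "(\<integral>\<^sup>+s. ennreal (?K s) * (?\<phi> s * indicator {0<..<\<delta>} s) \<partial>lborel)
        \<le> (\<integral>\<^sup>+l. ennreal (2 * ?K l / l) * (\<integral>\<^sup>+s. ?\<phi> s * indicator {0<..<\<delta>} s * indicator {l<..<2*l} s \<partial>lborel) \<partial>lborel)"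
        using K0 truncation_kernel_nonpos[OF \<alpha>] truncation_kernel_decreasing[OF \<alpha> \<epsilon>]
        by (intro decreasing_kernel_le_scale_average) auto
      also have "\<dots> \<le> (\<integral>\<^sup>+l. ennreal (e / 2) * ennreal (?K l) \<partial>lborel)"
      proof (rule nn_integral_mono)
        fix l
        show "ennreal (2 * ?K l / l) * (\<integral>\<^sup>+s. ?\<phi> s * indicator {0<..<\<delta>} s * indicator {l<..<2*l} s \<partial>lborel)
          \<le> ennreal (e / 2) * ennreal (?K l)"
        proof (cases "0 < l \<and> l < \<delta>")
          case True
          have "(\<integral>\<^sup>+s. ?\<phi> s * indicator {0<..<\<delta>} s * indicator {l<..<2*l} s \<partial>lborel)
            \<le> (\<integral>\<^sup>+s. ?\<phi> s * indicator {0<..<2*l} s \<partial>lborel)"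
            by (intro nn_integral_mono) (auto split: split_indicator)
          also have "\<dots> \<le> ennreal (e / 8 * (2 * l))" using True by (intro \<delta>2) (auto simp: \<delta>_def)
          finally have "ennreal (2 * ?K l / l) * (\<integral>\<^sup>+s. ?\<phi> s * indicator {0<..<\<delta>} s * indicator {l<..<2*l} s \<partial>lborel)
            \<le> ennreal (2 * ?K l / l) * ennreal (e / 8 * (2 * l))" by (intro mult_left_mono) auto
          also have "\<dots> = ennreal (e / 2) * ennreal (?K l)"
            using True e K0[of l] by (simp add: mult_ac flip: ennreal_mult)
          finally show ?thesis .
        next
          case False
          then have zero: "indicator {0<..<\<delta>} s * indicator {l<..<2*l} s = (0 :: ennreal)" for s
            by (auto split: split_indicator)
          show ?thesis unfolding mult.assoc zero by simp
        qed
      qed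
      also have "\<dots> = ennreal (e / 2)"
        by (simp add: nn_integral_cmult nn_integral_truncation_kernel[OF \<alpha> \<epsilon>])
      finally show ?thesis .
    qed
    have far: "(\<integral>\<^sup>+s. ennreal (?K s) * (?\<phi> s * indicator {\<delta>..} s) \<partial>lborel) \<le> ennreal (?c * Q * \<epsilon> powr (1 - \<alpha>))"
    proof -
      have "(\<integral>\<^sup>+s. ennreal (?K s) * (?\<phi> s * indicator {\<delta>..} s) \<partial>lborel)
        \<le> (\<integral>\<^sup>+s. ennreal (?c * \<epsilon> powr (1 - \<alpha>)) * (ennreal (s powr (\<alpha> - 2)) * ?\<phi> s * indicator {\<delta>..} s) \<partial>lborel)"
      proof (rule nn_integral_mono)
        fix s
        show "ennreal (?K s) * (?\<phi> s * indicator {\<delta>..} s)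
          \<le> ennreal (?c * \<epsilon> powr (1 - \<alpha>)) * (ennreal (s powr (\<alpha> - 2)) * ?\<phi> s * indicator {\<delta>..} s)"
        proof (cases "\<delta> \<le> s")
          case True
          then have "?K s \<le> ?c * \<epsilon> powr (1 - \<alpha>) * s powr (\<alpha> - 2)"
            using truncation_kernel_le[OF \<alpha> \<epsilon>, of s] \<delta> by simp
          then have "ennreal (?K s) * ?\<phi> s \<le> ennreal (?c * \<epsilon> powr (1 - \<alpha>) * s powr (\<alpha> - 2)) * ?\<phi> s"
            by (intro mult_right_mono ennreal_leI) auto
          also have "\<dots> = ennreal (?c * \<epsilon> powr (1 - \<alpha>)) * (ennreal (s powr (\<alpha> - 2)) * ?\<phi> s)"
            using Gamma_product_pos[OF \<alpha>] by (subst ennreal_mult) (auto simp: mult_ac)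
          finally show ?thesis using True by simp
        qed auto
      qed
      also have "\<dots> = ennreal (?c * \<epsilon> powr (1 - \<alpha>)) * ennreal Q"
        unfolding Q(1)[symmetric] by (rule nn_integral_cmult) measurable
      also have "\<dots> = ennreal (?c * Q * \<epsilon> powr (1 - \<alpha>))"
        using Q Gamma_product_pos[OF \<alpha>] by (subst ennreal_mult[symmetric]) (auto simp: mult_ac)
      finally show ?thesis .
    qed
    have "conv ?K g x - g x = (\<integral>s. ?K s * (g (x - s) - g x) \<partial>lborel)"
      using integrable_truncation_kernel_conv[OF \<epsilon> _ fin] truncation_kernel_integral[OF \<epsilon>]
      unfolding conv_def has_bochner_integral_iff by (simp add: right_diff_distrib)
    then have "ennreal \<bar>conv ?K g x - g x\<bar> \<le> (\<integral>\<^sup>+s. ennreal \<bar>?K s * (g (x - s) - g x)\<bar> \<partial>lborel)"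
      by (simp add: abs_lebesgue_integral_le)
    also have "\<dots> \<le> (\<integral>\<^sup>+s. ennreal (?K s) * (?\<phi> s * indicator {0<..<\<delta>} s) + ennreal (?K s) * (?\<phi> s * indicator {\<delta>..} s) \<partial>lborel)"
      using K0 truncation_kernel_nonpos[OF \<alpha>]
      by (intro nn_integral_mono) (auto simp: abs_mult ennreal_mult split: split_indicator)
    also have "\<dots> = (\<integral>\<^sup>+s. ennreal (?K s) * (?\<phi> s * indicator {0<..<\<delta>} s) \<partial>lborel)
        + (\<integral>\<^sup>+s. ennreal (?K s) * (?\<phi> s * indicator {\<delta>..} s) \<partial>lborel)"
      by (rule nn_integral_add) measurable
    also have "\<dots> \<le> ennreal (e / 2) + ennreal (?c * Q * \<epsilon> powr (1 - \<alpha>))"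
      by (intro add_mono near far)
    also have "\<dots> = ennreal (e / 2 + ?c * Q * \<epsilon> powr (1 - \<alpha>))"
      using e Q Gamma_product_pos[OF \<alpha>] by (intro ennreal_plus[symmetric]) auto
    finally show ?thesis
      using e Q Gamma_product_pos[OF \<alpha>] by (subst (asm) ennreal_le_iff) auto
  qed
  have "((\<lambda>\<epsilon>. ?c * Q * \<epsilon> powr (1 - \<alpha>)) \<longlongrightarrow> ?c * Q * 0) (at_right 0)"
    using \<alpha> by (intro tendsto_mult tendsto_const tendsto_zero_powrI[where b="1 - \<alpha>"])
      (auto simp: eventually_at_right_less intro: tendsto_ident_at eventually_mono[OF eventually_at_right_less])
  then have "\<forall>\<^sub>F \<epsilon> in at_right 0. ?c * Q * \<epsilon> powr (1 - \<alpha>) < e / 2"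
    using e by (intro order_tendstoD(2)) auto
  moreover have "\<forall>\<^sub>F \<epsilon> in at_right (0::real). 0 < \<epsilon>" by (rule eventually_at_right_less)
  ultimately show "\<forall>\<^sub>F \<epsilon> in at_right 0. dist (conv (truncation_kernel \<alpha> \<epsilon>) g x) (g x) < e"
  proof eventually_elim
    case (elim \<epsilon>)
    then show ?case using bound[of \<epsilon>] unfolding dist_real_def by linarith
  qed
qed

end

section \<open>Convergence in the weighted space\<close>

lemma abs_add3_powr_le:
  fixes a b c p :: real
  assumes "0 \<le> p"
  shows "\<bar>a + b + c\<bar> powr p \<le> 3 powr p * (\<bar>a\<bar> powr p + \<bar>b\<bar> powr p + \<bar>c\<bar> powr p)"
proof -
  let ?m = "max \<bar>a\<bar> (max \<bar>b\<bar> \<bar>c\<bar>)"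
  have "\<bar>a + b + c\<bar> powr p \<le> (3 * ?m) powr p"
    using assms by (intro powr_mono2) auto
  also have "\<dots> = 3 powr p * ?m powr p" by (simp add: powr_mult)
  also have "?m powr p \<le> \<bar>a\<bar> powr p + \<bar>b\<bar> powr p + \<bar>c\<bar> powr p"
    by (auto simp: max_def)
  finally show ?thesis by simp
qed

context one_sided_weight begin

lemma conv_truncation_kernel_bound:
  assumes "0 < \<epsilon>" "g \<in> borel_measurable borel"
    and N: "(\<integral>\<^sup>+t. ennreal ((\<bar>g t\<bar> * \<omega> t) powr p) \<partial>lborel) < \<infinity>"
  shows "(\<integral>\<^sup>+x. ennreal ((\<bar>conv (truncation_kernel \<alpha> \<epsilon>) g x\<bar> * \<omega> x) powr p) \<partial>lborel)
    \<le> ennreal ((4 * C) powr p) * (\<integral>\<^sup>+t. ennreal ((\<bar>g t\<bar> * \<omega> t) powr p) \<partial>lborel)"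
  using assms \<alpha>
  by (intro conv_bound)
     (simp_all add: truncation_kernel_nonneg truncation_kernel_nonpos truncation_kernel_decreasing
        nn_integral_truncation_kernel)

lemma AE_conv_truncation_kernel_tendsto:
  assumes g: "g \<in> borel_measurable borel"
    and N: "(\<integral>\<^sup>+t. ennreal ((\<bar>g t\<bar> * \<omega> t) powr p) \<partial>lborel) < \<infinity>"
  shows "AE x in lborel. ((\<lambda>\<epsilon>. conv (truncation_kernel \<alpha> \<epsilon>) g x) \<longlongrightarrow> g x) (at_right 0)"
  using AE_left_Lebesgue_point[OF g annulus_Holder(1)[OF g N]] fractional_integral_finite[OF g N]
proof eventually_elim
  case (elim x)
  then show ?case by (intro conv_truncation_kernel_tendsto \<alpha> g) auto
qed

lemma nn_Wp_finite: "(\<integral>\<^sup>+y. ennreal (\<omega> y powr p) * indicator {u..v} y \<partial>lborel) < \<infinity>"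
proof (cases "u \<le> v")
  case True
  then show ?thesis using nn_Wp_le[OF True] by (auto simp: order.strict_trans1)
qed auto

text \<open>
  On \<open>[-B, B + 1]\<close> the total mass 1 of the kernel gives the bound \<open>B\<close>, and to the left of \<open>-B\<close> the
  convolution vanishes. To the right of \<open>B + 1\<close> only arguments \<open>s \<ge> 1\<close> of the kernel matter, where
  \<open>truncation_kernel_le_unit\<close> removes the dependence on \<open>\<epsilon>\<close>.
\<close>
lemma conv_truncation_kernel_dominated:
  assumes [measurable]: "g \<in> borel_measurable borel"
    and B: "0 \<le> B" and g: "\<And>t. \<bar>g t\<bar> \<le> B * indicator {-B..B} t"
    and \<epsilon>: "0 < \<epsilon>" "\<epsilon> \<le> 1"
  shows "\<bar>conv (truncation_kernel \<alpha> \<epsilon>) g x\<bar>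
    \<le> B * indicator {-B..B + 1} x + B / \<alpha> * conv (truncation_kernel \<alpha> 1) (indicator {-B..B}) x"
proof -
  let ?K = "truncation_kernel \<alpha> \<epsilon>" and ?K1 = "truncation_kernel \<alpha> 1"
  note K0 = truncation_kernel_nonneg[OF \<alpha> \<epsilon>(1)] and K10 = truncation_kernel_nonneg[OF \<alpha> zero_less_one]
  have K1_int: "integrable lborel (\<lambda>s. ?K1 s * indicator {-B..B} (x - s))"
  proof (rule Bochner_Integration.integrable_bound)
    show "integrable lborel ?K1"
      using truncation_kernel_integral[OF \<alpha> zero_less_one] by (auto simp: has_bochner_integral_iff)
  qed (auto simp: K10 split: split_indicator)
  have "0 \<le> conv ?K1 (indicator {-B..B}) x"
    unfolding conv_def by (intro Bochner_Integration.integral_nonneg) (auto simp: K10)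
  then have conv1: "0 \<le> B / \<alpha> * conv ?K1 (indicator {-B..B}) x"
    using B \<alpha> by (intro mult_nonneg_nonneg) auto
  have K_int: "integrable lborel (\<lambda>s. B * ?K s)"
    using truncation_kernel_integral[OF \<alpha> \<epsilon>(1)] by (auto simp: has_bochner_integral_iff)
  show ?thesis
  proof (cases "x \<in> {-B..B + 1}")
    case True
    have "\<bar>conv ?K g x\<bar> \<le> (\<integral>s. B * ?K s \<partial>lborel)"
      unfolding conv_def real_norm_def[symmetric]
    proof (rule Bochner_Integration.integral_norm_bound_integral[OF _ K_int])
      have le: "norm (?K s * g (x - s)) \<le> B * ?K s" for s
      proof -
        have "\<bar>g (x - s)\<bar> \<le> B" using g[of "x - s"] B by (auto split: split_indicator_asm)
        then show ?thesis
          using mult_right_mono[of "\<bar>g (x - s)\<bar>" B "?K s"] K0[of s] by (simp add: abs_mult mult.commute[of "?K s"])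
      qed
      then show "integrable lborel (\<lambda>s. ?K s * g (x - s))"
        using K0 B by (rule_tac Bochner_Integration.integrable_bound[OF K_int]) auto
      show "norm (?K s * g (x - s)) \<le> B * ?K s" for s by (rule le)
    qed
    also have "\<dots> = B" using truncation_kernel_integral[OF \<alpha> \<epsilon>(1)] by (simp add: has_bochner_integral_iff)
    finally show ?thesis using True conv1 by simp
  next
    case False
    have le: "norm (?K s * g (x - s)) \<le> B / \<alpha> * (?K1 s * indicator {-B..B} (x - s))" for s
    proof (cases "0 < s \<and> x - s \<in> {-B..B}")
      case True
      then have "1 \<le> s" using False by auto
      then have "?K s \<le> ?K1 s / \<alpha>"
        using truncation_kernel_le_unit[OF \<alpha> \<epsilon>, of s] \<alpha> by (simp add: field_simps)
      then have "?K s * \<bar>g (x - s)\<bar> \<le> ?K1 s / \<alpha> * B"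
        using g[of "x - s"] True K0 K10 \<alpha> by (intro mult_mono) auto
      then show ?thesis using True K0[of s] by (simp add: abs_mult mult_ac)
    next
      case False
      then show ?thesis
        using g[of "x - s"] truncation_kernel_nonpos[OF \<alpha>, of s] by (auto simp: not_less)
    qed
    have "\<bar>conv ?K g x\<bar> \<le> (\<integral>s. B / \<alpha> * (?K1 s * indicator {-B..B} (x - s)) \<partial>lborel)"
      unfolding conv_def real_norm_def[symmetric]
    proof (rule Bochner_Integration.integral_norm_bound_integral)
      show "integrable lborel (\<lambda>s. B / \<alpha> * (?K1 s * indicator {-B..B} (x - s)))"
        using K1_int by simp
      then show "integrable lborel (\<lambda>s. ?K s * g (x - s))"
      proof (rule Bochner_Integration.integrable_bound)
        show "AE s in lborel. norm (?K s * g (x - s)) \<le> norm (B / \<alpha> * (?K1 s * indicator {-B..B} (x - s)))"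
          using le unfolding real_norm_def by (intro AE_I2 order_trans[OF le[unfolded real_norm_def] abs_ge_self])
      qed measurable
      show "norm (?K s * g (x - s)) \<le> B / \<alpha> * (?K1 s * indicator {-B..B} (x - s))" for s by (rule le)
    qed
    also have "\<dots> = B / \<alpha> * conv ?K1 (indicator {-B..B}) x" by (simp add: conv_def)
    finally show ?thesis using False by simp
  qed
qed

text \<open>
  Dominated convergence. The dominating function from \<open>conv_truncation_kernel_dominated\<close> belongs to the
  weighted space: the indicators because \<open>\<omega>\<^sup>p\<close> is locally integrable, the convolution by \<open>conv_bound\<close>.
\<close>
lemma conv_truncation_kernel_Lp_tendsto_bounded:
  assumes [measurable]: "g \<in> borel_measurable borel"
    and B: "0 \<le> B" and g: "\<And>t. \<bar>g t\<bar> \<le> B * indicator {-B..B} t"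
    and e: "\<And>n::nat. 0 < e n" "\<And>n. e n < 1" "e \<longlonglongrightarrow> 0"
  shows "(\<lambda>n. \<integral>\<^sup>+x. ennreal ((\<bar>conv (truncation_kernel \<alpha> (e n)) g x - g x\<bar> * \<omega> x) powr p) \<partial>lborel) \<longlonglongrightarrow> 0"
proof -
  let ?I = "indicator {-B..B} :: real \<Rightarrow> real"
  let ?J = "indicator {-B..B + 1} :: real \<Rightarrow> real"
  let ?k = "conv (truncation_kernel \<alpha> 1) ?I"
  define D where "D = B / \<alpha>"
  have D: "0 \<le> D" using B \<alpha> by (simp add: D_def)
  let ?w = "\<lambda>x. 3 powr p * ((B * ?J x * \<omega> x) powr p + (D * (\<bar>?k x\<bar> * \<omega> x)) powr p + (B * ?I x * \<omega> x) powr p)"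
  have N: "(\<integral>\<^sup>+t. ennreal ((\<bar>g t\<bar> * \<omega> t) powr p) \<partial>lborel) < \<infinity>"
  proof -
    have "(\<integral>\<^sup>+t. ennreal ((\<bar>g t\<bar> * \<omega> t) powr p) \<partial>lborel)
      \<le> (\<integral>\<^sup>+t. ennreal (B powr p) * (ennreal (\<omega> t powr p) * indicator {-B..B} t) \<partial>lborel)"
    proof (rule nn_integral_mono)
      fix t
      have "(\<bar>g t\<bar> * \<omega> t) powr p \<le> (B * ?I t * \<omega> t) powr p"
        using g[of t] \<omega>_pos[of t] p by (intro powr_mono2 mult_right_mono) auto
      then show "ennreal ((\<bar>g t\<bar> * \<omega> t) powr p) \<le> ennreal (B powr p) * (ennreal (\<omega> t powr p) * indicator {-B..B} t)"
        by (cases "t \<in> {-B..B}") (use g[of t] in \<open>simp_all add: powr_mult ennreal_leI flip: ennreal_mult\<close>)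
    qed
    also have "\<dots> < \<infinity>" using nn_Wp_finite by (simp add: nn_integral_cmult ennreal_mult_less_top)
    finally show ?thesis .
  qed
  have N1: "(\<integral>\<^sup>+t. ennreal ((\<bar>?I t\<bar> * \<omega> t) powr p) \<partial>lborel) < \<infinity>"
  proof -
    have "(\<integral>\<^sup>+t. ennreal ((\<bar>?I t\<bar> * \<omega> t) powr p) \<partial>lborel) = (\<integral>\<^sup>+t. ennreal (\<omega> t powr p) * indicator {-B..B} t \<partial>lborel)"
      by (intro nn_integral_cong) (auto split: split_indicator)
    then show ?thesis using nn_Wp_finite by simp
  qed
  have "(\<lambda>n. \<integral>\<^sup>+x. ennreal ((\<bar>conv (truncation_kernel \<alpha> (e n)) g x - g x\<bar> * \<omega> x) powr p) \<partial>lborel)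
    \<longlonglongrightarrow> (\<integral>\<^sup>+x. 0 \<partial>(lborel :: real measure))"
  proof (rule nn_integral_dominated_convergence[where w="\<lambda>x. ennreal (?w x)"])
    fix n
    show "AE x in lborel. ennreal ((\<bar>conv (truncation_kernel \<alpha> (e n)) g x - g x\<bar> * \<omega> x) powr p) \<le> ennreal (?w x)"
    proof (intro AE_I2 ennreal_leI)
      fix x
      have "\<bar>conv (truncation_kernel \<alpha> (e n)) g x - g x\<bar>
        \<le> \<bar>B * ?J x + D * \<bar>?k x\<bar> + B * ?I x\<bar>"
        using conv_truncation_kernel_dominated[OF assms(1) B g e(1) less_imp_le[OF e(2)], of n x, folded D_def]
          g[of x] mult_left_mono[OF abs_ge_self[of "?k x"] D] by linarith
      then have "(\<bar>conv (truncation_kernel \<alpha> (e n)) g x - g x\<bar> * \<omega> x) powr p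
        \<le> (\<bar>B * ?J x + D * \<bar>?k x\<bar> + B * ?I x\<bar> * \<omega> x) powr p"
        using \<omega>_pos[of x] p by (intro powr_mono2 mult_right_mono) auto
      also have "\<dots> \<le> (3 powr p * (\<bar>B * ?J x\<bar> powr p + \<bar>D * \<bar>?k x\<bar>\<bar> powr p + \<bar>B * ?I x\<bar> powr p)) * \<omega> x powr p"
        unfolding powr_mult[of "\<bar>_\<bar>"] using p by (intro mult_right_mono abs_add3_powr_le) auto
      also have "\<dots> = ?w x"
        using B D by (simp add: powr_mult distrib_left distrib_right mult_ac)
      finally show "(\<bar>conv (truncation_kernel \<alpha> (e n)) g x - g x\<bar> * \<omega> x) powr p \<le> ?w x" .
    qed
  next
    have "(\<integral>\<^sup>+x. ennreal (?w x) \<partial>lborel) = (\<integral>\<^sup>+x. ennreal (3 powr p) * (ennreal (B powr p) * (ennreal (\<omega> x powr p) * indicator {-B..B + 1} x)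
      + ennreal (D powr p) * ennreal ((\<bar>?k x\<bar> * \<omega> x) powr p)
      + ennreal (B powr p) * (ennreal (\<omega> x powr p) * indicator {-B..B} x)) \<partial>lborel)"
      by (intro nn_integral_cong) (auto simp: powr_mult ennreal_mult split: split_indicator)
    also have "\<dots> = ennreal (3 powr p) * (ennreal (B powr p) * (\<integral>\<^sup>+x. ennreal (\<omega> x powr p) * indicator {-B..B + 1} x \<partial>lborel)
      + ennreal (D powr p) * (\<integral>\<^sup>+x. ennreal ((\<bar>?k x\<bar> * \<omega> x) powr p) \<partial>lborel)
      + ennreal (B powr p) * (\<integral>\<^sup>+x. ennreal (\<omega> x powr p) * indicator {-B..B} x \<partial>lborel))"
      by (simp add: nn_integral_cmult nn_integral_add)
    also have "\<dots> < \<infinity>"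
    proof -
      have "(\<integral>\<^sup>+x. ennreal ((\<bar>?k x\<bar> * \<omega> x) powr p) \<partial>lborel)
        \<le> ennreal ((4 * C) powr p) * (\<integral>\<^sup>+t. ennreal ((\<bar>?I t\<bar> * \<omega> t) powr p) \<partial>lborel)"
        by (rule conv_truncation_kernel_bound[OF _ _ N1]) auto
      also have "\<dots> < \<infinity>" using N1 by (simp add: ennreal_mult_less_top)
      finally show ?thesis using nn_Wp_finite by (simp add: ennreal_mult_less_top)
    qed
    finally show "(\<integral>\<^sup>+x. ennreal (?w x) \<partial>lborel) < \<infinity>" .
  next
    have e_lim: "filterlim e (at_right 0) sequentially"
      using e by (intro tendsto_imp_filterlim_at_right always_eventually) auto
    show "AE x in lborel. (\<lambda>n. ennreal ((\<bar>conv (truncation_kernel \<alpha> (e n)) g x - g x\<bar> * \<omega> x) powr p)) \<longlonglongrightarrow> 0"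
      using AE_conv_truncation_kernel_tendsto[OF assms(1) N]
    proof eventually_elim
      case (elim x)
      have "(\<lambda>n. conv (truncation_kernel \<alpha> (e n)) g x) \<longlonglongrightarrow> g x"
        by (rule filterlim_compose[OF elim e_lim])
      then have "(\<lambda>n. \<bar>conv (truncation_kernel \<alpha> (e n)) g x - g x\<bar> * \<omega> x) \<longlonglongrightarrow> 0"
        by (intro tendsto_mult_left_zero tendsto_rabs_zero) (simp add: LIM_zero_iff)
      then have "(\<lambda>n. (\<bar>conv (truncation_kernel \<alpha> (e n)) g x - g x\<bar> * \<omega> x) powr p) \<longlonglongrightarrow> 0"
        using p \<omega>_pos[of x] by (intro tendsto_zero_powrI[where b=p]) (auto simp: less_imp_le)
      from tendsto_ennrealI[OF this] show ?case by simp
    qed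
  qed auto
  then show ?thesis by simp
qed

lemma truncations_tendsto:
  assumes [measurable]: "g \<in> borel_measurable borel"
    and N: "(\<integral>\<^sup>+t. ennreal ((\<bar>g t\<bar> * \<omega> t) powr p) \<partial>lborel) < \<infinity>"
  shows "(\<lambda>n. \<integral>\<^sup>+t. ennreal ((\<bar>if \<bar>t\<bar> \<le> real n \<and> \<bar>g t\<bar> \<le> real n then 0 else g t\<bar> * \<omega> t) powr p) \<partial>lborel) \<longlonglongrightarrow> 0"
proof -
  have "(\<lambda>n. \<integral>\<^sup>+t. ennreal ((\<bar>if \<bar>t\<bar> \<le> real n \<and> \<bar>g t\<bar> \<le> real n then 0 else g t\<bar> * \<omega> t) powr p) \<partial>lborel)
     \<longlonglongrightarrow> (\<integral>\<^sup>+t. 0 \<partial>(lborel :: real measure))"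
  proof (rule nn_integral_dominated_convergence[where w="\<lambda>t. ennreal ((\<bar>g t\<bar> * \<omega> t) powr p)"])
    show "AE t in lborel. (\<lambda>n. ennreal ((\<bar>if \<bar>t\<bar> \<le> real n \<and> \<bar>g t\<bar> \<le> real n then 0 else g t\<bar> * \<omega> t) powr p)) \<longlonglongrightarrow> 0"
    proof (rule AE_I2)
      fix t
      obtain m :: nat where m: "max \<bar>t\<bar> \<bar>g t\<bar> < real m" using reals_Archimedean2 by blast
      have "\<forall>\<^sub>F n in sequentially. ennreal ((\<bar>if \<bar>t\<bar> \<le> real n \<and> \<bar>g t\<bar> \<le> real n then 0 else g t\<bar> * \<omega> t) powr p) = 0"
        using eventually_ge_at_top[of m]
      proof eventually_elim
        case (elim n)
        then have "real m \<le> real n" by simp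
        then have "\<bar>t\<bar> \<le> real n" "\<bar>g t\<bar> \<le> real n" using m by linarith+
        then show ?case by simp
      qed
      then show "(\<lambda>n. ennreal ((\<bar>if \<bar>t\<bar> \<le> real n \<and> \<bar>g t\<bar> \<le> real n then 0 else g t\<bar> * \<omega> t) powr p)) \<longlonglongrightarrow> 0"
        by (rule tendsto_eventually)
    qed
  qed (use N in \<open>auto intro!: AE_I2\<close>)
  then show ?thesis by simp
qed

text \<open>
  Split \<open>g\<close> into its truncation \<open>g1 m\<close> and a remainder \<open>g2 m\<close> of small norm. The uniform bound
  \<open>conv_bound\<close> keeps the contribution of the remainder small for every \<open>\<epsilon>\<close> at once.
\<close>
lemma conv_truncation_kernel_Lp_tendsto:
  assumes [measurable]: "g \<in> borel_measurable borel"
    and N: "(\<integral>\<^sup>+t. ennreal ((\<bar>g t\<bar> * \<omega> t) powr p) \<partial>lborel) < \<infinity>"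
  shows "((\<lambda>\<epsilon>. \<integral>\<^sup>+x. ennreal ((\<bar>conv (truncation_kernel \<alpha> \<epsilon>) g x - g x\<bar> * \<omega> x) powr p) \<partial>lborel) \<longlongrightarrow> 0) (at_right 0)"
proof (rule tendsto_at_right_sequentially[OF zero_less_one])
  fix e :: "nat \<Rightarrow> real"
  assume e: "\<And>n. 0 < e n" "\<And>n. e n < 1" "e \<longlonglongrightarrow> 0"
  let ?D = "\<lambda>g n. \<integral>\<^sup>+x. ennreal ((\<bar>conv (truncation_kernel \<alpha> (e n)) g x - g x\<bar> * \<omega> x) powr p) \<partial>lborel"
  let ?A = "ennreal ((4 * C) powr p)"
  define g1 where "g1 = (\<lambda>(m::nat) t. if \<bar>t\<bar> \<le> real m \<and> \<bar>g t\<bar> \<le> real m then g t else 0)"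
  define g2 where "g2 = (\<lambda>(m::nat) t. if \<bar>t\<bar> \<le> real m \<and> \<bar>g t\<bar> \<le> real m then 0 else g t)"
  define R where "R = (\<lambda>m. \<integral>\<^sup>+t. ennreal ((\<bar>g2 m t\<bar> * \<omega> t) powr p) \<partial>lborel)"
  have meas [measurable]: "g1 m \<in> borel_measurable borel" "g2 m \<in> borel_measurable borel" for m
    unfolding g1_def g2_def by measurable
  have R0: "R \<longlonglongrightarrow> 0" unfolding R_def g2_def by (rule truncations_tendsto[OF assms])
  have N2: "R m < \<infinity>" for m
  proof -
    have "R m \<le> (\<integral>\<^sup>+t. ennreal ((\<bar>g t\<bar> * \<omega> t) powr p) \<partial>lborel)"
      unfolding R_def by (intro nn_integral_mono) (auto simp: g2_def)
    then show ?thesis using N by (rule le_less_trans)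
  qed
  have N1: "(\<integral>\<^sup>+t. ennreal ((\<bar>g1 m t\<bar> * \<omega> t) powr p) \<partial>lborel) < \<infinity>" for m
  proof -
    have "(\<integral>\<^sup>+t. ennreal ((\<bar>g1 m t\<bar> * \<omega> t) powr p) \<partial>lborel) \<le> (\<integral>\<^sup>+t. ennreal ((\<bar>g t\<bar> * \<omega> t) powr p) \<partial>lborel)"
      by (intro nn_integral_mono) (auto simp: g1_def)
    then show ?thesis using N by (rule le_less_trans)
  qed
  have split: "?D g n \<le> ennreal (3 powr p) * (?D (g1 m) n + (?A + 1) * R m)" for m n
  proof -
    let ?K = "truncation_kernel \<alpha> (e n)"
    have "AE x in lborel. ennreal ((\<bar>conv ?K g x - g x\<bar> * \<omega> x) powr p)
       \<le> ennreal (3 powr p) * (ennreal ((\<bar>conv ?K (g1 m) x - g1 m x\<bar> * \<omega> x) powr p)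
         + ennreal ((\<bar>conv ?K (g2 m) x\<bar> * \<omega> x) powr p) + ennreal ((\<bar>g2 m x\<bar> * \<omega> x) powr p))"
      using fractional_integral_finite[OF meas(1) N1[of m]] fractional_integral_finite[OF meas(2) N2[of m, unfolded R_def]]
    proof eventually_elim
      case (elim x)
      have "conv ?K g x = (\<integral>s. ?K s * g1 m (x - s) + ?K s * g2 m (x - s) \<partial>lborel)"
        unfolding conv_def by (intro Bochner_Integration.integral_cong) (auto simp: g1_def g2_def)
      also have "\<dots> = conv ?K (g1 m) x + conv ?K (g2 m) x"
        unfolding conv_def
        using elim by (intro Bochner_Integration.integral_add integrable_truncation_kernel_conv \<alpha> e(1)) auto
      finally have "conv ?K g x - g x = (conv ?K (g1 m) x - g1 m x) + conv ?K (g2 m) x + (- g2 m x)"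
        by (simp add: g1_def g2_def)
      then have "\<bar>conv ?K g x - g x\<bar> powr p \<le> 3 powr p *
          (\<bar>conv ?K (g1 m) x - g1 m x\<bar> powr p + \<bar>conv ?K (g2 m) x\<bar> powr p + \<bar>g2 m x\<bar> powr p)"
        using abs_add3_powr_le[of p "conv ?K (g1 m) x - g1 m x" "conv ?K (g2 m) x" "- g2 m x"] p by simp
      then have "\<bar>conv ?K g x - g x\<bar> powr p * \<omega> x powr p \<le> 3 powr p *
          (\<bar>conv ?K (g1 m) x - g1 m x\<bar> powr p + \<bar>conv ?K (g2 m) x\<bar> powr p + \<bar>g2 m x\<bar> powr p) * \<omega> x powr p"
        by (intro mult_right_mono) auto
      then have "(\<bar>conv ?K g x - g x\<bar> * \<omega> x) powr p \<le> 3 powr p *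
          ((\<bar>conv ?K (g1 m) x - g1 m x\<bar> * \<omega> x) powr p + (\<bar>conv ?K (g2 m) x\<bar> * \<omega> x) powr p + (\<bar>g2 m x\<bar> * \<omega> x) powr p)"
        by (simp add: powr_mult distrib_left distrib_right mult_ac)
      then show ?case
        by (simp add: ennreal_leI flip: ennreal_mult ennreal_plus)
    qed
    then have "?D g n \<le> (\<integral>\<^sup>+x. ennreal (3 powr p) * (ennreal ((\<bar>conv ?K (g1 m) x - g1 m x\<bar> * \<omega> x) powr p)
         + ennreal ((\<bar>conv ?K (g2 m) x\<bar> * \<omega> x) powr p) + ennreal ((\<bar>g2 m x\<bar> * \<omega> x) powr p)) \<partial>lborel)"
      by (rule nn_integral_mono_AE)
    also have "\<dots> = ennreal (3 powr p) * (?D (g1 m) n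
         + (\<integral>\<^sup>+x. ennreal ((\<bar>conv ?K (g2 m) x\<bar> * \<omega> x) powr p) \<partial>lborel) + R m)"
      unfolding R_def by (simp add: nn_integral_cmult nn_integral_add)
    also have "\<dots> \<le> ennreal (3 powr p) * (?D (g1 m) n + ?A * R m + R m)"
      using conv_truncation_kernel_bound[OF e(1) _ N2[unfolded R_def]]
      by (intro mult_left_mono add_mono order_refl) (auto simp: R_def)
    finally show ?thesis by (simp add: distrib_right add.assoc)
  qed
  show "(\<lambda>n. ?D g n) \<longlonglongrightarrow> 0"
  proof (rule order_tendstoI)
    fix a :: ennreal assume "0 < a"
    then obtain b where b: "0 < b" "ennreal b \<le> a"
    proof (cases a)
      case (real r)
      then show ?thesis using that[of r] \<open>0 < a\<close> by simp
    qed (use that[of 1] in auto)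
    have "(\<lambda>m. ennreal (3 powr p) * ((?A + 1) * R m)) \<longlonglongrightarrow> ennreal (3 powr p) * ((?A + 1) * 0)"
      by (intro ennreal_tendsto_cmult R0) auto
    then have "\<forall>\<^sub>F m in sequentially. ennreal (3 powr p) * ((?A + 1) * R m) < ennreal (b / 2)"
      using b by (intro order_tendstoD(2)) auto
    then obtain m where m: "ennreal (3 powr p) * ((?A + 1) * R m) < ennreal (b / 2)"
      by (auto simp: eventually_sequentially)
    have "?D (g1 m) \<longlonglongrightarrow> 0"
      by (rule conv_truncation_kernel_Lp_tendsto_bounded[where B="real m"])
         (use e in \<open>auto simp: g1_def split: split_indicator\<close>)
    then have "(\<lambda>n. ennreal (3 powr p) * ?D (g1 m) n) \<longlonglongrightarrow> ennreal (3 powr p) * 0"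
      by (intro ennreal_tendsto_cmult) auto
    then have "\<forall>\<^sub>F n in sequentially. ennreal (3 powr p) * ?D (g1 m) n < ennreal (b / 2)"
      using b by (intro order_tendstoD(2)) auto
    then show "\<forall>\<^sub>F n in sequentially. ?D g n < a"
    proof eventually_elim
      case (elim n)
      have "?D g n \<le> ennreal (3 powr p) * ?D (g1 m) n + ennreal (3 powr p) * ((?A + 1) * R m)"
        using split[of n m] by (simp add: distrib_left)
      also have "\<dots> < ennreal (b / 2) + ennreal (b / 2)"
        using elim m by (intro add_strict_mono)
      also have "\<dots> = ennreal b" using b by (simp flip: ennreal_plus)
      also have "\<dots> \<le> a" by (rule b)
      finally show ?case .
    qed
  qed auto
qed

end

section \<open>Passage to the weighted operators\<close>

text \<open>
  The data of the theorem are Lebesgue measurable, while products and Fubini's theorem are at home with Borel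
  functions. The next two lemmas allow every Lebesgue measurable function to be replaced by a Borel
  function that agrees with it almost everywhere.
\<close>

lemma AE_eq_borel_imp_lebesgue_measurable:
  fixes F H :: "real \<Rightarrow> real"
  assumes [measurable]: "H \<in> borel_measurable borel" and eq: "AE x in lborel. F x = H x"
  shows "F \<in> borel_measurable lebesgue"
proof (rule measurableI)
  fix A :: "real set" assume [measurable]: "A \<in> sets borel"
  have "H -` A \<inter> space borel \<in> sets borel" by measurable
  then have "H -` A \<in> sets lebesgue" by simp
  moreover have "AE x in lebesgue. x \<in> H -` A \<longleftrightarrow> x \<in> F -` A"
    using eq by (intro AE_completion) (auto elim: eventually_mono)
  ultimately have "F -` A \<in> sets lebesgue"
    by (intro completion.in_sets_AE[of "H -` A" "F -` A"]) auto
  then show "F -` A \<inter> space lebesgue \<in> sets lebesgue" by simp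
qed simp

lemma lebesgue_integral_eq_lborel:
  fixes F H :: "real \<Rightarrow> real"
  assumes H[measurable]: "H \<in> borel_measurable borel" and eq: "AE x in lborel. F x = H x"
  shows "integral\<^sup>L lebesgue F = integral\<^sup>L lborel H"
    and "integrable lebesgue F \<longleftrightarrow> integrable lborel H"
proof -
  have F: "F \<in> borel_measurable lebesgue"
    by (rule AE_eq_borel_imp_lebesgue_measurable[OF assms])
  have H': "H \<in> borel_measurable lborel" "H \<in> borel_measurable lebesgue" by (simp_all add: measurable_completion)
  show "integral\<^sup>L lebesgue F = integral\<^sup>L lborel H"
    using integral_cong_AE[OF F H'(2) AE_completion[OF eq]] integral_completion[OF H'(1)] by simp
  show "integrable lebesgue F \<longleftrightarrow> integrable lborel H"
    using integrable_cong_AE[OF F H'(2) AE_completion[OF eq]] integrable_completion[OF H'(1)] by simp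
qed

lemma integrating_factor_pos: "0 < integrating_factor a x0 x"
  by (simp add: integrating_factor_def)

lemma integrating_factor_continuous:
  assumes a: "continuous_on UNIV a"
  shows "continuous_on UNIV (integrating_factor a x0)"
  unfolding continuous_on_eq_continuous_at[OF open_UNIV]
proof
  fix x :: real
  let ?l = "min x x0 - 1" and ?u = "max x x0 + 1"
  have "((\<lambda>u. LBINT y=x0..u. a y) has_vector_derivative a x) (at x within {?l..?u})"
    by (rule interval_integral_FTC2) (use a in \<open>auto intro: continuous_on_subset\<close>)
  moreover have "at x within {?l..?u} = at x"
    by (rule at_within_interior) (auto simp: interior_atLeastAtMost_real)
  ultimately have "isCont (\<lambda>u::real. LBINT y=x0..u. a y) x"
    by (metis has_vector_derivative_continuous)
  then show "isCont (integrating_factor a x0) x"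
    unfolding integrating_factor_def by (intro continuous_intros)
qed

lemma inverse_abs_Gamma_uminus:
  assumes "0 < \<alpha>" "\<alpha> < (1::real)"
  shows "1 / \<bar>Gamma (- \<alpha>)\<bar> = \<alpha> / Gamma (1 - \<alpha>)"
proof -
  have "- \<alpha> \<notin> \<int>\<^sub>\<le>\<^sub>0"
  proof
    assume "- \<alpha> \<in> \<int>\<^sub>\<le>\<^sub>0"
    then obtain n where "- \<alpha> = of_int n" by (auto elim: nonpos_Ints_cases)
    then have "-1 < real_of_int n" "real_of_int n < 0" using assms by linarith+
    then show False by simp
  qed
  then have "Gamma (1 - \<alpha>) = - \<alpha> * Gamma (- \<alpha>)"
    using Gamma_plus1[of "- \<alpha>"] by simp
  moreover have "0 < Gamma (1 - \<alpha>)" using assms by (intro Gamma_real_pos) auto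
  ultimately have "\<bar>Gamma (- \<alpha>)\<bar> = Gamma (1 - \<alpha>) / \<alpha>"
    using assms by (simp add: mult_less_0_iff field_simps)
  then show ?thesis by simp
qed

context
  fixes a f g :: "real \<Rightarrow> real" and x0 \<alpha> :: real
  assumes a: "continuous_on UNIV a" and \<alpha>: "0 < \<alpha>" "\<alpha> < 1"
    and g[measurable]: "g \<in> borel_measurable borel"
    and fg: "AE x in lborel. f x / integrating_factor a x0 x = g x"
begin

lemma left_neg_power_eq_conv:
  "left_neg_power a \<alpha> f x / integrating_factor a x0 x = conv (riesz_kernel \<alpha>) g x"
proof -
  have G: "0 < Gamma \<alpha>" using \<alpha> by (intro Gamma_real_pos)
  let ?H = "\<lambda>t. indicator {..x} t * (g t / (x - t) powr (1 - \<alpha>)) :: real"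
  have [measurable]: "?H \<in> borel_measurable borel" by measurable
  have "(LINT t:{..x}|lebesgue. f t / integrating_factor a x0 t / (x - t) powr (1 - \<alpha>)) = integral\<^sup>L lborel ?H"
    unfolding set_lebesgue_integral_def
    by (rule lebesgue_integral_eq_lborel, measurable) (use fg in eventually_elim, simp)
  also have "\<dots> = (\<integral>s. ?H (x - s) \<partial>lborel)"
    by (subst lborel_integral_real_affine[where c="-1" and t=x]) auto
  also have "\<dots> = (\<integral>s. Gamma \<alpha> * (riesz_kernel \<alpha> s * g (x - s)) \<partial>lborel)"
  proof (intro Bochner_Integration.integral_cong refl)
    fix s
    have "1 / s powr (1 - \<alpha>) = s powr (\<alpha> - 1)" using powr_minus_divide[of s "1 - \<alpha>"] by simp
    then have "g (x - s) / s powr (1 - \<alpha>) = s powr (\<alpha> - 1) * g (x - s)" by (simp add: divide_inverse mult.commute)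
    then show "?H (x - s) = Gamma \<alpha> * (riesz_kernel \<alpha> s * g (x - s))"
      using G by (cases "s = 0") (auto simp: riesz_kernel_def split: split_indicator)
  qed
  also have "\<dots> = Gamma \<alpha> * conv (riesz_kernel \<alpha>) g x" by (simp add: conv_def)
  finally show ?thesis
    unfolding left_neg_power_eq[OF a, of _ _ _ x0] using G integrating_factor_pos[of a x0 x] by simp
qed

text \<open>
  Here \<open>left_neg_power a \<alpha> f / E\<close> equals the Riesz potential of \<open>g\<close> at every point, not just almost
  everywhere, because changing \<open>f\<close> on a null set changes no value of an integral.
\<close>
lemma left_trunc_power_eq_conv:
  assumes \<epsilon>: "0 < \<epsilon>"
    and fin: "(\<integral>\<^sup>+s. ennreal (s powr (\<alpha> - 1) * \<bar>g (x - s)\<bar>) * indicator {0<..} s \<partial>lborel) < \<infinity>"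
  shows "left_trunc_power a x0 \<alpha> \<epsilon> (left_neg_power a \<alpha> f) x
    = integrating_factor a x0 x * conv (truncation_kernel \<alpha> \<epsilon>) g x"
proof -
  let ?I = "conv (riesz_kernel \<alpha>) g"
  let ?H = "\<lambda>t. indicator {..x - \<epsilon>} t * ((?I x - ?I t) / (x - t) powr (1 + \<alpha>)) :: real"
  have [measurable]: "?H \<in> borel_measurable borel" by measurable
  have "(LINT t:{..x - \<epsilon>}|lebesgue. (?I x - ?I t) / (x - t) powr (1 + \<alpha>)) = integral\<^sup>L lborel ?H"
    unfolding set_lebesgue_integral_def by (rule lebesgue_integral_eq_lborel) auto
  also have "\<dots> = (\<integral>y. ?H (x - y) \<partial>lborel)"
    by (subst lborel_integral_real_affine[where c="-1" and t=x]) auto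
  also have "\<dots> = (\<integral>y. indicator {\<epsilon><..} y * ((?I x - ?I (x - y)) / y powr (1 + \<alpha>)) \<partial>lborel)"
  proof (rule integral_cong_AE)
    show "AE y in lborel. ?H (x - y) = indicator {\<epsilon><..} y * ((?I x - ?I (x - y)) / y powr (1 + \<alpha>))"
      using AE_lborel_singleton[of \<epsilon>] by eventually_elim (auto split: split_indicator)
  qed measurable
  finally have "left_trunc_power a x0 \<alpha> \<epsilon> (left_neg_power a \<alpha> f) x = integrating_factor a x0 x *
     (\<alpha> / Gamma (1 - \<alpha>) * (\<integral>y. indicator {\<epsilon><..} y * ((?I x - ?I (x - y)) / y powr (1 + \<alpha>)) \<partial>lborel))"
    unfolding left_trunc_power_def left_neg_power_eq_conv inverse_abs_Gamma_uminus[OF \<alpha>]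
    by (simp only: mult_ac)
  then show ?thesis
    by (simp only: truncated_derivative_of_riesz_potential[OF \<alpha> \<epsilon> g fin])
qed

end

text \<open>The factor \<open>E powr (- p)\<close> of the density cancels the integrating factor in \<open>F = E H\<close>.\<close>
lemma nn_integral_weighted_measure:
  assumes a: "continuous_on UNIV a"
    and \<omega>: "\<omega> \<in> borel_measurable lebesgue"
    and [measurable]: "w \<in> borel_measurable borel" "H \<in> borel_measurable borel"
    and w: "AE x in lborel. \<omega> x = w x" and H: "AE x in lborel. F x = integrating_factor a x0 x * H x"
  shows "(\<integral>\<^sup>+x. ennreal (\<bar>F x\<bar> powr p) \<partial>weighted_measure a x0 p \<omega>) = (\<integral>\<^sup>+x. ennreal ((\<bar>H x\<bar> * w x) powr p) \<partial>lborel)"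
    and "F \<in> borel_measurable (weighted_measure a x0 p \<omega>)"
proof -
  let ?E = "integrating_factor a x0"
  have E [measurable]: "?E \<in> borel_measurable borel"
    by (rule borel_measurable_continuous_onI[OF integrating_factor_continuous[OF a]])
  have El: "?E \<in> borel_measurable lebesgue" by (simp add: measurable_completion)
  have F: "F \<in> borel_measurable lebesgue"
    by (rule AE_eq_borel_imp_lebesgue_measurable[OF _ H]) measurable
  show "F \<in> borel_measurable (weighted_measure a x0 p \<omega>)"
    using F by (simp add: weighted_measure_def)
  have "(\<integral>\<^sup>+x. ennreal (\<bar>F x\<bar> powr p) \<partial>weighted_measure a x0 p \<omega>)
    = (\<integral>\<^sup>+x. ennreal (?E x powr (- p) * \<omega> x powr p) * ennreal (\<bar>F x\<bar> powr p) \<partial>lebesgue)"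
    unfolding weighted_measure_def
  proof (rule nn_integral_density)
    note [measurable] = El F \<omega>
    show "(\<lambda>x. ennreal (?E x powr (- p) * \<omega> x powr p)) \<in> borel_measurable lebesgue" by measurable
    show "(\<lambda>x. ennreal (\<bar>F x\<bar> powr p)) \<in> borel_measurable lebesgue" by measurable
  qed
  also have "\<dots> = (\<integral>\<^sup>+x. ennreal (?E x powr (- p) * \<omega> x powr p) * ennreal (\<bar>F x\<bar> powr p) \<partial>lborel)"
    by (rule nn_integral_completion)
  also have "\<dots> = (\<integral>\<^sup>+x. ennreal ((\<bar>H x\<bar> * w x) powr p) \<partial>lborel)"
  proof (rule nn_integral_cong_AE, use w H in eventually_elim)
    fix x assume x: "\<omega> x = w x" "F x = ?E x * H x"
    have "?E x powr (- p) * ?E x powr p = 1"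
      using integrating_factor_pos[of a x0 x] by (simp flip: powr_add)
    then have "?E x powr (- p) * w x powr p * (?E x * \<bar>H x\<bar>) powr p = (\<bar>H x\<bar> * w x) powr p"
      by (simp add: powr_mult mult_ac)
    then show "ennreal (?E x powr (- p) * \<omega> x powr p) * ennreal (\<bar>F x\<bar> powr p) = ennreal ((\<bar>H x\<bar> * w x) powr p)"
      using x integrating_factor_pos[of a x0 x] by (simp add: abs_mult flip: ennreal_mult')
  qed
  finally show "(\<integral>\<^sup>+x. ennreal (\<bar>F x\<bar> powr p) \<partial>weighted_measure a x0 p \<omega>) = (\<integral>\<^sup>+x. ennreal ((\<bar>H x\<bar> * w x) powr p) \<partial>lborel)" .
qed

lemma A_minus_imp_one_sided_weight:
  assumes \<alpha>: "0 < \<alpha>" "\<alpha> < 1" and p: "1 < p" "p < 1 / \<alpha>" and q: "1 / q = 1 / p - \<alpha>"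
    and \<omega>: "\<omega> \<in> A_minus p q"
    and w[measurable]: "w \<in> borel_measurable borel" and w_pos: "\<And>x. 0 < w x" and eq: "AE x in lborel. \<omega> x = w x"
  obtains C where "one_sided_weight \<alpha> p q (conj_exponent p) C w"
proof -
  define r where "r = conj_exponent p"
  have r: "1 / p + 1 / r = 1" "1 < r" using p by (auto simp: r_def conj_exponent_def field_simps)
  have "\<alpha> < 1 / p" using p \<alpha> by (simp add: field_simps)
  then have "0 < 1 / q" using q by simp
  then have q0: "0 < q" by simp
  from \<omega> obtain C where C: "0 < C"
    and int_q: "\<And>x h. 0 < h \<Longrightarrow> set_integrable lebesgue {x..x+h} (\<lambda>y. \<omega> y powr q)"
    and int_r: "\<And>x h. 0 < h \<Longrightarrow> set_integrable lebesgue {x-h..x} (\<lambda>y. \<omega> y powr (- r))"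
    and le: "\<And>x h. 0 < h \<Longrightarrow> (1 / h * (LINT y:{x..x+h}|lebesgue. \<omega> y powr q)) powr (1 / q) *
        (1 / h * (LINT y:{x-h..x}|lebesgue. \<omega> y powr (- r))) powr (1 / r) \<le> C"
    unfolding A_minus_def r_def by auto
  have AEw: "AE y in lborel. indicator A y *\<^sub>R \<omega> y powr b = indicator A y *\<^sub>R w y powr b" for A and b :: real
    using eq by eventually_elim simp
  have int_eq: "set_integrable lebesgue {u..v} (\<lambda>y. \<omega> y powr b) \<longleftrightarrow> set_integrable lborel {u..v} (\<lambda>y. w y powr b)"
    and lint_eq: "(LINT y:{u..v}|lebesgue. \<omega> y powr b) = (LBINT y:{u..v}. w y powr b)" for u v b :: real
    unfolding set_integrable_def set_lebesgue_integral_def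
    by (rule lebesgue_integral_eq_lborel[OF _ AEw], measurable)+
  have "one_sided_weight \<alpha> p q r C w"
  proof (unfold_locales)
    fix u v :: real
    let ?h = "\<bar>v - u\<bar> + 1"
    have "set_integrable lborel {u..u + ?h} (\<lambda>y. w y powr q)" "set_integrable lborel {v - ?h..v} (\<lambda>y. w y powr (- r))"
      using int_q[of ?h u] int_r[of ?h v] by (auto simp: int_eq)
    then show "set_integrable lborel {u..v} (\<lambda>y. w y powr q)" "set_integrable lborel {u..v} (\<lambda>y. w y powr (- r))"
      by (auto elim!: set_integrable_subset)
  next
    fix x h :: real assume h: "0 < h"
    let ?W = "LBINT y:{x..x+h}. w y powr q" and ?S = "LBINT y:{x-h..x}. w y powr (- r)"
    have "?W powr (1 / q) * ?S powr (1 / r)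
      = (1 / h * ?W) powr (1 / q) * (1 / h * ?S) powr (1 / r) * h powr (1 / q + 1 / r)"
      using h by (simp add: powr_mult powr_divide powr_add)
    also have "\<dots> \<le> C * h powr (1 / q + 1 / r)"
      using le[OF h, of x] by (intro mult_right_mono) (auto simp: lint_eq)
    also have "1 / q + 1 / r = 1 - \<alpha>" using q r by simp
    finally show "?W powr (1 / q) * ?S powr (1 / r) \<le> C * h powr (1 - \<alpha>)" .
  qed (use \<alpha> p r q q0 C w w_pos in auto)
  then show ?thesis using that unfolding r_def by blast
qed

theorem theorem2p17:
  fixes a \<omega> f :: "real \<Rightarrow> real" and x0 \<alpha> p q :: real
  assumes "continuous_on UNIV a"
    and "0 < \<alpha>" and "\<alpha> < 1"
    and "1 < p" and "p < 1 / \<alpha>"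
    and "1 / q = 1 / p - \<alpha>"
    and "\<omega> \<in> A_minus p q"
    and "f \<in> Lp_space (weighted_measure a x0 p \<omega>) p"
  shows "(AE x in lebesgue.
           ((\<lambda>\<epsilon>. left_trunc_power a x0 \<alpha> \<epsilon> (left_neg_power a \<alpha> f) x) \<longlongrightarrow> f x) (at_right 0)) \<and>
         tendsto_Lp (weighted_measure a x0 p \<omega>) p
           (\<lambda>\<epsilon>. left_trunc_power a x0 \<alpha> \<epsilon> (left_neg_power a \<alpha> f)) f (at_right 0)"
proof -
  let ?E = "integrating_factor a x0" and ?M = "weighted_measure a x0 p \<omega>"
  let ?T = "\<lambda>\<epsilon>. left_trunc_power a x0 \<alpha> \<epsilon> (left_neg_power a \<alpha> f)"
  note a = assms(1) and \<alpha> = assms(2,3)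
  have E0: "0 < ?E x" for x by (rule integrating_factor_pos)
  have E [measurable]: "?E \<in> borel_measurable borel"
    by (rule borel_measurable_continuous_onI[OF integrating_factor_continuous[OF a]])
  have weight: "\<omega> \<in> borel_measurable lebesgue" "\<And>x. 0 < \<omega> x"
    using assms(7) by (auto simp: A_minus_def)
  have f: "f \<in> borel_measurable lebesgue" and f_int: "integrable ?M (\<lambda>x. \<bar>f x\<bar> powr p)"
    using assms(8) by (auto simp: Lp_space_def weighted_measure_def)
  have "?E \<in> borel_measurable lebesgue" by (simp add: measurable_completion)
  with f have "(\<lambda>x. f x / ?E x) \<in> borel_measurable lebesgue" by (rule borel_measurable_divide)
  from completion_ex_borel_measurable_real[OF this]
  obtain g where g [measurable]: "g \<in> borel_measurable borel" and fg: "AE x in lborel. f x / ?E x = g x"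
    by auto
  from completion_ex_borel_measurable_real[OF weight(1)]
  obtain w' where w' [measurable]: "w' \<in> borel_measurable borel" and w'_eq: "AE x in lborel. \<omega> x = w' x"
    by auto
  \<comment> \<open>The Borel representative may fail to be positive on a null set.\<close>
  define w where "w = (\<lambda>x. if 0 < w' x then w' x else 1)"
  have w [measurable]: "w \<in> borel_measurable borel" and w_pos: "\<And>x. 0 < w x"
    unfolding w_def by auto
  have w_eq: "AE x in lborel. \<omega> x = w x"
    using w'_eq by eventually_elim (metis weight(2) w_def)
  obtain C where "one_sided_weight \<alpha> p q (conj_exponent p) C w"
    using A_minus_imp_one_sided_weight[OF \<alpha> assms(4-7) w w_pos w_eq] by blast
  then interpret one_sided_weight \<alpha> p q "conj_exponent p" C w .
  have fEg: "AE x in lborel. f x = ?E x * g x"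
    using fg by eventually_elim (use E0 in \<open>metis less_irrefl nonzero_mult_div_cancel_left times_divide_eq_right\<close>)
  note nn = nn_integral_weighted_measure[OF a weight(1) w _ w_eq, of _ _ x0 p]
  have N: "(\<integral>\<^sup>+x. ennreal ((\<bar>g x\<bar> * w x) powr p) \<partial>lborel) < \<infinity>"
    using f_int unfolding integrable_iff_bounded nn(1)[OF g fEg, symmetric] by simp
  have T_eq: "AE x in lborel. \<forall>\<epsilon>>0. ?T \<epsilon> x = ?E x * conv (truncation_kernel \<alpha> \<epsilon>) g x"
    using fractional_integral_finite[OF g N]
    by eventually_elim (intro allI impI left_trunc_power_eq_conv[OF a \<alpha> g fg])
  have "AE x in lborel. ((\<lambda>\<epsilon>. ?T \<epsilon> x) \<longlongrightarrow> f x) (at_right 0)"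
    using T_eq AE_conv_truncation_kernel_tendsto[OF g N] fEg
  proof eventually_elim
    case (elim x)
    have "((\<lambda>\<epsilon>. ?E x * conv (truncation_kernel \<alpha> \<epsilon>) g x) \<longlongrightarrow> f x) (at_right 0)"
      unfolding elim(3) by (intro tendsto_mult tendsto_const elim(2))
    moreover have "\<forall>\<^sub>F \<epsilon> in at_right 0. ?E x * conv (truncation_kernel \<alpha> \<epsilon>) g x = ?T \<epsilon> x"
      using eventually_at_right_less[of 0] by eventually_elim (simp add: elim(1))
    ultimately show ?case by (rule Lim_transform_eventually)
  qed
  then have pointwise: "AE x in lebesgue. ((\<lambda>\<epsilon>. ?T \<epsilon> x) \<longlongrightarrow> f x) (at_right 0)"
    by (rule AE_completion)
  have T_Lp: "?T \<epsilon> \<in> Lp_space ?M p" if \<epsilon>: "0 < \<epsilon>" for \<epsilon>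
  proof -
    have T: "AE x in lborel. ?T \<epsilon> x = ?E x * conv (truncation_kernel \<alpha> \<epsilon>) g x"
      using T_eq by eventually_elim (use \<epsilon> in auto)
    have meas: "?T \<epsilon> \<in> borel_measurable ?M" by (rule nn(2)[OF _ T]) measurable
    have "(\<integral>\<^sup>+x. ennreal (\<bar>?T \<epsilon> x\<bar> powr p) \<partial>?M) = (\<integral>\<^sup>+x. ennreal ((\<bar>conv (truncation_kernel \<alpha> \<epsilon>) g x\<bar> * w x) powr p) \<partial>lborel)"
      by (rule nn(1)[OF _ T]) measurable
    also have "\<dots> \<le> ennreal ((4 * C) powr p) * (\<integral>\<^sup>+x. ennreal ((\<bar>g x\<bar> * w x) powr p) \<partial>lborel)"
      by (rule conv_truncation_kernel_bound[OF \<epsilon> g N])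
    also have "\<dots> < \<infinity>" using N by (simp add: ennreal_mult_less_top)
    finally have "integrable ?M (\<lambda>x. \<bar>?T \<epsilon> x\<bar> powr p)"
      using meas by (intro integrableI_bounded) auto
    with meas show ?thesis by (simp add: Lp_space_def)
  qed
  have norm_eq: "Lp_norm ?M p (\<lambda>x. ?T \<epsilon> x - f x)
      = enn2real (\<integral>\<^sup>+x. ennreal ((\<bar>conv (truncation_kernel \<alpha> \<epsilon>) g x - g x\<bar> * w x) powr p) \<partial>lborel) powr (1 / p)"
    if \<epsilon>: "0 < \<epsilon>" for \<epsilon>
  proof -
    have T: "AE x in lborel. ?T \<epsilon> x - f x = ?E x * (conv (truncation_kernel \<alpha> \<epsilon>) g x - g x)"
      using T_eq fEg by eventually_elim (use \<epsilon> in \<open>auto simp: right_diff_distrib\<close>)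
    have meas: "(\<lambda>x. ?T \<epsilon> x - f x) \<in> borel_measurable ?M" by (rule nn(2)[OF _ T]) measurable
    have "(\<integral>\<^sup>+x. ennreal (\<bar>?T \<epsilon> x - f x\<bar> powr p) \<partial>?M)
      = (\<integral>\<^sup>+x. ennreal ((\<bar>conv (truncation_kernel \<alpha> \<epsilon>) g x - g x\<bar> * w x) powr p) \<partial>lborel)"
      by (rule nn(1)[OF _ T]) measurable
    then show ?thesis
      unfolding Lp_norm_def using meas by (subst integral_eq_nn_integral) auto
  qed
  have "((\<lambda>\<epsilon>. enn2real (\<integral>\<^sup>+x. ennreal ((\<bar>conv (truncation_kernel \<alpha> \<epsilon>) g x - g x\<bar> * w x) powr p) \<partial>lborel)) \<longlongrightarrow> 0) (at_right 0)"
    using conv_truncation_kernel_Lp_tendsto[OF g N] by (intro tendsto_enn2real) auto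
  then have "((\<lambda>\<epsilon>. enn2real (\<integral>\<^sup>+x. ennreal ((\<bar>conv (truncation_kernel \<alpha> \<epsilon>) g x - g x\<bar> * w x) powr p) \<partial>lborel) powr (1 / p)) \<longlongrightarrow> 0) (at_right 0)"
    using assms(4) by (intro tendsto_zero_powrI[where b="1 / p"]) auto
  moreover have "\<forall>\<^sub>F \<epsilon> in at_right 0.
      enn2real (\<integral>\<^sup>+x. ennreal ((\<bar>conv (truncation_kernel \<alpha> \<epsilon>) g x - g x\<bar> * w x) powr p) \<partial>lborel) powr (1 / p)
        = Lp_norm ?M p (\<lambda>x. ?T \<epsilon> x - f x)"
    using eventually_at_right_less[of 0] by eventually_elim (simp only: norm_eq)
  ultimately have "((\<lambda>\<epsilon>. Lp_norm ?M p (\<lambda>x. ?T \<epsilon> x - f x)) \<longlongrightarrow> 0) (at_right 0)"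
    by (rule Lim_transform_eventually)
  moreover have "\<forall>\<^sub>F \<epsilon> in at_right 0. ?T \<epsilon> \<in> Lp_space ?M p"
    using eventually_at_right_less[of 0] by eventually_elim (rule T_Lp)
  ultimately have "tendsto_Lp ?M p ?T f (at_right 0)"
    unfolding tendsto_Lp_def using assms(8) by blast
  with pointwise show ?thesis by blast
qed

end
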